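(* Let $0<\alpha<n$ and $b$ be locally integrable on $\mathbb{Q}_p^n$. The following are equivalent: (T.1) $b\in\mathrm{BMO}(\mathbb{Q}_p^n)$. (T.2) $\mathcal{M}^p_{\alpha,b}$ is bounded from $L^{r(\cdot)}(\mathbb{Q}_p^n)$ to $L^{q(\cdot)}(\mathbb{Q}_p^n)$ for all $r(\cdot),q(\cdot)\in\mathscr{C}^{\log}(\mathbb{Q}_p^n)$ with $r(\cdot)\in\mathscr{P}(\mathbb{Q}_p^n)$, $r_+<n/\alpha$, $1/q(\cdot)=1/r(\cdot)-\alpha/n$. (T.3) The same boundedness holds for some such $r(\cdot),q(\cdot)$. (T.4) For some such $r(\cdot),q(\cdot)$, $$\sup_{\gamma\in\mathbb{Z},x\in\mathbb{Q}_p^n}\frac{\big\|(b-b_{B_\gamma(x)})\chi_{B_\gamma(x)}\big\|_{L^{q(\cdot)}}}{\|\chi_{B_\gamma(x)}\|_{L^{q(\cdot)}}}<\infty.\quad(\ddagger)$$ (T.5) $(\ddagger)$ holds for all such $r(\cdot),q(\cdot)$.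
   Context: Fix a prime $p$; $\mathbb{Q}_p^n$ with $|x|_p=\max_j|x_j|_p$; balls $B_\gamma(x)=\{y:|y-x|_p\le p^\gamma\}$; Haar measure with $|B_\gamma(x)|_h=p^{n\gamma}$; $\chi_E$ indicator; $f_B=|B|_h^{-1}\int_Bf$. For $0\le\alpha<n$ the maximal commutator is $\mathcal{M}^p_{\alpha,b}(f)(x)=\sup_{\gamma\in\mathbb{Z}}|B_\gamma(x)|_h^{\alpha/n-1}\int_{B_\gamma(x)}|b(x)-b(y)||f(y)|dy$. $\mathrm{BMO}(\mathbb{Q}_p^n)$: locally integrable $b$ with $\sup_{\gamma,x}|B_\gamma(x)|_h^{-1}\int_{B_\gamma(x)}|b-b_{B_\gamma(x)}|<\infty$. Variable exponents: $q_-=\operatorname{ess\,inf}q$, $q_+=\operatorname{ess\,sup}q$, $q_\pm(B)$ ess inf/sup over $B$. $\mathscr{P}$: measurable $q$ with $1<q_-\le q_+<\infty$. $L^{q(\cdot)}$ with Luxemburg norm $\|f\|_{L^{q(\cdot)}}=\inf\{\eta>0:\int(|f(x)|/\eta)^{q(x)}dx\le1\}$. $\mathscr{C}^{\log}_0$: $\gamma(q_-(B_\gamma(x))-q_+(B_\gamma(x)))\le C$ for all $\gamma,x$; $\mathscr{C}^{\log}_\infty$: $|q(x)-q(y)|\le C/\log_p(p+\min\{|x|_p,|y|_p\})$; $\mathscr{C}^{\log}=\mathscr{C}^{\log}_0\cap\mathscr{C}^{\log}_\infty$. *)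

theory Defs
  imports "HOL-Probability.Probability"
begin

text \<open>An element of Q_p is represented by its (unique) p-adic digit expansion
  sum_k a_k p^k, with digits a_k in {0..p-1} and a_k = 0 for all sufficiently
  negative k. A point of Q_p^n is a family of n such digit expansions
  (coordinates j < n; coordinates j >= n are fixed to be 0).\<close>

definition padic_digits :: "nat \<Rightarrow> (int \<Rightarrow> nat) set" where
  "padic_digits p = {a. (\<forall>k. a k < p) \<and> (\<exists>m. \<forall>k<m. a k = 0)}"

definition Qpn :: "nat \<Rightarrow> nat \<Rightarrow> (nat \<Rightarrow> int \<Rightarrow> nat) set" where
  "Qpn p n = {x. (\<forall>j<n. x j \<in> padic_digits p) \<and> (\<forall>j\<ge>n. x j = (\<lambda>_. 0))}"

text \<open>p-adic distance |a - b|_p on Q_p: the valuation of a - b is the first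
  position where the digit expansions differ.\<close>

definition padic_dist :: "nat \<Rightarrow> (int \<Rightarrow> nat) \<Rightarrow> (int \<Rightarrow> nat) \<Rightarrow> real" where
  "padic_dist p a b = (if a = b then 0 else real p powr (- real_of_int (LEAST k. a k \<noteq> b k)))"

definition Qpn_dist :: "nat \<Rightarrow> nat \<Rightarrow> (nat \<Rightarrow> int \<Rightarrow> nat) \<Rightarrow> (nat \<Rightarrow> int \<Rightarrow> nat) \<Rightarrow> real" where
  "Qpn_dist p n x y = (MAX j\<in>{..<n}. padic_dist p (x j) (y j))"

definition Qpn_norm :: "nat \<Rightarrow> nat \<Rightarrow> (nat \<Rightarrow> int \<Rightarrow> nat) \<Rightarrow> real" where
  "Qpn_norm p n x = Qpn_dist p n x (\<lambda>_ _. 0)"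

definition qball :: "nat \<Rightarrow> nat \<Rightarrow> int \<Rightarrow> (nat \<Rightarrow> int \<Rightarrow> nat) \<Rightarrow> (nat \<Rightarrow> int \<Rightarrow> nat) set" where
  "qball p n \<gamma> x = {y \<in> Qpn p n. Qpn_dist p n y x \<le> real p powr real_of_int \<gamma>}"

text \<open>Haar measure on Q_p^n, normalized by |B_gamma(x)|_h = p^(n gamma), on the
  Borel sigma-algebra (generated by the balls).\<close>

definition haar :: "nat \<Rightarrow> nat \<Rightarrow> (nat \<Rightarrow> int \<Rightarrow> nat) measure" where
  "haar p n = (SOME M. space M = Qpn p n \<and>
      sets M = sigma_sets (Qpn p n) {qball p n \<gamma> x | \<gamma> x. x \<in> Qpn p n} \<and>
      (\<forall>\<gamma> x. x \<in> Qpn p n \<longrightarrow>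
          emeasure M (qball p n \<gamma> x) = ennreal (real p powr (real n * real_of_int \<gamma>))))"

definition loc_integrable :: "nat \<Rightarrow> nat \<Rightarrow> ((nat \<Rightarrow> int \<Rightarrow> nat) \<Rightarrow> real) \<Rightarrow> bool" where
  "loc_integrable p n b \<longleftrightarrow> b \<in> borel_measurable (haar p n) \<and>
     (\<forall>\<gamma> x. x \<in> Qpn p n \<longrightarrow> set_integrable (haar p n) (qball p n \<gamma> x) b)"

definition ball_avg :: "nat \<Rightarrow> nat \<Rightarrow> ((nat \<Rightarrow> int \<Rightarrow> nat) \<Rightarrow> real) \<Rightarrow> int \<Rightarrow> (nat \<Rightarrow> int \<Rightarrow> nat) \<Rightarrow> real" where
  "ball_avg p n f \<gamma> x =
     (LINT y:qball p n \<gamma> x|haar p n. f y) / measure (haar p n) (qball p n \<gamma> x)"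

definition BMO :: "nat \<Rightarrow> nat \<Rightarrow> ((nat \<Rightarrow> int \<Rightarrow> nat) \<Rightarrow> real) set" where
  "BMO p n = {b. loc_integrable p n b \<and>
     (\<exists>C. \<forall>\<gamma> x. x \<in> Qpn p n \<longrightarrow>
        (LINT y:qball p n \<gamma> x|haar p n. \<bar>b y - ball_avg p n b \<gamma> x\<bar>)
          / measure (haar p n) (qball p n \<gamma> x) \<le> C)}"

definition max_comm :: "nat \<Rightarrow> nat \<Rightarrow> real \<Rightarrow> ((nat \<Rightarrow> int \<Rightarrow> nat) \<Rightarrow> real)
    \<Rightarrow> ((nat \<Rightarrow> int \<Rightarrow> nat) \<Rightarrow> real) \<Rightarrow> (nat \<Rightarrow> int \<Rightarrow> nat) \<Rightarrow> ennreal" where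
  "max_comm p n \<alpha> b f x = (SUP \<gamma>\<in>(UNIV::int set).
      ennreal ((real p powr (real n * real_of_int \<gamma>)) powr (\<alpha> / real n - 1)) *
      (\<integral>\<^sup>+ y\<in>qball p n \<gamma> x. ennreal (\<bar>b x - b y\<bar> * \<bar>f y\<bar>) \<partial>haar p n))"

text \<open>Luxemburg norm of an [0,\<infinity>]-valued function F in L^{q(.)} (value \<infinity> if no
  admissible eta exists). For a real function f it is applied to |f|.\<close>

definition var_modular :: "'a measure \<Rightarrow> ('a \<Rightarrow> real) \<Rightarrow> ('a \<Rightarrow> ennreal) \<Rightarrow> real \<Rightarrow> ennreal" where
  "var_modular M q F \<eta> = (\<integral>\<^sup>+ x. (if F x = \<top> then \<top>
        else ennreal ((enn2real (F x) / \<eta>) powr q x)) \<partial>M)"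

definition var_norm :: "'a measure \<Rightarrow> ('a \<Rightarrow> real) \<Rightarrow> ('a \<Rightarrow> ennreal) \<Rightarrow> ennreal" where
  "var_norm M q F = (INF \<eta>\<in>{\<eta>::real. \<eta> > 0 \<and> var_modular M q F \<eta> \<le> 1}. ennreal \<eta>)"

definition ess_sup_on :: "'a measure \<Rightarrow> 'a set \<Rightarrow> ('a \<Rightarrow> real) \<Rightarrow> ereal" where
  "ess_sup_on M B q = esssup (restrict_space M B) (\<lambda>x. ereal (q x))"

definition ess_inf_on :: "'a measure \<Rightarrow> 'a set \<Rightarrow> ('a \<Rightarrow> real) \<Rightarrow> ereal" where
  "ess_inf_on M B q = - esssup (restrict_space M B) (\<lambda>x. - ereal (q x))"

definition exp_P :: "nat \<Rightarrow> nat \<Rightarrow> ((nat \<Rightarrow> int \<Rightarrow> nat) \<Rightarrow> real) set" where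
  "exp_P p n = {q. q \<in> borel_measurable (haar p n) \<and>
      1 < ess_inf_on (haar p n) (Qpn p n) q \<and>
      ess_sup_on (haar p n) (Qpn p n) q < \<infinity>}"

definition Clog0 :: "nat \<Rightarrow> nat \<Rightarrow> ((nat \<Rightarrow> int \<Rightarrow> nat) \<Rightarrow> real) set" where
  "Clog0 p n = {q. \<exists>C::real. \<forall>\<gamma> x. x \<in> Qpn p n \<longrightarrow>
      ereal (real_of_int \<gamma>) * (ess_inf_on (haar p n) (qball p n \<gamma> x) q
                                - ess_sup_on (haar p n) (qball p n \<gamma> x) q) \<le> ereal C}"

definition ClogInf :: "nat \<Rightarrow> nat \<Rightarrow> ((nat \<Rightarrow> int \<Rightarrow> nat) \<Rightarrow> real) set" where
  "ClogInf p n = {q. \<exists>C::real. \<forall>x\<in>Qpn p n. \<forall>y\<in>Qpn p n.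
      \<bar>q x - q y\<bar> \<le> C / log (real p) (real p + min (Qpn_norm p n x) (Qpn_norm p n y))}"

definition Clog :: "nat \<Rightarrow> nat \<Rightarrow> ((nat \<Rightarrow> int \<Rightarrow> nat) \<Rightarrow> real) set" where
  "Clog p n = Clog0 p n \<inter> ClogInf p n"

definition adm_pair :: "nat \<Rightarrow> nat \<Rightarrow> real \<Rightarrow> ((nat \<Rightarrow> int \<Rightarrow> nat) \<Rightarrow> real)
    \<Rightarrow> ((nat \<Rightarrow> int \<Rightarrow> nat) \<Rightarrow> real) \<Rightarrow> bool" where
  "adm_pair p n \<alpha> r q \<longleftrightarrow> r \<in> Clog p n \<and> q \<in> Clog p n \<and> r \<in> exp_P p n \<and>
     ess_sup_on (haar p n) (Qpn p n) r < ereal (real n / \<alpha>) \<and>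
     (\<forall>x\<in>Qpn p n. 1 / q x = 1 / r x - \<alpha> / real n)"

definition mc_bounded :: "nat \<Rightarrow> nat \<Rightarrow> real \<Rightarrow> ((nat \<Rightarrow> int \<Rightarrow> nat) \<Rightarrow> real)
    \<Rightarrow> ((nat \<Rightarrow> int \<Rightarrow> nat) \<Rightarrow> real) \<Rightarrow> ((nat \<Rightarrow> int \<Rightarrow> nat) \<Rightarrow> real) \<Rightarrow> bool" where
  "mc_bounded p n \<alpha> b r q \<longleftrightarrow> (\<exists>C::real. \<forall>f. f \<in> borel_measurable (haar p n) \<longrightarrow>
      var_norm (haar p n) r (\<lambda>y. ennreal \<bar>f y\<bar>) < \<top> \<longrightarrow>
      var_norm (haar p n) q (max_comm p n \<alpha> b f)
        \<le> ennreal C * var_norm (haar p n) r (\<lambda>y. ennreal \<bar>f y\<bar>))"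

definition ddagger :: "nat \<Rightarrow> nat \<Rightarrow> ((nat \<Rightarrow> int \<Rightarrow> nat) \<Rightarrow> real)
    \<Rightarrow> ((nat \<Rightarrow> int \<Rightarrow> nat) \<Rightarrow> real) \<Rightarrow> bool" where
  "ddagger p n b q \<longleftrightarrow>
     (SUP (\<gamma>, x)\<in>(UNIV::int set) \<times> Qpn p n.
        var_norm (haar p n) q
          (\<lambda>y. ennreal (\<bar>b y - ball_avg p n b \<gamma> x\<bar> * indicator (qball p n \<gamma> x) y))
        / var_norm (haar p n) q (\<lambda>y. ennreal (indicator (qball p n \<gamma> x) y))) < \<top>"

end

theory Submission
  imports Defs
begin

text \<open>The equivalences follow from the implications from T1 to T2, from boundedness for a pair (r, q) to
  the oscillation condition for the same q, and from the oscillation condition to T1; constant exponents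
  show that admissible pairs exist.

  For T1 to T2, split b(x) - b(y) at the mean b_B. Hoelder's inequality and the John-Nirenberg inequality
  bound the commutator on B by (1 + |b(x) - b_B|) times |B|^{alpha/n} <|f|^s>_B^{1/s}. Log-Hoelder
  continuity bounds the q(x)-th power of the second factor by <H>_B^s, for one function H with a
  bounded L^s norm and constant s > 1, up to an integrable error, so that only the constant exponent inequality
  for the supremum over B of (1 + |b(x) - b_B|)^N <H>_B^s is needed. That one follows by
  decomposing the level sets of the maximal function of H into maximal balls, because all moments of the
  maximal oscillation of b on a ball are bounded.

  From boundedness to the oscillation condition one tests with the indicator of B, since its commutator
  is at least |B|^{alpha/n} |b - b_B| on B. From there to T1, the pointwise bound for averages with
  alpha = 0 controls the mean oscillation by the variable exponent one.\<close>

section \<open>Spaces of nested balls\<close>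

text \<open>Up to Haar measure, p and n enter only through \<open>P\<close> = p^n, and the metric
  only through the partitions of the space into balls, one partition per integer scale. The obstacle
  is that the weight 1 + |b(x) - b_B| depends on B and cannot be pulled out of the supremum over B.
  Hence the maximal inequality carries ball-dependent weights, and the John-Nirenberg inequality is
  proved for the supremum of the oscillations over all smaller balls at once. Scale 0 separates two
  regimes. On small balls the exponent is nearly constant and q(x) itself can be used; on large
  balls it is exchanged for its limit at infinity, which costs an error. This error is integrable,
  but it is multiplied by the weight, which may grow polynomially with the scale. It is therefore
  kept together with a factor |B|^(-\<epsilon>), which is available because the exponents stay away
  from 1 even after division by s. The choice s = sqrt(lo), with lo > 1 a lower bound of the
  exponents, comes from needing a power above 1 twice: in Hoelder's inequality and in the maximal
  inequality.\<close>

locale ball_space =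
  fixes M :: "'a measure" and B :: "int \<Rightarrow> 'a \<Rightarrow> 'a set" and P :: real and org :: 'a
  assumes P_ge_2: "2 \<le> P"
    and ball_sets [measurable]: "\<And>\<gamma> x. x \<in> space M \<Longrightarrow> B \<gamma> x \<in> sets M"
    and emeasure_ball: "\<And>\<gamma> x. x \<in> space M \<Longrightarrow> emeasure M (B \<gamma> x) = ennreal (P powr \<gamma>)"
    and center_in_ball: "\<And>\<gamma> x. x \<in> space M \<Longrightarrow> x \<in> B \<gamma> x"
    and ball_eq: "\<And>\<gamma> x y. x \<in> space M \<Longrightarrow> y \<in> B \<gamma> x \<Longrightarrow> B \<gamma> y = B \<gamma> x"
    and ball_mono: "\<And>\<gamma> \<delta> x. x \<in> space M \<Longrightarrow> \<gamma> \<le> \<delta> \<Longrightarrow> B \<gamma> x \<subseteq> B \<delta> x"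
    and org_space: "org \<in> space M"
    and cover: "\<And>x. x \<in> space M \<Longrightarrow> \<exists>\<gamma>. x \<in> B \<gamma> org"
    and countable_balls: "\<And>\<gamma>. countable (B \<gamma> ` space M)"
    and generated: "sets M = sigma_sets (space M) {B \<gamma> x | \<gamma> x. x \<in> space M}"
begin

section \<open>Balls of one scale as a partition of the space\<close>

lemma ball_subset_space: "x \<in> space M \<Longrightarrow> B \<gamma> x \<subseteq> space M"
  using ball_sets sets.sets_into_space by blast

lemma ball_in_space: "x \<in> space M \<Longrightarrow> y \<in> B \<gamma> x \<Longrightarrow> y \<in> space M"
  using ball_subset_space by blast

lemma P_pos [simp]: "0 < P" "0 \<le> P" "1 \<le> P" "1 < P" "P \<noteq> 0"
  using P_ge_2 by auto

lemma ball_sym: "x \<in> space M \<Longrightarrow> y \<in> B \<gamma> x \<Longrightarrow> x \<in> B \<gamma> y"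
  using ball_eq center_in_ball by blast

text \<open>Balls of one scale are equal or disjoint, so these sets are the unions of cells of the
  partition at scale \<open>\<gamma>\<close>. Stopping sets and level sets of averages are of this
  kind.\<close>

definition saturated :: "int \<Rightarrow> 'a set \<Rightarrow> bool" where
  "saturated \<gamma> E \<longleftrightarrow> E \<subseteq> space M \<and> (\<forall>x\<in>E. B \<gamma> x \<subseteq> E)"

text \<open>The value type is arbitrary so that predicates are covered as well:
  \<open>saturated_Collect\<close> turns a locally constant condition into a saturated set.\<close>

definition locally_const :: "int \<Rightarrow> ('a \<Rightarrow> 'b) \<Rightarrow> bool" where
  "locally_const \<gamma> f \<longleftrightarrow> (\<forall>x\<in>space M. \<forall>y\<in>B \<gamma> x. f y = f x)"

lemma locally_constD: "locally_const \<gamma> f \<Longrightarrow> x \<in> space M \<Longrightarrow> y \<in> B \<gamma> x \<Longrightarrow> f y = f x"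
  by (auto simp: locally_const_def)

lemma locally_const_antimono: "locally_const \<gamma> f \<Longrightarrow> \<delta> \<le> \<gamma> \<Longrightarrow> locally_const \<delta> f"
  unfolding locally_const_def using ball_mono by blast

lemma saturated_antimono: "saturated \<gamma> E \<Longrightarrow> \<delta> \<le> \<gamma> \<Longrightarrow> saturated \<delta> E"
  unfolding saturated_def using ball_mono by blast

lemma saturated_ball: "x \<in> space M \<Longrightarrow> saturated \<gamma> (B \<gamma> x)"
  unfolding saturated_def using ball_subset_space ball_eq by blast

lemma saturated_UN: "(\<And>i. i \<in> I \<Longrightarrow> saturated \<gamma> (E i)) \<Longrightarrow> saturated \<gamma> (\<Union>i\<in>I. E i)"
  unfolding saturated_def by blast

lemma saturated_Compl: "saturated \<gamma> E \<Longrightarrow> saturated \<gamma> (space M - E)"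
  unfolding saturated_def using ball_subset_space ball_sym by blast

lemma saturated_Int: "saturated \<gamma> E \<Longrightarrow> saturated \<gamma> F \<Longrightarrow> saturated \<gamma> (E \<inter> F)"
  unfolding saturated_def by blast

lemma saturated_Collect: "locally_const \<gamma> Q \<Longrightarrow> saturated \<gamma> {x \<in> space M. Q x}"
  unfolding saturated_def locally_const_def using ball_in_space by fastforce

lemma saturated_eq:
  assumes "saturated \<gamma> E"
  shows "E = \<Union>(B \<gamma> ` E)" "countable (B \<gamma> ` E)"
proof -
  have "E \<subseteq> space M" using assms by (auto simp: saturated_def)
  then show "countable (B \<gamma> ` E)"
    by (meson countable_balls countable_subset image_mono)
  show "E = \<Union>(B \<gamma> ` E)"
    using assms center_in_ball unfolding saturated_def by blast
qed

lemma saturated_sets [measurable_dest]: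
  assumes "saturated \<gamma> E" shows "E \<in> sets M"
proof -
  have "\<Union>(B \<gamma> ` E) \<in> sets M"
    using saturated_eq(2)[OF assms] assms
    by (intro sets.countable_Union) (auto simp: saturated_def ball_sets)
  with saturated_eq(1)[OF assms] show ?thesis by simp
qed

lemma locally_const_measurable:
  fixes f :: "'a \<Rightarrow> 'b::topological_space"
  assumes "locally_const \<gamma> f" shows "f \<in> borel_measurable M"
proof (rule measurableI)
  fix A
  have "saturated \<gamma> {x \<in> space M. f x \<in> A}"
    by (rule saturated_Collect) (use assms in \<open>auto simp: locally_const_def\<close>)
  moreover have "f -` A \<inter> space M = {x \<in> space M. f x \<in> A}" by auto
  ultimately show "f -` A \<inter> space M \<in> sets M"
    using saturated_sets by simp
qed simp

lemma disjoint_balls: "E \<subseteq> space M \<Longrightarrow> disjoint_family_on (\<lambda>X. X) (B \<gamma> ` E)"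
  unfolding disjoint_family_on_def using ball_eq by blast

lemma emeasure_saturated_mono:
  assumes E: "saturated \<gamma> E" and s: "sets N1 = sets M" "sets N2 = sets M"
    and le: "\<And>x. x \<in> E \<Longrightarrow> emeasure N1 (B \<gamma> x) \<le> emeasure N2 (B \<gamma> x)"
  shows "emeasure N1 E \<le> emeasure N2 E"
proof -
  have sub: "E \<subseteq> space M" using E by (auto simp: saturated_def)
  have *: "emeasure N E = (\<integral>\<^sup>+X. emeasure N X \<partial>count_space (B \<gamma> ` E))" if "sets N = sets M" for N
  proof -
    have "emeasure N (\<Union>X\<in>B \<gamma> ` E. X) = (\<integral>\<^sup>+X. emeasure N X \<partial>count_space (B \<gamma> ` E))"
      using saturated_eq(2)[OF E] disjoint_balls[OF sub] sub that
      by (intro emeasure_UN_countable) (auto simp: ball_sets)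
    then show ?thesis using saturated_eq(1)[OF E] by simp
  qed
  show ?thesis
    unfolding *[OF s(1)] *[OF s(2)] using le
    by (intro nn_integral_mono) auto
qed

text \<open>The comparison of measures is applied to the measures with densities \<open>f\<close>
  and \<open>g\<close>. Estimates on the single balls of a stopping family are summed up in this
  way.\<close>

lemma nn_integral_saturated_mono:
  fixes f g :: "'a \<Rightarrow> ennreal"
  assumes E: "saturated \<gamma> E" and [measurable]: "f \<in> borel_measurable M" "g \<in> borel_measurable M"
    and le: "\<And>x. x \<in> E \<Longrightarrow> (\<integral>\<^sup>+y\<in>B \<gamma> x. f y \<partial>M) \<le> (\<integral>\<^sup>+y\<in>B \<gamma> x. g y \<partial>M)"
  shows "(\<integral>\<^sup>+y\<in>E. f y \<partial>M) \<le> (\<integral>\<^sup>+y\<in>E. g y \<partial>M)"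
proof -
  have sub: "E \<subseteq> space M" using E by (auto simp: saturated_def)
  have [measurable]: "E \<in> sets M" using E saturated_sets by auto
  have "emeasure (density M f) E \<le> emeasure (density M g) E"
    by (rule emeasure_saturated_mono[OF E])
       (use le sub in \<open>auto simp: emeasure_density ball_sets\<close>)
  then show ?thesis by (simp add: emeasure_density)
qed

lemma nn_integral_saturated_le:
  fixes f :: "'a \<Rightarrow> ennreal"
  assumes E: "saturated \<gamma> E" and [measurable]: "f \<in> borel_measurable M"
    and le: "\<And>x. x \<in> E \<Longrightarrow> (\<integral>\<^sup>+y\<in>B \<gamma> x. f y \<partial>M) \<le> c * ennreal (P powr \<gamma>)"
  shows "(\<integral>\<^sup>+y\<in>E. f y \<partial>M) \<le> c * emeasure M E"
proof -
  have sub: "E \<subseteq> space M" using E by (auto simp: saturated_def)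
  have [measurable]: "E \<in> sets M" using E saturated_sets by auto
  have "(\<integral>\<^sup>+y\<in>E. f y \<partial>M) \<le> (\<integral>\<^sup>+y\<in>E. c \<partial>M)"
    by (rule nn_integral_saturated_mono[OF E])
       (use le sub in \<open>auto simp: nn_integral_cmult_indicator ball_sets emeasure_ball subset_iff\<close>)
  then show ?thesis by (simp add: nn_integral_cmult_indicator)
qed

lemma AE_ballwise:
  assumes "\<And>z. z \<in> space M \<Longrightarrow> AE y in M. y \<in> B \<gamma> z \<longrightarrow> Q y"
  shows "AE y in M. Q y"
proof -
  have "AE y in M. \<forall>X\<in>B \<gamma> ` space M. y \<in> X \<longrightarrow> Q y"
    using countable_balls assms by (subst AE_ball_countable) auto
  moreover have "AE y in M. y \<in> space M" by simp
  ultimately show ?thesis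
    by eventually_elim (use center_in_ball in auto)
qed

section \<open>Ball averages and local integrability\<close>

lemma measure_ball: "x \<in> space M \<Longrightarrow> measure M (B \<gamma> x) = P powr \<gamma>"
  by (simp add: emeasure_ball measure_def)

lemma emeasure_ball_finite: "x \<in> space M \<Longrightarrow> emeasure M (B \<gamma> x) < \<infinity>"
  by (simp add: emeasure_ball)

definition avg :: "int \<Rightarrow> ('a \<Rightarrow> real) \<Rightarrow> 'a \<Rightarrow> real" where
  "avg \<gamma> f x = (LINT y:B \<gamma> x|M. f y) / P powr \<gamma>"

definition loc_int :: "('a \<Rightarrow> real) \<Rightarrow> bool" where
  "loc_int f \<longleftrightarrow> f \<in> borel_measurable M \<and> (\<forall>\<gamma>. \<forall>x\<in>space M. set_integrable M (B \<gamma> x) f)"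

lemma loc_intD:
  assumes "loc_int f" shows "f \<in> borel_measurable M" "x \<in> space M \<Longrightarrow> set_integrable M (B \<gamma> x) f"
  using assms by (auto simp: loc_int_def)

lemma avg_locally_const: "locally_const \<gamma> (avg \<gamma> f)"
  by (auto simp: locally_const_def avg_def ball_eq)

lemma avg_eq: "x \<in> space M \<Longrightarrow> y \<in> B \<gamma> x \<Longrightarrow> avg \<gamma> f y = avg \<gamma> f x"
  using avg_locally_const locally_constD by metis

lemma avg_measurable [measurable]: "avg \<gamma> f \<in> borel_measurable M"
  using avg_locally_const locally_const_measurable by blast

lemma avg_nonneg: "(\<And>y. y \<in> B \<gamma> x \<Longrightarrow> 0 \<le> f y) \<Longrightarrow> 0 \<le> avg \<gamma> f x"
  unfolding avg_def set_lebesgue_integral_def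
  by (intro divide_nonneg_nonneg Bochner_Integration.integral_nonneg)
     (auto simp: indicator_def)

lemma set_integrable_const_ball [simp, intro]: "x \<in> space M \<Longrightarrow> set_integrable M (B \<gamma> x) (\<lambda>_. c::real)"
  unfolding set_integrable_def
  using emeasure_ball_finite[of x \<gamma>] ball_sets[of x \<gamma>]
  by (auto intro!: integrable_scaleR_left integrable_real_indicator)

lemma avg_const [simp]: "x \<in> space M \<Longrightarrow> avg \<gamma> (\<lambda>_. c) x = c"
  unfolding avg_def set_lebesgue_integral_def
  by (simp add: measure_ball)

lemma avg_mono_AE:
  assumes "x \<in> space M" "set_integrable M (B \<gamma> x) f" "set_integrable M (B \<gamma> x) g"
    "AE y in M. y \<in> B \<gamma> x \<longrightarrow> f y \<le> g y"
  shows "avg \<gamma> f x \<le> avg \<gamma> g x"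
  unfolding avg_def set_lebesgue_integral_def
  using assms(2,3) unfolding set_integrable_def
  by (intro divide_right_mono integral_mono_AE)
     (use assms(4) in \<open>auto simp: indicator_def\<close>)

lemma avg_add: "x \<in> space M \<Longrightarrow> set_integrable M (B \<gamma> x) f \<Longrightarrow> set_integrable M (B \<gamma> x) g \<Longrightarrow>
  avg \<gamma> (\<lambda>y. f y + g y) x = avg \<gamma> f x + avg \<gamma> g x"
  by (simp add: avg_def set_integral_add add_divide_distrib)

lemma avg_diff: "x \<in> space M \<Longrightarrow> set_integrable M (B \<gamma> x) f \<Longrightarrow> set_integrable M (B \<gamma> x) g \<Longrightarrow>
  avg \<gamma> (\<lambda>y. f y - g y) x = avg \<gamma> f x - avg \<gamma> g x"
  by (simp add: avg_def set_integral_diff diff_divide_distrib)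

lemma avg_cmult: "avg \<gamma> (\<lambda>y. c * f y) x = c * avg \<gamma> f x"
  by (simp add: avg_def)

lemma nn_integral_avg:
  assumes "x \<in> space M" "set_integrable M (B \<gamma> x) f" "AE y in M. y \<in> B \<gamma> x \<longrightarrow> 0 \<le> f y"
  shows "(\<integral>\<^sup>+y\<in>B \<gamma> x. ennreal (f y) \<partial>M) = ennreal (avg \<gamma> f x) * ennreal (P powr \<gamma>)"
proof -
  have "(\<integral>\<^sup>+y\<in>B \<gamma> x. ennreal (f y) \<partial>M) = (\<integral>\<^sup>+y. ennreal (indicator (B \<gamma> x) y * f y) \<partial>M)"
    by (intro nn_integral_cong) (auto simp: indicator_def)
  also have "\<dots> = ennreal (\<integral>y. indicator (B \<gamma> x) y * f y \<partial>M)"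
    using assms(2,3) unfolding set_integrable_def
    by (intro nn_integral_eq_integral) (auto simp: indicator_def)
  also have "(\<integral>y. indicator (B \<gamma> x) y * f y \<partial>M) = avg \<gamma> f x * P powr \<gamma>"
    by (simp add: avg_def set_lebesgue_integral_def)
  finally show ?thesis by (simp add: ennreal_mult'')
qed

lemma abs_avg_le: 
  assumes "x \<in> space M" "set_integrable M (B \<gamma> x) f"
  shows "\<bar>avg \<gamma> f x\<bar> \<le> avg \<gamma> (\<lambda>y. \<bar>f y\<bar>) x"
proof -
  have "\<bar>LINT y:B \<gamma> x|M. f y\<bar> \<le> (LINT y:B \<gamma> x|M. \<bar>f y\<bar>)"
    using set_integral_norm_bound[OF assms(2)] by simp
  then show ?thesis by (simp add: avg_def divide_right_mono)
qed

lemma loc_int_abs: "loc_int f \<Longrightarrow> loc_int (\<lambda>x. \<bar>f x\<bar>)"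
  unfolding loc_int_def using set_integrable_abs[where f=f and M=M] by (auto)

lemma loc_int_diff: "loc_int f \<Longrightarrow> loc_int g \<Longrightarrow> loc_int (\<lambda>x. f x - g x)"
  unfolding loc_int_def by auto

lemma loc_int_add: "loc_int f \<Longrightarrow> loc_int g \<Longrightarrow> loc_int (\<lambda>x. f x + g x)"
  unfolding loc_int_def by auto

lemma loc_int_const [simp]: "loc_int (\<lambda>_. c)"
  unfolding loc_int_def by auto

lemma loc_int_cmult: "loc_int f \<Longrightarrow> loc_int (\<lambda>x. c * f x)"
  unfolding loc_int_def by auto

lemma loc_int_bound:
  assumes "loc_int g" "f \<in> borel_measurable M" "\<And>x. x \<in> space M \<Longrightarrow> \<bar>f x\<bar> \<le> g x"
  shows "loc_int f"
  unfolding loc_int_def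
proof (intro conjI allI ballI)
  fix \<gamma> x assume x: "x \<in> space M"
  show "set_integrable M (B \<gamma> x) f"
    by (rule set_integrable_bound[OF loc_intD(2)[OF assms(1) x, of \<gamma>]])
       (use assms x in \<open>auto simp: set_borel_measurable_def abs_of_nonneg intro!: AE_I2 order_trans[OF _ abs_ge_self]\<close>)
qed (use assms in auto)

lemma loc_int_const_diff_abs: "loc_int f \<Longrightarrow> loc_int (\<lambda>y. \<bar>f y - c\<bar>)"
  by (intro loc_int_abs loc_int_diff) auto

end

section \<open>Lebesgue differentiation\<close>

context ball_space begin

text \<open>The sets that can be approximated form a sigma-algebra containing the balls. In a
  countable union, finiteness of \<open>N\<close> allows dropping all but finitely many sets, and
  finitely many scales have a smallest one, at which all the approximants are saturated.\<close>

lemma approx_by_saturated: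
  assumes N: "finite_measure N" "sets N = sets M" and A: "A \<in> sets M" and "0 < \<epsilon>"
  shows "\<exists>m S. saturated m S \<and> measure N ((A - S) \<union> (S - A)) < \<epsilon>"
proof -
  interpret N: finite_measure N by fact
  have sp: "space N = space M" using sets_eq_imp_space_eq[OF N(2)] .
  note [simp] = N(2)
  have "A \<in> sigma_sets (space M) {B \<gamma> x | \<gamma> x. x \<in> space M}" using A generated by simp
  then show ?thesis using \<open>0 < \<epsilon>\<close>
  proof (induction arbitrary: \<epsilon> rule: sigma_sets.induct)
    case (Basic a)
    then obtain \<gamma> x where "a = B \<gamma> x" "x \<in> space M" by auto
    then show ?case using saturated_ball Basic by (intro exI[of _ \<gamma>] exI[of _ a]) auto
  next
    case Empty
    then show ?case by (intro exI[of _ 0] exI[of _ "{}"]) (auto simp: saturated_def)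
  next
    case (Compl a)
    then obtain m S where S: "saturated m S" "measure N ((a - S) \<union> (S - a)) < \<epsilon>" by blast
    have "a \<subseteq> space M" using Compl.hyps by (rule sigma_sets_into_sp[rotated]) (use ball_subset_space in auto)
    moreover have "S \<subseteq> space M" using S by (auto simp: saturated_def)
    ultimately have "((space M - a) - (space M - S)) \<union> ((space M - S) - (space M - a)) = (a - S) \<union> (S - a)"
      by auto
    then show ?case using S saturated_Compl by (intro exI[of _ m] exI[of _ "space M - S"]) auto
  next
    case (Union a)
    have a: "a i \<in> sets M" for i using Union.hyps generated by simp
    have inc: "(\<lambda>k. measure N (\<Union>i\<le>k. a i)) \<longlonglongrightarrow> measure N (\<Union>k. \<Union>i\<le>k. a i)"
      using a by (intro N.finite_Lim_measure_incseq) (auto simp: incseq_def intro: order_trans)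
    have eq: "(\<Union>k. \<Union>i\<le>k. a i) = (\<Union>i. a i)" by auto
    obtain k where k: "measure N (\<Union>i. a i) - measure N (\<Union>i\<le>k. a i) < \<epsilon> / 2"
    proof -
      have "eventually (\<lambda>k. measure N (\<Union>i. a i) - \<epsilon> / 2 < measure N (\<Union>i\<le>k. a i)) sequentially"
        using order_tendstoD(1)[OF inc[unfolded eq]] Union.prems by simp
      then obtain k where "measure N (\<Union>i. a i) - \<epsilon> / 2 < measure N (\<Union>i\<le>k. a i)"
        by (auto simp: eventually_sequentially)
      then show ?thesis using that[of k] by simp
    qed
    \<comment> \<open>One half of \<open>\<epsilon>\<close> pays for the tail of the union; the
      other half is shared by the \<open>k + 1\<close> sets of index at most
      \<open>k\<close>.\<close>
    have "\<forall>i. \<exists>m S. saturated m S \<and> measure N ((a i - S) \<union> (S - a i)) < \<epsilon> / (2 * (real k + 1))"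
      using Union.IH Union.prems by simp
    then obtain m S where S: "\<And>i. saturated (m i) (S i)"
      "\<And>i. measure N ((a i - S i) \<union> (S i - a i)) < \<epsilon> / (2 * (real k + 1))"
      by metis
    define m0 where "m0 = Min (m ` {..k})"
    have sat: "saturated m0 (\<Union>i\<le>k. S i)"
      unfolding m0_def by (intro saturated_UN saturated_antimono[OF S(1)] Min_le) auto
    have Ss: "S i \<in> sets M" for i using S(1) saturated_sets by blast
    let ?A = "\<Union>i. a i" and ?S = "\<Union>i\<le>k. S i" and ?Ak = "\<Union>i\<le>k. a i"
    have "measure N ((?A - ?S) \<union> (?S - ?A)) \<le> measure N ((?A - ?Ak) \<union> (\<Union>i\<le>k. (a i - S i) \<union> (S i - a i)))"
    proof (rule N.finite_measure_mono)
      show "(?A - ?S) \<union> (?S - ?A) \<subseteq> (?A - ?Ak) \<union> (\<Union>i\<le>k. (a i - S i) \<union> (S i - a i))"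
        by blast
    qed (use a Ss in auto)
    also have "\<dots> \<le> measure N (?A - ?Ak) + measure N (\<Union>i\<le>k. (a i - S i) \<union> (S i - a i))"
      using a Ss by (intro measure_Un_le) auto
    also have "measure N (\<Union>i\<le>k. (a i - S i) \<union> (S i - a i)) \<le> (\<Sum>i\<le>k. measure N ((a i - S i) \<union> (S i - a i)))"
      using a Ss by (intro measure_UNION_le) auto
    also have "(\<Sum>i\<le>k. measure N ((a i - S i) \<union> (S i - a i))) \<le> (\<Sum>i\<le>k. \<epsilon> / (2 * (real k + 1)))"
      using S(2) by (intro sum_mono less_imp_le) auto
    also have "\<dots> = \<epsilon> / 2" by (simp add: divide_simps)
    also have "measure N (?A - ?Ak) = measure N ?A - measure N ?Ak"
      using a by (intro N.finite_measure_Diff) auto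
    finally have "measure N ((?A - ?S) \<union> (?S - ?A)) < \<epsilon>" using k by simp
    with sat show ?case by blast
  qed
qed

lemma approx_by_locally_const:
  fixes f :: "'a \<Rightarrow> real"
  assumes N: "finite_measure N" "sets N = sets M" and "integrable N f" and "0 < \<epsilon>"
  shows "\<exists>m h. locally_const m h \<and> integrable N h \<and> (\<integral>x. \<bar>f x - h x\<bar> \<partial>N) < \<epsilon>"
  using assms(3,4)
proof (induction arbitrary: \<epsilon> rule: integrable_induct)
  case (base A c)
  interpret N: finite_measure N by fact
  have sp: "space N = space M" using sets_eq_imp_space_eq[OF N(2)] .
  have A: "A \<in> sets M" using base N by simp
  \<comment> \<open>The denominator \<open>\<bar>c\<bar> + 1\<close> also covers
    \<open>c = 0\<close>.\<close>
  have e: "0 < \<epsilon> / (\<bar>c\<bar> + 1)" using base by simp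
  obtain m S where S: "saturated m S" "measure N ((A - S) \<union> (S - A)) < \<epsilon> / (\<bar>c\<bar> + 1)"
    using approx_by_saturated[OF N A e] by blast
  have Sm: "S \<in> sets M" using S saturated_sets by auto
  have "locally_const m (\<lambda>x. indicator S x *\<^sub>R c)"
    unfolding locally_const_def
  proof (intro ballI)
    fix x y assume "x \<in> space M" "y \<in> B m x"
    then have "x \<in> S \<longleftrightarrow> y \<in> S"
      using S(1) ball_sym[of x y m] by (auto simp: saturated_def)
    then show "indicator S y *\<^sub>R c = indicator S x *\<^sub>R c" by (simp add: indicator_def)
  qed
  moreover have "integrable N (\<lambda>x. indicator S x *\<^sub>R c)"
    using Sm N by (intro integrable_scaleR_left integrable_real_indicator) (auto simp: less_top[symmetric])
  moreover have "(\<integral>x. \<bar>indicator A x *\<^sub>R c - indicator S x *\<^sub>R c\<bar> \<partial>N)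
      = (\<integral>x. indicator ((A - S) \<union> (S - A)) x *\<^sub>R \<bar>c\<bar> \<partial>N)"
    by (intro Bochner_Integration.integral_cong) (auto simp: indicator_def)
  moreover have "\<dots> = measure N ((A - S) \<union> (S - A)) * \<bar>c\<bar>"
    using A Sm N by simp
  moreover have "\<dots> < \<epsilon>"
  proof -
    have "measure N ((A - S) \<union> (S - A)) * (\<bar>c\<bar> + 1) < \<epsilon>"
      using S(2) by (simp add: pos_less_divide_eq)
    moreover have "measure N ((A - S) \<union> (S - A)) * \<bar>c\<bar> \<le> measure N ((A - S) \<union> (S - A)) * (\<bar>c\<bar> + 1)"
      by (intro mult_left_mono) auto
    ultimately show ?thesis by linarith
  qed
  ultimately show ?case
    by (intro exI[of _ m] exI[of _ "\<lambda>x. indicator S x *\<^sub>R c"] conjI) (assumption | simp only:)+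
next
  case (add f g)
  obtain m1 h1 where 1: "locally_const m1 h1" "integrable N h1" "(\<integral>x. \<bar>f x - h1 x\<bar> \<partial>N) < \<epsilon> / 2"
    using add.IH(1)[of "\<epsilon> / 2"] add.prems by auto
  obtain m2 h2 where 2: "locally_const m2 h2" "integrable N h2" "(\<integral>x. \<bar>g x - h2 x\<bar> \<partial>N) < \<epsilon> / 2"
    using add.IH(2)[of "\<epsilon> / 2"] add.prems by auto
  have "locally_const (min m1 m2) h1" "locally_const (min m1 m2) h2"
    using 1(1) 2(1) locally_const_antimono by (metis min.cobounded1, metis min.cobounded2)
  then have "locally_const (min m1 m2) (\<lambda>x. h1 x + h2 x)"
    by (auto simp: locally_const_def)
  moreover have "integrable N (\<lambda>x. h1 x + h2 x)" using 1 2 by simp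
  moreover have "(\<integral>x. \<bar>(f x + g x) - (h1 x + h2 x)\<bar> \<partial>N) \<le> (\<integral>x. \<bar>f x - h1 x\<bar> + \<bar>g x - h2 x\<bar> \<partial>N)"
    using add 1 2 by (intro integral_mono) (auto intro!: Bochner_Integration.integrable_add integrable_abs)
  moreover have "\<dots> = (\<integral>x. \<bar>f x - h1 x\<bar> \<partial>N) + (\<integral>x. \<bar>g x - h2 x\<bar> \<partial>N)"
    using add 1 2 by (intro Bochner_Integration.integral_add) auto
  ultimately show ?case using 1(3) 2(3) by (intro exI[of _ "min m1 m2"] exI[of _ "\<lambda>x. h1 x + h2 x"]) simp
next
  case (lim f s)
  have "(\<lambda>i. \<integral>x. \<bar>f x - s i x\<bar> \<partial>N) \<longlonglongrightarrow> (\<integral>x. 0 \<partial>N)"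
  proof (rule integral_dominated_convergence[where w="\<lambda>x. 3 * \<bar>f x\<bar>"])
    show "AE x in N. (\<lambda>i. \<bar>f x - s i x\<bar>) \<longlonglongrightarrow> 0"
    proof (rule AE_I2)
      fix x assume "x \<in> space N"
      then have "(\<lambda>i. s i x) \<longlonglongrightarrow> f x" using lim by auto
      then have "(\<lambda>i. \<bar>f x - s i x\<bar>) \<longlonglongrightarrow> \<bar>f x - f x\<bar>" by (intro tendsto_intros)
      then show "(\<lambda>i. \<bar>f x - s i x\<bar>) \<longlonglongrightarrow> 0" by simp
    qed
    show "AE x in N. norm \<bar>f x - s i x\<bar> \<le> 3 * \<bar>f x\<bar>" for i
      using lim.hyps(3)[of _ i] by (intro AE_I2) fastforce
  qed (use lim in auto)
  then have "eventually (\<lambda>i. (\<integral>x. \<bar>f x - s i x\<bar> \<partial>N) < \<epsilon> / 2) sequentially"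
    using lim.prems by (intro order_tendstoD(2)) auto
  then obtain i where i: "(\<integral>x. \<bar>f x - s i x\<bar> \<partial>N) < \<epsilon> / 2" by (auto simp: eventually_sequentially)
  obtain m h where h: "locally_const m h" "integrable N h" "(\<integral>x. \<bar>s i x - h x\<bar> \<partial>N) < \<epsilon> / 2"
    using lim.IH[of "\<epsilon> / 2" i] lim.prems by auto
  have "(\<integral>x. \<bar>f x - h x\<bar> \<partial>N) \<le> (\<integral>x. \<bar>f x - s i x\<bar> + \<bar>s i x - h x\<bar> \<partial>N)"
    using lim h by (intro integral_mono) auto
  moreover have "\<dots> = (\<integral>x. \<bar>f x - s i x\<bar> \<partial>N) + (\<integral>x. \<bar>s i x - h x\<bar> \<partial>N)"
    using lim h by (intro Bochner_Integration.integral_add) auto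
  ultimately show ?case using i h by (intro exI[of _ m] exI[of _ h]) simp
qed

text \<open>Averaging at scale \<open>j\<close> is a conditional expectation: on each cell it gives
  a constant, bounded by the average of the absolute value over that cell.\<close>

lemma avg_contraction:
  assumes x: "x \<in> space M" and "j \<le> k" and u: "set_integrable M (B k x) u"
  shows "(\<integral>\<^sup>+y\<in>B k x. ennreal \<bar>avg j u y\<bar> \<partial>M) \<le> (\<integral>\<^sup>+y\<in>B k x. ennreal \<bar>u y\<bar> \<partial>M)"
proof -
  have [measurable]: "B k x \<in> sets M" using x by (simp add: ball_sets)
  \<comment> \<open>Set integrability gives measurability only for the product with the indicator.
    That product has the same averages over all cells inside \<open>B k x\<close>.\<close>
  define w where "w = (\<lambda>y. indicator (B k x) y * u y)"
  have [measurable]: "w \<in> borel_measurable M"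
    using u unfolding set_integrable_def w_def by (auto dest: borel_measurable_integrable)
  have iw: "integrable M w" using u unfolding set_integrable_def w_def by simp
  have sub: "B j y \<subseteq> B k x" if "y \<in> B k x" for y
    using that x \<open>j \<le> k\<close> ball_mono ball_eq ball_in_space by metis
  have "(\<integral>\<^sup>+y\<in>B k x. ennreal \<bar>avg j w y\<bar> \<partial>M) \<le> (\<integral>\<^sup>+y\<in>B k x. ennreal \<bar>w y\<bar> \<partial>M)"
  proof (rule nn_integral_saturated_mono[of j])
    show "saturated j (B k x)" using saturated_ball[OF x] \<open>j \<le> k\<close> saturated_antimono by blast
    fix y assume y: "y \<in> B k x"
    have ys: "y \<in> space M" using y x ball_in_space by blast
    have si: "set_integrable M (B j y) w"
      unfolding set_integrable_def using iw ys by (intro integrable_mult_indicator) (auto simp: ball_sets)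
    have "(\<integral>\<^sup>+z\<in>B j y. ennreal \<bar>avg j w z\<bar> \<partial>M) = (\<integral>\<^sup>+z\<in>B j y. ennreal \<bar>avg j w y\<bar> \<partial>M)"
      using avg_eq[OF ys] by (intro nn_integral_cong) (auto simp: indicator_def)
    also have "\<dots> = ennreal \<bar>avg j w y\<bar> * ennreal (P powr j)"
      using ys by (simp add: nn_integral_cmult_indicator ball_sets emeasure_ball)
    also have "\<dots> \<le> ennreal (avg j (\<lambda>z. \<bar>w z\<bar>) y) * ennreal (P powr j)"
      using abs_avg_le[OF ys si] by (intro mult_right_mono ennreal_leI) auto
    also have "\<dots> = (\<integral>\<^sup>+z\<in>B j y. ennreal \<bar>w z\<bar> \<partial>M)"
      using si ys by (intro nn_integral_avg[symmetric] set_integrable_abs) auto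
    finally show "(\<integral>\<^sup>+z\<in>B j y. ennreal \<bar>avg j w z\<bar> \<partial>M) \<le> (\<integral>\<^sup>+z\<in>B j y. ennreal \<bar>w z\<bar> \<partial>M)" .
  qed auto
  moreover have "avg j w y = avg j u y" if "y \<in> B k x" for y
    unfolding avg_def set_lebesgue_integral_def w_def using sub[OF that]
    by (intro arg_cong2[where f="(/)"] Bochner_Integration.integral_cong refl) (auto simp: indicator_def)
  then have "(\<integral>\<^sup>+y\<in>B k x. ennreal \<bar>avg j w y\<bar> \<partial>M) = (\<integral>\<^sup>+y\<in>B k x. ennreal \<bar>avg j u y\<bar> \<partial>M)"
    by (intro nn_integral_cong) (auto simp: indicator_def)
  moreover have "(\<integral>\<^sup>+y\<in>B k x. ennreal \<bar>w y\<bar> \<partial>M) = (\<integral>\<^sup>+y\<in>B k x. ennreal \<bar>u y\<bar> \<partial>M)"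
    by (intro nn_integral_cong) (auto simp: indicator_def w_def)
  ultimately show ?thesis by simp
qed

lemma avg_of_locally_const:
  assumes "locally_const m h" "j \<le> m" "y \<in> space M" shows "avg j h y = h y"
proof -
  have "avg j h y = avg j (\<lambda>_. h y) y"
    unfolding avg_def set_lebesgue_integral_def
    using locally_constD[OF locally_const_antimono[OF assms(1,2)] assms(3)]
    by (intro arg_cong2[where f="(/)"] Bochner_Integration.integral_cong refl) (auto simp: indicator_def)
  then show ?thesis using assms by simp
qed

text \<open>For a locally constant function the averages are eventually equal to the function. The
  general case follows by density, since averaging does not increase the distance to the
  approximant.\<close>

lemma avg_L1_convergence:
  assumes f: "loc_int f" and x: "x \<in> space M"
  shows "(\<lambda>i. \<integral>y. \<bar>indicator (B k x) y * (avg (- int i) f y - f y)\<bar> \<partial>M) \<longlonglongrightarrow> 0"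
proof (rule LIMSEQ_I)
  fix \<epsilon> :: real assume e: "0 < \<epsilon>"
  let ?Q = "B k x"
  have [measurable]: "?Q \<in> sets M" using x by (simp add: ball_sets)
  have [measurable]: "f \<in> borel_measurable M" using f loc_intD by auto
  have fQ: "set_integrable M ?Q f" using f x loc_intD by auto
  \<comment> \<open>The density result needs a finite measure, so \<open>M\<close> is restricted to
    the ball by means of a density.\<close>
  define N where "N = density M (\<lambda>y. ennreal (indicator ?Q y))"
  have N: "finite_measure N" "sets N = sets M"
    unfolding N_def using x emeasure_ball_finite[OF x, of k]
    by (auto intro!: finite_measureI simp: emeasure_density ball_sets ennreal_indicator less_top[symmetric] emeasure_ball)
  have iN: "integrable N g \<longleftrightarrow> set_integrable M ?Q g" if "g \<in> borel_measurable M" for g :: "'a \<Rightarrow> real"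
    unfolding N_def set_integrable_def using that by (subst integrable_density) auto
  obtain m h where h: "locally_const m h" "integrable N h" "(\<integral>x. \<bar>f x - h x\<bar> \<partial>N) < \<epsilon> / 2"
    using approx_by_locally_const[OF N, of f "\<epsilon> / 2"] fQ iN[of f] e by auto
  have [measurable]: "h \<in> borel_measurable M" using h(1) locally_const_measurable by blast
  have hQ: "set_integrable M ?Q h" using h iN by simp
  have fh: "(\<integral>y. \<bar>indicator ?Q y * (f y - h y)\<bar> \<partial>M) < \<epsilon> / 2"
  proof -
    have "(\<integral>x. \<bar>f x - h x\<bar> \<partial>N) = (\<integral>y. \<bar>indicator ?Q y * (f y - h y)\<bar> \<partial>M)"
      unfolding N_def by (subst integral_density) (auto simp: abs_mult)
    then show ?thesis using h(3) by simp
  qed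
  have ifh: "set_integrable M ?Q (\<lambda>y. f y - h y)" using fQ hQ by auto
  have nf: "(\<integral>\<^sup>+y\<in>?Q. ennreal \<bar>f y - h y\<bar> \<partial>M) < ennreal (\<epsilon> / 2)"
  proof -
    have "(\<integral>\<^sup>+y\<in>?Q. ennreal \<bar>f y - h y\<bar> \<partial>M) = (\<integral>\<^sup>+y. ennreal \<bar>indicator ?Q y * (f y - h y)\<bar> \<partial>M)"
      by (intro nn_integral_cong) (auto simp: indicator_def)
    also have "\<dots> = ennreal (\<integral>y. \<bar>indicator ?Q y * (f y - h y)\<bar> \<partial>M)"
      using ifh unfolding set_integrable_def by (intro nn_integral_eq_integral) auto
    finally show ?thesis using fh e by (simp add: ennreal_less_iff)
  qed
  show "\<exists>no. \<forall>i\<ge>no. norm ((\<integral>y. \<bar>indicator ?Q y * (avg (- int i) f y - f y)\<bar> \<partial>M) - 0) < \<epsilon>"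
  \<comment> \<open>From this index on the scale is at most \<open>m\<close>, so that averaging
    leaves \<open>h\<close> unchanged, and at most \<open>k\<close>, so that the cells stay inside
    the ball.\<close>
  proof (intro exI[of _ "nat (- min m k)"] allI impI)
    fix i assume i: "nat (- min m k) \<le> i"
    then have j: "- int i \<le> m" "- int i \<le> k" by linarith+
    let ?j = "- int i"
    have "(\<integral>\<^sup>+y. ennreal \<bar>indicator ?Q y * (avg ?j f y - f y)\<bar> \<partial>M)
       \<le> (\<integral>\<^sup>+y. (ennreal \<bar>avg ?j (\<lambda>y. f y - h y) y\<bar> * indicator ?Q y + ennreal \<bar>f y - h y\<bar> * indicator ?Q y) \<partial>M)"
    proof (intro nn_integral_mono)
      fix y assume "y \<in> space M"
      show "ennreal \<bar>indicator ?Q y * (avg ?j f y - f y)\<bar> \<le> ennreal \<bar>avg ?j (\<lambda>y. f y - h y) y\<bar> * indicator ?Q y + ennreal \<bar>f y - h y\<bar> * indicator ?Q y"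
      proof (cases "y \<in> ?Q")
        case True
        then have ys: "y \<in> space M" using x ball_in_space by blast
        have "B ?j y \<subseteq> ?Q" using True x j ball_mono ball_eq ball_in_space by metis
        then have "set_integrable M (B ?j y) h"
          using hQ ys by (intro set_integrable_subset[OF hQ]) (auto simp: ball_sets)
        then have "avg ?j (\<lambda>y. f y - h y) y = avg ?j f y - h y"
          using ys f loc_intD(2) avg_of_locally_const[OF h(1) j(1) ys] by (subst avg_diff) auto
        then show ?thesis using True by (simp flip: ennreal_plus)
      qed simp
    qed
    also have "\<dots> = (\<integral>\<^sup>+y\<in>?Q. ennreal \<bar>avg ?j (\<lambda>y. f y - h y) y\<bar> \<partial>M) + (\<integral>\<^sup>+y\<in>?Q. ennreal \<bar>f y - h y\<bar> \<partial>M)"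
      by (intro nn_integral_add) auto
    also have "\<dots> \<le> (\<integral>\<^sup>+y\<in>?Q. ennreal \<bar>f y - h y\<bar> \<partial>M) + (\<integral>\<^sup>+y\<in>?Q. ennreal \<bar>f y - h y\<bar> \<partial>M)"
      by (intro add_right_mono avg_contraction[OF x j(2) ifh])
    also have "\<dots> < ennreal (\<epsilon> / 2) + ennreal (\<epsilon> / 2)"
      by (intro add_strict_mono nf)
    also have "\<dots> = ennreal \<epsilon>" using e by (simp flip: ennreal_plus)
    finally have "(\<integral>\<^sup>+y. ennreal \<bar>indicator ?Q y * (avg ?j f y - f y)\<bar> \<partial>M) < ennreal \<epsilon>" .
    then have "(\<integral>y. \<bar>indicator ?Q y * (avg ?j f y - f y)\<bar> \<partial>M) < \<epsilon>"
      using e order.strict_trans[OF _ ennreal_less_top]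
      by (subst integral_eq_nn_integral) (auto simp: enn2real_less_iff)
    then show "norm ((\<integral>y. \<bar>indicator ?Q y * (avg (- int i) f y - f y)\<bar> \<partial>M) - 0) < \<epsilon>"
      by (simp add: Bochner_Integration.integral_nonneg)
  qed
qed

text \<open>Convergence in L1 on each unit ball yields almost everywhere convergence along a
  subsequence. Subsequences suffice because the limit is only compared with a supremum over all
  small scales.\<close>

theorem lebesgue_differentiation:
  assumes f: "loc_int f"
  shows "AE y in M. \<exists>r::nat\<Rightarrow>nat. strict_mono r \<and> (\<lambda>i. avg (- int (r i)) f y) \<longlonglongrightarrow> f y"
proof (rule AE_ballwise[of 0])
  fix x assume x: "x \<in> space M"
  let ?Q = "B 0 x"
  have [measurable]: "?Q \<in> sets M" using x by (simp add: ball_sets)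
  have [measurable]: "f \<in> borel_measurable M" using f loc_intD by auto
  have ia: "integrable M (\<lambda>y. indicator ?Q y * (avg (- int i) f y - f y))" for i
  proof -
    have "(\<integral>\<^sup>+y\<in>?Q. ennreal \<bar>avg (- int i) f y\<bar> \<partial>M) \<le> (\<integral>\<^sup>+y\<in>?Q. ennreal \<bar>f y\<bar> \<partial>M)"
      by (rule avg_contraction) (use x f loc_intD in auto)
    also have "\<dots> < \<infinity>"
      using nn_integral_avg[of x 0 "\<lambda>y. \<bar>f y\<bar>"] x f loc_intD(2) by (simp add: set_integrable_abs ennreal_mult_less_top)
    finally have "(\<integral>\<^sup>+y. ennreal (norm (indicator ?Q y * avg (- int i) f y)) \<partial>M) < \<infinity>"
      by (subst nn_integral_cong[where v="\<lambda>y. ennreal \<bar>avg (- int i) f y\<bar> * indicator ?Q y"]) (auto simp: indicator_def)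
    then have "integrable M (\<lambda>y. indicator ?Q y * avg (- int i) f y)"
      by (intro integrableI_bounded) auto
    moreover have "integrable M (\<lambda>y. indicator ?Q y * f y)"
      using f x loc_intD(2)[of f x 0] by (simp add: set_integrable_def)
    ultimately show ?thesis by (simp add: right_diff_distrib)
  qed
  obtain r :: "nat \<Rightarrow> nat" where r: "strict_mono r"
    "AE y in M. (\<lambda>i. indicator ?Q y * (avg (- int (r i)) f y - f y)) \<longlonglongrightarrow> 0"
    using tendsto_L1_AE_subseq[of M "\<lambda>i y. indicator ?Q y * (avg (- int i) f y - f y)"]
      ia avg_L1_convergence[OF f x, of 0] by auto
  from r(2) show "AE y in M. y \<in> ?Q \<longrightarrow> (\<exists>r::nat\<Rightarrow>nat. strict_mono r \<and> (\<lambda>i. avg (- int (r i)) f y) \<longlonglongrightarrow> f y)"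
  proof eventually_elim
    fix y assume y: "(\<lambda>i. indicator ?Q y * (avg (- int (r i)) f y - f y)) \<longlonglongrightarrow> 0"
    show "y \<in> ?Q \<longrightarrow> (\<exists>r::nat\<Rightarrow>nat. strict_mono r \<and> (\<lambda>i. avg (- int (r i)) f y) \<longlonglongrightarrow> f y)"
    proof
      assume "y \<in> ?Q"
      then have "(\<lambda>i. avg (- int (r i)) f y - f y) \<longlonglongrightarrow> 0" using y by simp
      then have "(\<lambda>i. avg (- int (r i)) f y) \<longlonglongrightarrow> f y" by (rule LIM_zero_cancel)
      then show "\<exists>r::nat\<Rightarrow>nat. strict_mono r \<and> (\<lambda>i. avg (- int (r i)) f y) \<longlonglongrightarrow> f y" using r(1) by blast
    qed
  qed
qed

end

section \<open>The John-Nirenberg inequality\<close>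

text \<open>One term of the exponential series at \<open>t / k + t * u\<close>. The shift by
  \<open>t / k\<close> turns \<open>1 + k * u\<close> into a multiple of the argument of that
  series.\<close>

lemma power_le_exp:
  fixes k t :: real assumes "0 < t" "0 < k"
  shows "\<exists>C>0. \<forall>u\<ge>0. (1 + k * u) ^ N \<le> C * exp (t * u)"
proof (intro exI[of _ "(k / t) ^ N * fact N * exp (t / k)"] conjI allI impI)
  fix u :: real assume u: "0 \<le> u"
  define x where "x = t / k + t * u"
  have x: "0 \<le> x" using assms u by (simp add: x_def)
  have "x ^ N /\<^sub>R fact N \<le> (\<Sum>n. x ^ n /\<^sub>R fact n)"
    using sum_le_suminf[OF summable_exp_generic[of x], of "{N}"] x by simp
  then have "x ^ N \<le> fact N * exp x"
    by (simp add: exp_def field_simps)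
  moreover have "(1 + k * u) ^ N = (k / t) ^ N * x ^ N"
  proof -
    have "1 + k * u = (k / t) * x" using assms unfolding x_def by (simp add: field_simps)
    then show ?thesis by (simp only: power_mult_distrib)
  qed
  ultimately have "(1 + k * u) ^ N \<le> (k / t) ^ N * (fact N * exp x)"
    using assms by (simp add: mult_left_mono)
  then show "(1 + k * u) ^ N \<le> (k / t) ^ N * fact N * exp (t / k) * exp (t * u)"
    by (simp add: x_def exp_add mult_ac)
qed (use assms in simp)

context ball_space begin

definition bmo :: "('a \<Rightarrow> real) \<Rightarrow> real \<Rightarrow> bool" where
  "bmo b D \<longleftrightarrow> loc_int b \<and> (\<forall>\<gamma>. \<forall>x\<in>space M. avg \<gamma> (\<lambda>y. \<bar>b y - avg \<gamma> b x\<bar>) x \<le> D)"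

lemma avg_le_parent:
  assumes x: "x \<in> space M" and g: "loc_int g" "\<And>y. 0 \<le> g y"
  shows "avg \<gamma> g x \<le> P * avg (\<gamma> + 1) g x"
proof -
  have "(LINT y:B \<gamma> x|M. g y) \<le> (LINT y:B (\<gamma> + 1) x|M. g y)"
    using ball_mono[OF x, of \<gamma> "\<gamma> + 1"] g x loc_intD(2)[OF g(1) x] unfolding set_lebesgue_integral_def set_integrable_def
    by (intro integral_mono) (auto simp: indicator_def)
  then have "(LINT y:B \<gamma> x|M. g y) / P powr \<gamma> \<le> (LINT y:B (\<gamma> + 1) x|M. g y) / P powr \<gamma>"
    by (intro divide_right_mono) auto
  also have "\<dots> = P * avg (\<gamma> + 1) g x"
    by (simp add: avg_def powr_add field_simps)
  finally show ?thesis by (simp add: avg_def)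
qed

lemma bmo_nonneg:
  assumes "bmo b D" shows "0 \<le> D"
  using assms org_space avg_nonneg[of 0 org "\<lambda>y. \<bar>b y - avg 0 b org\<bar>"]
  unfolding bmo_def by (meson abs_ge_zero order_trans)

lemma avg_minus_const:
  "loc_int b \<Longrightarrow> x \<in> space M \<Longrightarrow> avg \<gamma> (\<lambda>y. b y - c) x = avg \<gamma> b x - c"
  by (subst avg_diff) (auto simp: loc_intD)

lemma avg_minus_const_le:
  assumes "loc_int b" "x \<in> space M"
  shows "\<bar>avg \<gamma> b x - c\<bar> \<le> avg \<gamma> (\<lambda>y. \<bar>b y - c\<bar>) x"
  unfolding avg_minus_const[OF assms, symmetric]
  by (rule abs_avg_le[OF assms(2)]) (use assms loc_intD loc_int_diff in auto)

text \<open>The mean of a nonnegative function over a ball is at most \<open>P\<close> times its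
  mean over the parent ball, because the measures differ by the factor \<open>P\<close>.\<close>

lemma bmo_step:
  assumes b: "bmo b D" and x: "x \<in> space M"
  shows "\<bar>avg \<gamma> b x - avg (\<gamma> + 1) b x\<bar> \<le> P * D"
proof -
  have l: "loc_int b" using b by (simp add: bmo_def)
  let ?c = "avg (\<gamma> + 1) b x"
  have "\<bar>avg \<gamma> b x - ?c\<bar> \<le> avg \<gamma> (\<lambda>y. \<bar>b y - ?c\<bar>) x"
    by (rule avg_minus_const_le[OF l x])
  also have "\<dots> \<le> P * avg (\<gamma> + 1) (\<lambda>y. \<bar>b y - ?c\<bar>) x"
    by (rule avg_le_parent[OF x]) (use l loc_int_const_diff_abs in auto)
  also have "\<dots> \<le> P * D" using b x by (intro mult_left_mono) (auto simp: bmo_def)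
  finally show ?thesis .
qed

text \<open>The linear growth in the number of scales is what the error terms of the large balls
  have to compensate.\<close>

lemma bmo_steps:
  assumes b: "bmo b D" and x: "x \<in> space M"
  shows "\<bar>avg \<gamma> b x - avg (\<gamma> + int k) b x\<bar> \<le> real k * (P * D)"
proof (induction k)
  case (Suc k)
  have "\<bar>avg (\<gamma> + int k) b x - avg (\<gamma> + int k + 1) b x\<bar> \<le> P * D"
    by (rule bmo_step[OF b x])
  moreover have "\<gamma> + int k + 1 = \<gamma> + int (Suc k)" by simp
  ultimately show ?case using Suc by (simp add: algebra_simps)
qed simp

definition osc_exp :: "real \<Rightarrow> ('a \<Rightarrow> real) \<Rightarrow> nat \<Rightarrow> int \<Rightarrow> 'a \<Rightarrow> ennreal" where
  "osc_exp t b d \<gamma> y = (SUP i\<in>{..d}. ennreal (exp (t * \<bar>avg (\<gamma> - int i) b y - avg \<gamma> b y\<bar>)))"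

lemma osc_exp_measurable [measurable]: "osc_exp t b d \<gamma> \<in> borel_measurable M"
  unfolding osc_exp_def by measurable

text \<open>Induction on the number d of scales: stop at the first scale where the average of b leaves the interval
  of radius 2D around b_B. The stopping balls fill at most half of B, and the jump at the stopping
  scale is at most P D, so the constant 6 reproduces itself: 3/2 + 3/2 * 6 / 2 = 6.\<close>

lemma osc_exp_bound:
  assumes b: "bmo b D" and D: "0 < D" and t: "t = ln (3/2) / ((P + 2) * D)"
  shows "z \<in> space M \<Longrightarrow> (\<integral>\<^sup>+y\<in>B \<gamma> z. osc_exp t b d \<gamma> y \<partial>M) \<le> 6 * ennreal (P powr \<gamma>)"
proof (induction d arbitrary: \<gamma> z rule: less_induct)
  case (less d)
  have l: "loc_int b" using b by (simp add: bmo_def)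
  have [measurable]: "b \<in> borel_measurable M" using l loc_intD by auto
  let ?Q = "B \<gamma> z" and ?c = "avg \<gamma> b z"
  have Qs [measurable]: "?Q \<in> sets M" using less by (simp add: ball_sets)
  have P2: "0 < P + 2" using P_pos(1) by linarith
  have tpos: "0 < t" unfolding t using D P2 by (intro divide_pos_pos mult_pos_pos) auto
  \<comment> \<open>The denominator of \<open>t\<close> is the largest deviation at the moment of
    stopping: \<open>2 * D\<close> just before it and at most \<open>P * D\<close> for the jump. The
    exponential can therefore grow by no more than 3/2 up to that point.\<close>
  have t32: "exp (t * ((P + 2) * D)) = 3/2" using t D P2 by simp
  have t2: "exp (t * s) \<le> 3/2" if "s \<le> 2 * D" for s
  proof -
    have "t * s \<le> t * ((P + 2) * D)"
      using that tpos D P_pos by (intro mult_left_mono) (auto intro: order_trans)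
    then show ?thesis using t32 by (metis exp_le_cancel_iff)
  qed
  \<comment> \<open>The points where the average first leaves the interval at scale
    \<open>\<gamma> - int i\<close>. Only averages at this scale and above enter, so the set is a
    union of balls of this scale.\<close>
  define \<tau> where "\<tau> i = {y \<in> ?Q. 2 * D < \<bar>avg (\<gamma> - int i) b y - avg \<gamma> b y\<bar> \<and>
     (\<forall>i'<i. \<bar>avg (\<gamma> - int i') b y - avg \<gamma> b y\<bar> \<le> 2 * D)}" for i
  have \<tau>Q: "\<tau> i \<subseteq> ?Q" for i by (auto simp: \<tau>_def)
  have \<tau>sat: "saturated (\<gamma> - int i) (\<tau> i)" for i
  proof -
    have lc: "locally_const (\<gamma> - int i) (avg (\<gamma> - int i') b)" if "i' \<le> i" for i'
      using avg_locally_const locally_const_antimono that by (metis diff_left_mono of_nat_le_iff)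
    have lc0: "locally_const (\<gamma> - int i) (avg \<gamma> b)" using lc[of 0] by simp
    have "saturated (\<gamma> - int i) (?Q \<inter> {y \<in> space M. 2 * D < \<bar>avg (\<gamma> - int i) b y - avg \<gamma> b y\<bar> \<and>
     (\<forall>i'<i. \<bar>avg (\<gamma> - int i') b y - avg \<gamma> b y\<bar> \<le> 2 * D)})"
    proof (intro saturated_Int saturated_Collect)
      show "saturated (\<gamma> - int i) ?Q"
        by (rule saturated_antimono[OF saturated_ball[OF less.prems, of \<gamma>]]) simp
      show "locally_const (\<gamma> - int i) (\<lambda>y. 2 * D < \<bar>avg (\<gamma> - int i) b y - avg \<gamma> b y\<bar> \<and>
         (\<forall>i'<i. \<bar>avg (\<gamma> - int i') b y - avg \<gamma> b y\<bar> \<le> 2 * D))"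
        unfolding locally_const_def
      proof (intro ballI)
        fix x y assume xy: "x \<in> space M" "y \<in> B (\<gamma> - int i) x"
        have e: "avg (\<gamma> - int i') b y = avg (\<gamma> - int i') b x" if "i' \<le> i" for i'
          by (rule locally_constD[OF lc[OF that] xy])
        have e0: "avg \<gamma> b y = avg \<gamma> b x" by (rule locally_constD[OF lc0 xy])
        show "(2 * D < \<bar>avg (\<gamma> - int i) b y - avg \<gamma> b y\<bar> \<and> (\<forall>i'<i. \<bar>avg (\<gamma> - int i') b y - avg \<gamma> b y\<bar> \<le> 2 * D)) =
          (2 * D < \<bar>avg (\<gamma> - int i) b x - avg \<gamma> b x\<bar> \<and> (\<forall>i'<i. \<bar>avg (\<gamma> - int i') b x - avg \<gamma> b x\<bar> \<le> 2 * D))"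
          using e e0 by simp
      qed
    qed
    moreover have "?Q \<inter> {y \<in> space M. 2 * D < \<bar>avg (\<gamma> - int i) b y - avg \<gamma> b y\<bar> \<and>
     (\<forall>i'<i. \<bar>avg (\<gamma> - int i') b y - avg \<gamma> b y\<bar> \<le> 2 * D)} = \<tau> i"
      using ball_subset_space[OF less.prems] by (auto simp: \<tau>_def)
    ultimately show ?thesis by simp
  qed
  have \<tau>s [measurable]: "\<tau> i \<in> sets M" for i using \<tau>sat saturated_sets by blast
  have disj: "disjoint_family_on \<tau> I" for I
  proof -
    have "y \<notin> \<tau> j" if "y \<in> \<tau> i" "i < j" for i j y
      using that unfolding \<tau>_def by force
    then show ?thesis
      unfolding disjoint_family_on_def by (metis disjoint_iff linorder_neqE_nat)
  qed
  \<comment> \<open>Scales before the stopping one contribute at most 3/2. Beyond it the deviation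
    is measured afresh from the average on the stopping ball, at the cost of a factor 3/2.\<close>
  have pw: "osc_exp t b d \<gamma> y \<le> ennreal (3/2) + (\<Sum>i\<in>{1..d}. ennreal (3/2) * (osc_exp t b (d - i) (\<gamma> - int i) y * indicator (\<tau> i) y))"
    if y: "y \<in> ?Q" for y
  proof (cases "\<exists>i\<le>d. 2 * D < \<bar>avg (\<gamma> - int i) b y - avg \<gamma> b y\<bar>")
    case False
    then have "osc_exp t b d \<gamma> y \<le> ennreal (3/2)"
      unfolding osc_exp_def by (intro SUP_least ennreal_leI t2) auto
    then show ?thesis by (simp add: add_increasing2)
  next
    case True
    have ys: "y \<in> space M" using y less.prems ball_in_space by blast
    define i where "i = (LEAST i. 2 * D < \<bar>avg (\<gamma> - int i) b y - avg \<gamma> b y\<bar>)"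
    have i1: "2 * D < \<bar>avg (\<gamma> - int i) b y - avg \<gamma> b y\<bar>"
      unfolding i_def by (rule LeastI_ex) (use True in auto)
    have i2: "\<bar>avg (\<gamma> - int i') b y - avg \<gamma> b y\<bar> \<le> 2 * D" if "i' < i" for i'
      using not_less_Least[OF that[unfolded i_def]] by simp
    have id: "i \<le> d" using True Least_le unfolding i_def by (metis (mono_tags, lifting) order_trans)
    \<comment> \<open>At \<open>i = 0\<close> the deviation vanishes. The stopping scale is thus
      strictly smaller and the induction hypothesis applies to \<open>d - i\<close>.\<close>
    have i0: "1 \<le> i" using i1 D by (cases i) auto
    have yt: "y \<in> \<tau> i" using y i1 i2 by (auto simp: \<tau>_def)
    have "osc_exp t b d \<gamma> y \<le> ennreal (3/2) + ennreal (3/2) * osc_exp t b (d - i) (\<gamma> - int i) y"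
      unfolding osc_exp_def[of t b d]
    proof (rule SUP_least)
      fix i' assume i': "i' \<in> {..d}"
      show "ennreal (exp (t * \<bar>avg (\<gamma> - int i') b y - avg \<gamma> b y\<bar>)) \<le> ennreal (3/2) + ennreal (3/2) * osc_exp t b (d - i) (\<gamma> - int i) y"
      proof (cases "i' < i")
        case True
        then have "ennreal (exp (t * \<bar>avg (\<gamma> - int i') b y - avg \<gamma> b y\<bar>)) \<le> ennreal (3/2)"
          using i2 t2 by (intro ennreal_leI) auto
        then show ?thesis by (simp add: add_increasing2)
      next
        case False
        let ?X = "\<bar>avg (\<gamma> - int i') b y - avg (\<gamma> - int i) b y\<bar>"
        \<comment> \<open>The parent of a stopping ball has not yet left the interval, so the
          deviation at stopping is at most \<open>2 * D\<close> plus one jump.\<close>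
        have "\<bar>avg (\<gamma> - int i) b y - avg (\<gamma> - int i + 1) b y\<bar> \<le> P * D" by (rule bmo_step[OF b ys])
        moreover have "\<bar>avg (\<gamma> - int i + 1) b y - avg \<gamma> b y\<bar> \<le> 2 * D"
        proof -
          have "\<gamma> - int (i - 1) = \<gamma> - int i + 1" using i0 by simp
          moreover have "\<bar>avg (\<gamma> - int (i - 1)) b y - avg \<gamma> b y\<bar> \<le> 2 * D" using i0 by (intro i2) auto
          ultimately show ?thesis by (simp only:)
        qed
        moreover have "(P + 2) * D = P * D + 2 * D" by (rule distrib_right)
        ultimately have "\<bar>avg (\<gamma> - int i') b y - avg \<gamma> b y\<bar> \<le> ?X + (P + 2) * D"
          by linarith
        then have "exp (t * \<bar>avg (\<gamma> - int i') b y - avg \<gamma> b y\<bar>) \<le> exp (t * (?X + (P + 2) * D))"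
          using tpos by simp
        also have "\<dots> = 3/2 * exp (t * ?X)"
          by (simp add: distrib_left exp_add t32)
        finally have "ennreal (exp (t * \<bar>avg (\<gamma> - int i') b y - avg \<gamma> b y\<bar>)) \<le> ennreal (3/2) * ennreal (exp (t * ?X))"
          by (simp add: ennreal_leI flip: ennreal_mult)
        also have "ennreal (exp (t * ?X)) \<le> osc_exp t b (d - i) (\<gamma> - int i) y"
          unfolding osc_exp_def by (rule SUP_upper2[of "i' - i"]) (use False i' id in \<open>auto simp: algebra_simps of_nat_diff\<close>)
        finally show ?thesis by (simp add: add_increasing mult_left_mono)
      qed
    qed
    also have "ennreal (3/2) * osc_exp t b (d - i) (\<gamma> - int i) y
       = ennreal (3/2) * (osc_exp t b (d - i) (\<gamma> - int i) y * indicator (\<tau> i) y)" using yt by simp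
    also have "\<dots> \<le> (\<Sum>i\<in>{1..d}. ennreal (3/2) * (osc_exp t b (d - i) (\<gamma> - int i) y * indicator (\<tau> i) y))"
      using i0 id by (intro member_le_sum) auto
    finally show ?thesis by (simp add: add_left_mono)
  qed
  \<comment> \<open>Chebyshev's inequality on balls: \<open>\<bar>b - ?c\<bar>\<close> has mean
    above \<open>2 * D\<close> on every stopping ball, but mean at most \<open>D\<close> on the
    whole ball.\<close>
  have weak: "(\<Sum>i\<in>{1..d}. emeasure M (\<tau> i)) \<le> ennreal (1/2) * ennreal (P powr \<gamma>)"
  proof -
    let ?g = "\<lambda>y. ennreal \<bar>b y - ?c\<bar>"
    have lg: "loc_int (\<lambda>y. \<bar>b y - ?c\<bar>)" using l by (rule loc_int_const_diff_abs)
    have one: "ennreal (2 * D) * emeasure M (\<tau> i) \<le> emeasure (density M ?g) (\<tau> i)" for i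
    proof -
      have "(\<integral>\<^sup>+y\<in>\<tau> i. ennreal (2 * D) \<partial>M) \<le> (\<integral>\<^sup>+y\<in>\<tau> i. ?g y \<partial>M)"
      proof (rule nn_integral_saturated_mono[OF \<tau>sat])
        fix x assume x: "x \<in> \<tau> i"
        have xQ: "x \<in> ?Q" using x \<tau>Q by blast
        have xs: "x \<in> space M" using xQ less.prems ball_in_space by blast
        have "2 * D \<le> \<bar>avg (\<gamma> - int i) b x - ?c\<bar>"
          using x avg_eq[OF less.prems xQ, of b] by (simp add: \<tau>_def)
        also have "\<dots> \<le> avg (\<gamma> - int i) (\<lambda>y. \<bar>b y - ?c\<bar>) x"
          by (rule avg_minus_const_le[OF l xs])
        finally have "ennreal (2 * D) * ennreal (P powr (\<gamma> - int i)) \<le> ennreal (avg (\<gamma> - int i) (\<lambda>y. \<bar>b y - ?c\<bar>) x) * ennreal (P powr (\<gamma> - int i))"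
          by (intro mult_right_mono ennreal_leI) auto
        also have "\<dots> = (\<integral>\<^sup>+y\<in>B (\<gamma> - int i) x. ?g y \<partial>M)"
          by (rule nn_integral_avg[symmetric]) (use xs loc_intD(2)[OF lg xs] in auto)
        finally show "(\<integral>\<^sup>+y\<in>B (\<gamma> - int i) x. ennreal (2 * D) \<partial>M) \<le> (\<integral>\<^sup>+y\<in>B (\<gamma> - int i) x. ?g y \<partial>M)"
          using xs by (simp add: nn_integral_cmult_indicator ball_sets emeasure_ball)
      qed auto
      then show ?thesis by (simp add: nn_integral_cmult_indicator emeasure_density)
    qed
    have "ennreal (2 * D) * (\<Sum>i\<in>{1..d}. emeasure M (\<tau> i)) \<le> (\<Sum>i\<in>{1..d}. emeasure (density M ?g) (\<tau> i))"
      unfolding sum_distrib_left by (intro sum_mono one)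
    also have "\<dots> = emeasure (density M ?g) (\<Union>i\<in>{1..d}. \<tau> i)"
      using disj by (intro sum_emeasure) auto
    also have "\<dots> \<le> emeasure (density M ?g) ?Q"
      using \<tau>Q by (intro emeasure_mono) auto
    also have "\<dots> = ennreal (avg \<gamma> (\<lambda>y. \<bar>b y - ?c\<bar>) z) * ennreal (P powr \<gamma>)"
      using nn_integral_avg[of z \<gamma> "\<lambda>y. \<bar>b y - ?c\<bar>"] less.prems loc_intD(2)[OF lg less.prems]
      by (simp add: emeasure_density)
    also have "\<dots> \<le> ennreal D * ennreal (P powr \<gamma>)"
      using b less.prems by (intro mult_right_mono ennreal_leI) (auto simp: bmo_def)
    finally have "ennreal (1 / (2 * D)) * (ennreal (2 * D) * (\<Sum>i\<in>{1..d}. emeasure M (\<tau> i))) \<le> ennreal (1 / (2 * D)) * (ennreal D * ennreal (P powr \<gamma>))"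
      by (intro mult_left_mono) auto
    moreover have "ennreal (1 / (2 * D)) * (ennreal (2 * D) * X) = X" for X
      using D by (simp add: mult.assoc[symmetric] ennreal_mult[symmetric])
    moreover have "ennreal (1 / (2 * D)) * (ennreal D * X) = ennreal (1/2) * X" for X
      using D by (simp only: mult.assoc[symmetric] ennreal_mult[symmetric]) (simp add: ennreal_mult[symmetric])
    ultimately show ?thesis by simp
  qed
  have "(\<integral>\<^sup>+y\<in>?Q. osc_exp t b d \<gamma> y \<partial>M)
     \<le> (\<integral>\<^sup>+y. (ennreal (3/2) * indicator ?Q y + (\<Sum>i\<in>{1..d}. ennreal (3/2) * (osc_exp t b (d - i) (\<gamma> - int i) y * indicator (\<tau> i) y))) \<partial>M)"
  proof (rule nn_integral_mono)
    fix y
    show "osc_exp t b d \<gamma> y * indicator ?Q y \<le> ennreal (3/2) * indicator ?Q y + (\<Sum>i\<in>{1..d}. ennreal (3/2) * (osc_exp t b (d - i) (\<gamma> - int i) y * indicator (\<tau> i) y))"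
      by (cases "y \<in> ?Q") (use pw in auto)
  qed
  also have "\<dots> = ennreal (3/2) * ennreal (P powr \<gamma>) + (\<Sum>i\<in>{1..d}. ennreal (3/2) * (\<integral>\<^sup>+y\<in>\<tau> i. osc_exp t b (d - i) (\<gamma> - int i) y \<partial>M))"
    using less.prems by (simp add: nn_integral_add nn_integral_sum nn_integral_cmult nn_integral_cmult_indicator emeasure_ball)
  also have "\<dots> \<le> ennreal (3/2) * ennreal (P powr \<gamma>) + (\<Sum>i\<in>{1..d}. ennreal (3/2) * (6 * emeasure M (\<tau> i)))"
  proof (intro add_left_mono sum_mono mult_left_mono nn_integral_saturated_le[OF \<tau>sat])
    fix i x assume "i \<in> {1..d}" "x \<in> \<tau> i"
    then show "(\<integral>\<^sup>+y\<in>B (\<gamma> - int i) x. osc_exp t b (d - i) (\<gamma> - int i) y \<partial>M) \<le> 6 * ennreal (P powr (\<gamma> - int i))"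
      using ball_in_space[OF less.prems subsetD[OF \<tau>Q]] by (intro less.IH) auto
  qed auto
  also have "(\<Sum>i\<in>{1..d}. ennreal (3/2) * (6 * emeasure M (\<tau> i))) = ennreal 9 * (\<Sum>i\<in>{1..d}. emeasure M (\<tau> i))"
    unfolding sum_distrib_left
    by (intro sum.cong refl) (simp add: mult.assoc[symmetric] ennreal_mult[symmetric] flip: ennreal_numeral)
  also have "\<dots> \<le> ennreal 9 * (ennreal (1/2) * ennreal (P powr \<gamma>))"
    by (intro mult_left_mono weak) auto
  also have "ennreal (3/2) * ennreal (P powr \<gamma>) + ennreal 9 * (ennreal (1/2) * ennreal (P powr \<gamma>)) = 6 * ennreal (P powr \<gamma>)"
  proof -
    have *: "ennreal 9 * (ennreal (1/2) * ennreal v) = ennreal (9/2 * v)" if "0 \<le> v" for v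
      using that ennreal_mult[of "1/2" v] ennreal_mult[of 9 "1/2 * v"] by simp
    show ?thesis unfolding *[OF powr_ge_zero]
      by (simp add: ennreal_mult[symmetric] ennreal_plus[symmetric] flip: ennreal_numeral) 
  qed
  finally show ?case by (simp add: add_left_mono)
qed

definition max_osc_exp :: "real \<Rightarrow> ('a \<Rightarrow> real) \<Rightarrow> int \<Rightarrow> 'a \<Rightarrow> ennreal" where
  "max_osc_exp t b \<gamma> y = (SUP i. ennreal (exp (t * \<bar>avg (\<gamma> - int i) b y - avg \<gamma> b y\<bar>)))"

lemma max_osc_exp_measurable [measurable]: "max_osc_exp t b \<gamma> \<in> borel_measurable M"
  unfolding max_osc_exp_def by measurable

theorem john_nirenberg:
  assumes b: "bmo b D"
  shows "\<exists>t>0. \<forall>\<gamma>. \<forall>z\<in>space M. (\<integral>\<^sup>+y\<in>B \<gamma> z. max_osc_exp t b \<gamma> y \<partial>M) \<le> 6 * ennreal (P powr \<gamma>)"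
proof -
  \<comment> \<open>The choice of \<open>t\<close> divides by the constant, which must therefore be
    positive.\<close>
  have b': "bmo b (max D 1)"
    using b unfolding bmo_def by (meson max.coboundedI1)
  define t where "t = ln (3/2) / ((P + 2) * max D 1)"
  have "0 < t" using P_pos unfolding t_def by (intro divide_pos_pos mult_pos_pos) (auto simp: add_pos_pos)
  moreover have "(\<integral>\<^sup>+y\<in>B \<gamma> z. max_osc_exp t b \<gamma> y \<partial>M) \<le> 6 * ennreal (P powr \<gamma>)" if z: "z \<in> space M" for \<gamma> z
  proof -
    have [measurable]: "B \<gamma> z \<in> sets M" using z by (simp add: ball_sets)
    have eq: "max_osc_exp t b \<gamma> y * indicator (B \<gamma> z) y = (SUP d. osc_exp t b d \<gamma> y * indicator (B \<gamma> z) y)" for y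
    proof -
      have "max_osc_exp t b \<gamma> y = (SUP d. osc_exp t b d \<gamma> y)"
        unfolding max_osc_exp_def osc_exp_def
      proof (intro antisym SUP_least)
        show "ennreal (exp (t * \<bar>avg (\<gamma> - int i) b y - avg \<gamma> b y\<bar>)) \<le>
          (SUP d. SUP i\<in>{..d}. ennreal (exp (t * \<bar>avg (\<gamma> - int i) b y - avg \<gamma> b y\<bar>)))" for i
          by (rule SUP_upper2[of i]) (auto intro: SUP_upper)
      qed (auto intro: SUP_upper)
      then show ?thesis by (simp add: SUP_mult_right_ennreal)
    qed
    have inc: "incseq (\<lambda>d y. osc_exp t b d \<gamma> y * indicator (B \<gamma> z) y)"
      unfolding incseq_def le_fun_def osc_exp_def
      by (intro allI impI mult_right_mono SUP_subset_mono) auto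
    have "(\<integral>\<^sup>+y\<in>B \<gamma> z. max_osc_exp t b \<gamma> y \<partial>M) = (SUP d. \<integral>\<^sup>+y\<in>B \<gamma> z. osc_exp t b d \<gamma> y \<partial>M)"
      unfolding eq by (intro nn_integral_monotone_convergence_SUP[OF inc]) auto
    also have "\<dots> \<le> 6 * ennreal (P powr \<gamma>)"
      using z by (intro SUP_least osc_exp_bound[OF b' _ t_def]) auto
    finally show ?thesis .
  qed
  ultimately show ?thesis by blast
qed

text \<open>At a point of differentiation \<open>b y\<close> is a limit of averages, all but
  finitely many of which have a scale below \<open>\<gamma>\<close>. One null set serves all
  \<open>\<gamma>\<close>.\<close>

lemma AE_osc_le_max_osc:
  assumes l: "loc_int b"
  shows "AE y in M. \<forall>\<gamma>. ennreal (exp (t * \<bar>b y - avg \<gamma> b y\<bar>)) \<le> max_osc_exp t b \<gamma> y"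
  using lebesgue_differentiation[OF l]
proof eventually_elim
  fix y assume "\<exists>r::nat\<Rightarrow>nat. strict_mono r \<and> (\<lambda>i. avg (- int (r i)) b y) \<longlonglongrightarrow> b y"
  then obtain r :: "nat \<Rightarrow> nat" where r: "strict_mono r" "(\<lambda>i. avg (- int (r i)) b y) \<longlonglongrightarrow> b y" by blast
  show "\<forall>\<gamma>. ennreal (exp (t * \<bar>b y - avg \<gamma> b y\<bar>)) \<le> max_osc_exp t b \<gamma> y"
  proof
    fix \<gamma>
    have "(\<lambda>i. ennreal (exp (t * \<bar>avg (- int (r i)) b y - avg \<gamma> b y\<bar>))) \<longlonglongrightarrow> ennreal (exp (t * \<bar>b y - avg \<gamma> b y\<bar>))"
      by (intro tendsto_ennrealI tendsto_intros r(2))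
    moreover have "ennreal (exp (t * \<bar>avg (- int (r i)) b y - avg \<gamma> b y\<bar>)) \<le> max_osc_exp t b \<gamma> y" if "i \<ge> nat (- \<gamma>)" for i
    proof -
      have "i \<le> r i" using r(1) by (rule strict_mono_imp_increasing)
      then obtain k where k: "- int (r i) = \<gamma> - int k"
        using \<open>i \<ge> nat (- \<gamma>)\<close> by (intro that[of "nat (\<gamma> + int (r i))"]) linarith
      show ?thesis unfolding max_osc_exp_def k by (rule SUP_upper) simp
    qed
    ultimately show "ennreal (exp (t * \<bar>b y - avg \<gamma> b y\<bar>)) \<le> max_osc_exp t b \<gamma> y"
      by (intro LIMSEQ_le_const2[OF _ exI[of _ "nat (- \<gamma>)"]]) blast+
  qed
qed

text \<open>The supremum stands inside the integral because the weighted maximal inequality replaces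
  the weight of a ball by the largest weight among the balls below a maximal one.\<close>

theorem bmo_maximal_moments:
  assumes b: "bmo b D"
  shows "\<exists>C>0. \<forall>\<gamma>. \<forall>z\<in>space M.
    (\<integral>\<^sup>+y\<in>B \<gamma> z. (SUP j\<in>{..\<gamma>}. ennreal ((1 + \<bar>b y - avg j b y\<bar>) ^ N)) \<partial>M) \<le> ennreal C * ennreal (P powr \<gamma>)"
proof -
  have l: "loc_int b" using b by (simp add: bmo_def)
  obtain t where t: "0 < t" and jn: "\<And>\<gamma> z. z \<in> space M \<Longrightarrow> (\<integral>\<^sup>+y\<in>B \<gamma> z. max_osc_exp t b \<gamma> y \<partial>M) \<le> 6 * ennreal (P powr \<gamma>)"
    using john_nirenberg[OF b] by blast
  obtain C where C: "0 < C" "\<And>u. 0 \<le> u \<Longrightarrow> (1 + 2 * u) ^ N \<le> C * exp (t * u)"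
    using power_le_exp[OF t, of 2 N] by auto
  have ae: "AE y in M. \<forall>\<gamma>. (SUP j\<in>{..\<gamma>}. ennreal ((1 + \<bar>b y - avg j b y\<bar>) ^ N)) \<le> ennreal C * max_osc_exp t b \<gamma> y"
    using AE_osc_le_max_osc[OF l, of t]
  proof eventually_elim
    fix y assume y: "\<forall>\<gamma>. ennreal (exp (t * \<bar>b y - avg \<gamma> b y\<bar>)) \<le> max_osc_exp t b \<gamma> y"
    show "\<forall>\<gamma>. (SUP j\<in>{..\<gamma>}. ennreal ((1 + \<bar>b y - avg j b y\<bar>) ^ N)) \<le> ennreal C * max_osc_exp t b \<gamma> y"
    proof (intro allI SUP_least)
      fix \<gamma> j :: int assume j: "j \<in> {..\<gamma>}"
      \<comment> \<open>Both deviations from the average at scale \<open>\<gamma>\<close> are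
        controlled by the maximal oscillation, and the deviation from the average at scale
        \<open>j\<close> is at most twice the larger one.\<close>
      define u where "u = max \<bar>b y - avg \<gamma> b y\<bar> \<bar>avg j b y - avg \<gamma> b y\<bar>"
      have "\<bar>b y - avg \<gamma> b y\<bar> \<le> u" "\<bar>avg j b y - avg \<gamma> b y\<bar> \<le> u" by (auto simp: u_def)
      then have "(1 + \<bar>b y - avg j b y\<bar>) ^ N \<le> (1 + 2 * u) ^ N"
        by (intro power_mono; linarith)
      also have "\<dots> \<le> C * exp (t * u)" by (rule C) (simp add: u_def)
      finally have "ennreal ((1 + \<bar>b y - avg j b y\<bar>) ^ N) \<le> ennreal C * ennreal (exp (t * u))"
        using C by (simp add: ennreal_leI flip: ennreal_mult)
      also have "ennreal (exp (t * u)) \<le> max_osc_exp t b \<gamma> y"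
      proof (cases "u = \<bar>b y - avg \<gamma> b y\<bar>")
        case False
        then have "u = \<bar>avg j b y - avg \<gamma> b y\<bar>" by (auto simp: u_def)
        then show ?thesis
          using j unfolding max_osc_exp_def by (intro SUP_upper2[of "nat (\<gamma> - j)"]) auto
      qed (use y in auto)
      finally show "ennreal ((1 + \<bar>b y - avg j b y\<bar>) ^ N) \<le> ennreal C * max_osc_exp t b \<gamma> y"
        by (simp add: mult_left_mono)
    qed
  qed
  have "(\<integral>\<^sup>+y\<in>B \<gamma> z. (SUP j\<in>{..\<gamma>}. ennreal ((1 + \<bar>b y - avg j b y\<bar>) ^ N)) \<partial>M) \<le> ennreal (6 * C) * ennreal (P powr \<gamma>)"
    if z: "z \<in> space M" for \<gamma> z
  proof -
    have [measurable]: "B \<gamma> z \<in> sets M" using z by (simp add: ball_sets)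
    have "(\<integral>\<^sup>+y\<in>B \<gamma> z. (SUP j\<in>{..\<gamma>}. ennreal ((1 + \<bar>b y - avg j b y\<bar>) ^ N)) \<partial>M)
       \<le> (\<integral>\<^sup>+y. ennreal C * (max_osc_exp t b \<gamma> y * indicator (B \<gamma> z) y) \<partial>M)"
      by (rule nn_integral_mono_AE, use ae in eventually_elim) (auto simp: indicator_def)
    also have "\<dots> = ennreal C * (\<integral>\<^sup>+y\<in>B \<gamma> z. max_osc_exp t b \<gamma> y \<partial>M)"
      by (intro nn_integral_cmult) auto
    also have "\<dots> \<le> ennreal C * (6 * ennreal (P powr \<gamma>))"
      by (intro mult_left_mono jn z) auto
    also have "\<dots> = ennreal (6 * C) * ennreal (P powr \<gamma>)"
      using C by (simp add: ennreal_mult' mult_ac)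
    finally show ?thesis .
  qed
  then show ?thesis using C by (intro exI[of _ "6 * C"]) auto
qed

end

section \<open>A weighted maximal inequality\<close>

text \<open>Above \<open>c\<close> the factor \<open>(a / c) powr (\<rho> - 1)\<close> is at least
  1. This elementary bound takes the place of convexity.\<close>

lemma le_add_powr:
  fixes a c \<rho> :: real
  assumes "0 \<le> a" "0 < c" "1 \<le> \<rho>"
  shows "a \<le> c + c powr (1 - \<rho>) * a powr \<rho>"
proof (cases "a \<le> c")
  case True
  then show ?thesis by (intro order_trans[OF True]) simp
next
  case False
  have "a = a powr (1 - \<rho>) * a powr \<rho>" using assms False by (simp flip: powr_add)
  also have "\<dots> \<le> c powr (1 - \<rho>) * a powr \<rho>"
    using assms False by (intro mult_right_mono powr_mono2') auto
  finally show ?thesis using assms by linarith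
qed

lemma geometric_sum_below:
  fixes a h :: real assumes a: "0 < a" and h: "0 < h"
  shows "(\<integral>\<^sup>+k. (if 2 powr real_of_int k < h then ennreal (2 powr (a * real_of_int k)) else 0) \<partial>count_space UNIV)
    \<le> ennreal (h powr a / (1 - 2 powr - a))"
proof -
  \<comment> \<open>The largest integer with \<open>2 powr k0 < h\<close>; the ceiling minus one
    respects the strict inequality. The sum is then a geometric series running downwards from
    \<open>k0\<close>.\<close>
  define k0 where "k0 = \<lceil>log 2 h\<rceil> - 1"
  have k0: "2 powr real_of_int k0 < h"
  proof -
    have "real_of_int k0 < log 2 h" unfolding k0_def by linarith
    then show ?thesis using h by (simp add: less_log_iff)
  qed
  have le: "k \<le> k0" if "2 powr real_of_int k < h" for k :: int
  proof -
    have "real_of_int k < log 2 h" using that h by (simp add: less_log_iff)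
    then show ?thesis unfolding k0_def by linarith
  qed
  let ?g = "\<lambda>k::int. ennreal (2 powr (a * real_of_int k))"
  have "(\<integral>\<^sup>+k. (if 2 powr real_of_int k < h then ?g k else 0) \<partial>count_space UNIV)
     \<le> (\<integral>\<^sup>+k. ?g k * indicator {..k0} k \<partial>count_space UNIV)"
    by (intro nn_integral_mono) (auto simp: le)
  also have "\<dots> = (\<integral>\<^sup>+k. ?g k \<partial>count_space {..k0})"
    by (simp add: nn_integral_count_space_indicator)
  also have "\<dots> = (\<integral>\<^sup>+n. ?g (k0 - int n) \<partial>count_space UNIV)"
    by (rule nn_integral_bij_count_space[symmetric])
       (auto simp: bij_betw_def inj_on_def image_iff intro!: exI[of _ "nat (k0 - _)"])
  also have "\<dots> = (\<Sum>n. ?g (k0 - int n))" by (rule nn_integral_count_space_nat)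
  also have "\<dots> = (\<Sum>n. ennreal (2 powr (a * k0) * (2 powr - a) ^ n))"
    by (intro suminf_cong arg_cong[where f=ennreal]) (simp add: powr_realpow[symmetric] powr_powr algebra_simps flip: powr_add)
  also have "\<dots> = ennreal (\<Sum>n. 2 powr (a * k0) * (2 powr - a) ^ n)"
    using a by (intro suminf_ennreal2 summable_mult summable_geometric) (auto simp: powr_minus_divide)
  also have "(\<Sum>n. 2 powr (a * k0) * (2 powr - a) ^ n) = 2 powr (a * k0) * (1 / (1 - 2 powr - a))"
    using a by (subst suminf_mult) (auto simp: powr_minus_divide suminf_geometric intro!: summable_geometric)
  also have "\<dots> \<le> h powr a * (1 / (1 - 2 powr - a))"
  proof (rule mult_right_mono)
    have "2 powr (a * k0) = (2 powr k0) powr a" by (simp add: powr_powr mult.commute)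
    also have "\<dots> \<le> h powr a" using k0 a by (intro powr_mono2) auto
    finally show "2 powr (a * k0) \<le> h powr a" .
    have "2 powr - a \<le> 1" using a powr_mono[of "- a" 0 2] by simp
    then show "0 \<le> 1 / (1 - 2 powr - a)" by simp
  qed
  finally show ?thesis by (simp add: ennreal_leI)
qed

context ball_space begin

text \<open>In \<open>le_add_powr\<close> take for \<open>c\<close> half of the average of
  \<open>f\<close>, which is then absorbed on the left. Compared with Jensen's inequality a factor
  \<open>2 powr \<rho>\<close> is lost, and the majorant \<open>g\<close> may be a power with a
  variable exponent.\<close>

lemma weak_jensen:
  assumes x: "x \<in> space M" and f: "set_integrable M (B \<gamma> x) f" "\<And>y. 0 \<le> f y"
    and g: "set_integrable M (B \<gamma> x) g" and \<rho>: "1 \<le> \<rho>"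
    and le: "AE y in M. y \<in> B \<gamma> x \<longrightarrow> f y powr \<rho> \<le> g y"
  shows "avg \<gamma> f x powr \<rho> \<le> 2 powr \<rho> * avg \<gamma> g x"
proof -
  define t where "t = avg \<gamma> f x"
  have t0: "0 \<le> t" unfolding t_def using f by (intro avg_nonneg) auto
  have g0: "0 \<le> avg \<gamma> g x"
  proof -
    have "avg \<gamma> (\<lambda>_. 0) x \<le> avg \<gamma> g x"
      by (rule avg_mono_AE[OF x _ g]) (use x le in \<open>auto elim!: eventually_mono intro: order_trans[OF powr_ge_zero]\<close>)
    then show ?thesis using x by simp
  qed
  show ?thesis
  proof (cases "t = 0")
    case True
    then show ?thesis using g0 by (simp add: t_def[symmetric])
  next
    case False
    then have tp: "0 < t" using t0 by simp
    let ?d = "(t / 2) powr (1 - \<rho>)"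
    have ig: "set_integrable M (B \<gamma> x) (\<lambda>y. ?d * g y)" using g by auto
    have "t \<le> avg \<gamma> (\<lambda>y. t / 2 + ?d * g y) x"
      unfolding t_def[symmetric]
    proof (subst t_def, rule avg_mono_AE[OF x f(1)])
      show "set_integrable M (B \<gamma> x) (\<lambda>y. t / 2 + ?d * g y)" using x ig by auto
      show "AE y in M. y \<in> B \<gamma> x \<longrightarrow> f y \<le> t / 2 + ?d * g y"
        using le
      proof eventually_elim
        fix y assume y: "y \<in> B \<gamma> x \<longrightarrow> f y powr \<rho> \<le> g y"
        show "y \<in> B \<gamma> x \<longrightarrow> f y \<le> t / 2 + ?d * g y"
        proof
          assume "y \<in> B \<gamma> x"
          then have "?d * f y powr \<rho> \<le> ?d * g y" using y by (intro mult_left_mono) auto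
          then show "f y \<le> t / 2 + ?d * g y"
            using le_add_powr[of "f y" "t / 2" \<rho>] f(2)[of y] tp \<rho> by linarith
        qed
      qed
    qed
    also have "\<dots> = t / 2 + ?d * avg \<gamma> g x"
      using x ig by (subst avg_add) (auto simp: avg_cmult)
    finally have "t / 2 \<le> ?d * avg \<gamma> g x" by simp
    then have "(t / 2) powr (\<rho> - 1) * (t / 2) \<le> (t / 2) powr (\<rho> - 1) * (?d * avg \<gamma> g x)"
      by (intro mult_left_mono) auto
    also have "(t / 2) powr (\<rho> - 1) * (?d * avg \<gamma> g x) = avg \<gamma> g x"
      using tp by (simp add: mult.assoc[symmetric] flip: powr_add)
    also have "(t / 2) powr (\<rho> - 1) * (t / 2) = (t / 2) powr \<rho>"
      using tp by (simp add: powr_mult_base powr_diff)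
    also have "\<dots> = t powr \<rho> / 2 powr \<rho>" using tp by (simp add: powr_divide)
    finally show ?thesis by (simp add: t_def[symmetric] field_simps)
  qed
qed

lemma integrable_imp_loc_int:
  assumes "integrable M f" shows "loc_int f"
  unfolding loc_int_def set_integrable_def
  using assms by (intro conjI allI ballI borel_measurable_integrable integrable_mult_indicator ball_sets)

lemma powr_integrable_imp_loc_int:
  assumes [measurable]: "H \<in> borel_measurable M" and H0: "\<And>x. 0 \<le> H x" and s: "1 \<le> s"
    and fin: "(\<integral>\<^sup>+x. ennreal (H x powr s) \<partial>M) < \<infinity>"
  shows "integrable M (\<lambda>x. H x powr s)" "loc_int H"
proof -
  show i: "integrable M (\<lambda>x. H x powr s)"
    using fin by (intro integrableI_bounded) auto
  show "loc_int H"
  proof (rule loc_int_bound[where g="\<lambda>x. 1 + H x powr s"])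
    show "loc_int (\<lambda>x. 1 + H x powr s)" using i integrable_imp_loc_int loc_int_add by auto
    show "\<bar>H x\<bar> \<le> 1 + H x powr s" for x using le_add_powr[of "H x" 1 s] H0[of x] s by simp
  qed simp
qed

lemma avg_le_integral:
  assumes x: "x \<in> space M" and i: "integrable M G" and G: "\<And>y. 0 \<le> G y"
  shows "avg \<gamma> G x \<le> (\<integral>y. G y \<partial>M) / P powr \<gamma>"
  unfolding avg_def set_lebesgue_integral_def
  using i G x by (intro divide_right_mono integral_mono integrable_mult_indicator) (auto simp: indicator_def ball_sets)

text \<open>For growing scales this is decay, which produces maximal balls; for negative scales it
  limits the growth of the averages, which is needed when exponents are changed.\<close>

lemma avg_powr_le_integral:
  assumes x: "x \<in> space M" and H: "H \<in> borel_measurable M" "\<And>x. 0 \<le> H x" and s: "1 \<le> s"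
    and fin: "(\<integral>\<^sup>+x. ennreal (H x powr s) \<partial>M) \<le> ennreal A" and A: "0 \<le> A"
  shows "avg \<gamma> H x powr s \<le> 2 powr s * A / P powr \<gamma>"
proof -
  have fin': "(\<integral>\<^sup>+x. ennreal (H x powr s) \<partial>M) < \<infinity>" using fin by (rule order.strict_trans1) simp
  note i = powr_integrable_imp_loc_int[OF H s fin']
  have "avg \<gamma> H x powr s \<le> 2 powr s * avg \<gamma> (\<lambda>x. H x powr s) x"
    by (rule weak_jensen[OF x]) (use i s H x loc_intD integrable_imp_loc_int in auto)
  also have "\<dots> \<le> 2 powr s * ((\<integral>y. H y powr s \<partial>M) / P powr \<gamma>)"
    by (intro mult_left_mono avg_le_integral[OF x i(1)]) auto
  also have "\<dots> \<le> 2 powr s * (A / P powr \<gamma>)"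
  proof -
    have "ennreal (\<integral>y. H y powr s \<partial>M) = (\<integral>\<^sup>+x. ennreal (H x powr s) \<partial>M)"
      using i(1) by (intro nn_integral_eq_integral[symmetric]) auto
    then have "(\<integral>y. H y powr s \<partial>M) \<le> A" using fin A by (metis ennreal_le_iff)
    then show ?thesis by (intro mult_left_mono divide_right_mono) auto
  qed
  finally show ?thesis by simp
qed

text \<open>Hence only finitely many scales above a given one carry an average above
  \<open>l\<close>, and there is a largest among them.\<close>

lemma avg_vanishes_at_infinity:
  assumes x: "x \<in> space M" and H: "H \<in> borel_measurable M" "\<And>x. 0 \<le> H x" and s: "1 \<le> s"
    and fin: "(\<integral>\<^sup>+x. ennreal (H x powr s) \<partial>M) < \<infinity>" and l: "0 < l"
  shows "\<exists>\<gamma>0. \<forall>\<gamma>\<ge>\<gamma>0. avg \<gamma> H x \<le> l"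
proof -
  obtain A where A: "0 \<le> A" "(\<integral>\<^sup>+x. ennreal (H x powr s) \<partial>M) = ennreal A"
    using fin by (cases "(\<integral>\<^sup>+x. ennreal (H x powr s) \<partial>M)" rule: ennreal_cases) auto
  let ?c = "2 powr s * A / (l powr s)"
  define \<gamma>0 where "\<gamma>0 = \<lceil>log P (?c + 1)\<rceil>"
  have "avg \<gamma> H x \<le> l" if g: "\<gamma>0 \<le> \<gamma>" for \<gamma>
  proof -
    have c0: "0 < ?c + 1" using A by (auto intro: add_nonneg_pos)
    have "log P (?c + 1) \<le> real_of_int \<gamma>" using g unfolding \<gamma>0_def by linarith
    then have "?c + 1 \<le> P powr \<gamma>" using c0 by (simp add: log_le_iff)
    then have "?c \<le> P powr \<gamma>" by simp
    then have "2 powr s * A \<le> P powr \<gamma> * l powr s" using l by (simp add: pos_divide_le_eq)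
    then have "2 powr s * A / P powr \<gamma> \<le> l powr s" by (simp add: pos_divide_le_eq mult.commute)
    then have "avg \<gamma> H x powr s \<le> l powr s"
      using avg_powr_le_integral[OF x H s _ A(1), of \<gamma>] A(2) by simp
    then show ?thesis using l s by (meson not_less order.asym powr_less_mono2 not_le less_le_trans zero_less_one less_imp_le)
  qed
  then show ?thesis by blast
qed

text \<open>A ball with average of H above 2^k lies in a maximal such ball, on which the supremum of the weights
  integrates to at most K times the measure.\<close>

theorem weighted_maximal:
  fixes \<Psi> :: "int \<Rightarrow> 'a \<Rightarrow> ennreal"
  assumes [measurable]: "\<And>j. \<Psi> j \<in> borel_measurable M"
    and \<Psi>: "\<And>\<gamma> z. z \<in> space M \<Longrightarrow> (\<integral>\<^sup>+y\<in>B \<gamma> z. (SUP j\<in>{..\<gamma>}. \<Psi> j y) \<partial>M) \<le> ennreal K * ennreal (P powr \<gamma>)"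
    and K: "0 \<le> K" and s: "1 < s"
  shows "\<exists>C\<ge>0. \<forall>H. H \<in> borel_measurable M \<longrightarrow> (\<forall>x. 0 \<le> H x) \<longrightarrow> (\<integral>\<^sup>+x. ennreal (H x powr s) \<partial>M) < \<infinity> \<longrightarrow>
    (\<integral>\<^sup>+x. (SUP \<gamma>. \<Psi> \<gamma> x * ennreal (avg \<gamma> H x powr s)) \<partial>M) \<le> ennreal C * (\<integral>\<^sup>+x. ennreal (H x powr s) \<partial>M)"
proof -
  define G where "G = 1 / (1 - 2 powr - (s - 1))"
  have "2 powr - (s - 1) < 1" using s powr_less_mono[of "- (s - 1)" 0 2] by simp
  then have G0: "0 \<le> G" by (simp add: G_def)
  \<comment> \<open>\<open>K\<close> bounds the weights. The factor \<open>2 powr (s + 1)\<close>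
    remains when \<open>(2 powr (k + 1)) powr s\<close> is divided by \<open>2 powr (k - 1)\<close>
    and \<open>2 powr (k * (s - 1))\<close> is split off. The factor \<open>2 powr (s - 1)\<close>
    comes from summing up to the threshold \<open>2 * H x\<close>, and \<open>G\<close> is the
    geometric series.\<close>
  define C where "C = K * 2 powr (s + 1) * 2 powr (s - 1) * G"
  have C0: "0 \<le> C" using K G0 by (simp add: C_def)
  have "(\<integral>\<^sup>+x. (SUP \<gamma>. \<Psi> \<gamma> x * ennreal (avg \<gamma> H x powr s)) \<partial>M) \<le> ennreal C * (\<integral>\<^sup>+x. ennreal (H x powr s) \<partial>M)"
    if H [measurable]: "H \<in> borel_measurable M" and H0: "\<And>x. 0 \<le> H x" and fin: "(\<integral>\<^sup>+x. ennreal (H x powr s) \<partial>M) < \<infinity>" for H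
  proof -
    have s1: "1 \<le> s" using s by simp
    have lH: "loc_int H" by (rule powr_integrable_imp_loc_int(2)[OF H H0 s1 fin])
    \<comment> \<open>The union of the balls of scale \<open>\<gamma>\<close> that are maximal among
      those with average above \<open>2 powr k\<close>. For fixed \<open>k\<close> these sets are
      disjoint in \<open>\<gamma>\<close>.\<close>
    define \<Omega> where "\<Omega> k \<gamma> = {x \<in> space M. 2 powr real_of_int k < avg \<gamma> H x \<and> (\<forall>\<delta>>\<gamma>. avg \<delta> H x \<le> 2 powr real_of_int k)}" for k \<gamma> :: int
    have sat: "saturated \<gamma> (\<Omega> k \<gamma>)" for k \<gamma>
      unfolding \<Omega>_def
    proof (rule saturated_Collect, unfold locally_const_def, intro ballI)
      fix x y assume xy: "x \<in> space M" "y \<in> B \<gamma> x"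
      have "avg \<delta> H y = avg \<delta> H x" if "\<gamma> \<le> \<delta>" for \<delta>
        using avg_eq[OF xy(1)] ball_mono[OF xy(1) that] xy(2) by blast
      then show "(2 powr real_of_int k < avg \<gamma> H y \<and> (\<forall>\<delta>>\<gamma>. avg \<delta> H y \<le> 2 powr real_of_int k)) =
        (2 powr real_of_int k < avg \<gamma> H x \<and> (\<forall>\<delta>>\<gamma>. avg \<delta> H x \<le> 2 powr real_of_int k))" by simp
    qed
    have \<Omega>s [measurable]: "\<Omega> k \<gamma> \<in> sets M" for k \<gamma> using sat saturated_sets by blast
    have top: "\<exists>\<gamma>'\<ge>\<gamma>. x \<in> \<Omega> k \<gamma>'" if x: "x \<in> space M" "2 powr real_of_int k < avg \<gamma> H x" for x k \<gamma>
    proof -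
      obtain \<gamma>0 where \<gamma>0: "\<And>\<delta>. \<gamma>0 \<le> \<delta> \<Longrightarrow> avg \<delta> H x \<le> 2 powr real_of_int k"
        using avg_vanishes_at_infinity[OF x(1) H H0 s1 fin, of "2 powr real_of_int k"] by auto
      define S where "S = {\<delta>\<in>{\<gamma>..\<gamma>0}. 2 powr real_of_int k < avg \<delta> H x}"
      have fS: "finite S" by (rule finite_subset[of _ "{\<gamma>..\<gamma>0}"]) (auto simp: S_def)
      have gS: "\<gamma> \<in> S" using x(2) \<gamma>0[of \<gamma>] by (cases "\<gamma>0 \<le> \<gamma>") (auto simp: S_def)
      have m: "Max S \<in> S" using fS gS by (intro Max_in) auto
      have "avg \<delta> H x \<le> 2 powr real_of_int k" if "Max S < \<delta>" for \<delta>
      proof (rule ccontr)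
        assume "\<not> ?thesis"
        moreover from this have "\<delta> < \<gamma>0" using \<gamma>0[of \<delta>] by linarith
        ultimately have "\<delta> \<in> S" using that m by (auto simp: S_def)
        then show False using fS that Max_ge by fastforce
      qed
      then have "x \<in> \<Omega> k (Max S)" using m x by (auto simp: \<Omega>_def S_def)
      moreover have "\<gamma> \<le> Max S" using m by (simp add: S_def)
      ultimately show ?thesis by blast
    qed
    have one: "(\<integral>\<^sup>+\<gamma>. indicator (\<Omega> k \<gamma>) x \<partial>count_space UNIV) \<le> (1::ennreal)" for k x
    proof (cases "\<exists>\<gamma>. x \<in> \<Omega> k \<gamma>")
      case True
      then obtain \<gamma> where g: "x \<in> \<Omega> k \<gamma>" by blast
      have "x \<in> \<Omega> k \<gamma>' \<longleftrightarrow> \<gamma>' = \<gamma>" for \<gamma>'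
        using g unfolding \<Omega>_def by (cases \<gamma> \<gamma>' rule: linorder_cases) force+
      then have "(\<integral>\<^sup>+\<gamma>'. indicator (\<Omega> k \<gamma>') x \<partial>count_space UNIV) = (\<integral>\<^sup>+\<gamma>'. indicator {\<gamma>} \<gamma>' \<partial>count_space UNIV :: ennreal)"
        by (intro nn_integral_cong) (simp add: indicator_def)
      then show ?thesis by simp
    qed simp
    \<comment> \<open>A ball of scale j lies in a maximal ball of some scale at least j, so its
      weight is dominated by the supremum of the weights up to the scale of the maximal
      ball.\<close>
    define \<Phi> where "\<Phi> \<gamma> x = (SUP j\<in>{..\<gamma>}. \<Psi> j x)" for \<gamma> x
    have [measurable]: "\<Phi> \<gamma> \<in> borel_measurable M" for \<gamma> unfolding \<Phi>_def by measurable
    define c where "c k = ennreal (2 powr ((real_of_int k + 1) * s))" for k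
    have pw: "(SUP \<gamma>. \<Psi> \<gamma> x * ennreal (avg \<gamma> H x powr s)) \<le>
        (\<integral>\<^sup>+i. c (fst i) * (\<Phi> (snd i) x * indicator (\<Omega> (fst i) (snd i)) x) \<partial>count_space UNIV)"
      if x: "x \<in> space M" for x
    proof (rule SUP_least)
      fix \<gamma>
      show "\<Psi> \<gamma> x * ennreal (avg \<gamma> H x powr s) \<le> (\<integral>\<^sup>+i. c (fst i) * (\<Phi> (snd i) x * indicator (\<Omega> (fst i) (snd i)) x) \<partial>count_space UNIV)"
      proof (cases "avg \<gamma> H x = 0")
        case False
        then have a0: "0 < avg \<gamma> H x" using avg_nonneg[of \<gamma> x H] H0 by (simp add: order_less_le)
        \<comment> \<open>Chosen such that the average lies in the dyadic interval from
          \<open>2 powr k\<close>, excluded, to \<open>2 powr (k + 1)\<close>, included.\<close>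
        define k where "k = \<lceil>log 2 (avg \<gamma> H x)\<rceil> - 1"
        have "real_of_int k < log 2 (avg \<gamma> H x)" unfolding k_def by linarith
        then have k1: "2 powr real_of_int k < avg \<gamma> H x" using a0 by (simp add: less_log_iff)
        have "log 2 (avg \<gamma> H x) \<le> real_of_int k + 1" unfolding k_def by linarith
        then have k2: "avg \<gamma> H x \<le> 2 powr (real_of_int k + 1)" using a0 by (simp add: log_le_iff)
        obtain \<gamma>' where g: "\<gamma> \<le> \<gamma>'" "x \<in> \<Omega> k \<gamma>'" using top[OF x k1] by blast
        have "\<Psi> \<gamma> x * ennreal (avg \<gamma> H x powr s) \<le> \<Phi> \<gamma>' x * c k"
        proof (rule mult_mono)
          show "\<Psi> \<gamma> x \<le> \<Phi> \<gamma>' x" unfolding \<Phi>_def using g by (intro SUP_upper) auto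
          have "avg \<gamma> H x powr s \<le> (2 powr (real_of_int k + 1)) powr s" using k2 a0 s by (intro powr_mono2) auto
          then show "ennreal (avg \<gamma> H x powr s) \<le> c k" unfolding c_def by (intro ennreal_leI) (simp add: powr_powr)
        qed auto
        also have "\<dots> = c (fst (k, \<gamma>')) * (\<Phi> (snd (k, \<gamma>')) x * indicator (\<Omega> (fst (k, \<gamma>')) (snd (k, \<gamma>'))) x)"
          using g by (simp add: mult.commute)
        also have "\<dots> \<le> (\<integral>\<^sup>+i. c (fst i) * (\<Phi> (snd i) x * indicator (\<Omega> (fst i) (snd i)) x) \<partial>count_space UNIV)"
          by (rule nn_integral_ge_point) simp
        finally show ?thesis .
      qed simp
    qed
    \<comment> \<open>The part of \<open>H\<close> up to \<open>2 powr (k - 1)\<close> contributes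
      at most half of the threshold to an average, so the truncated function still has mean at least
      \<open>2 powr (k - 1)\<close>. As in Marcinkiewicz interpolation, the truncation makes the sum
      over \<open>k\<close> converge.\<close>
    let ?h = "\<lambda>k x. ennreal (H x) * indicator {x. 2 powr (real_of_int k - 1) < H x} x"
    have weak: "ennreal (2 powr (real_of_int k - 1)) * emeasure M (\<Omega> k \<gamma>) \<le> (\<integral>\<^sup>+x\<in>\<Omega> k \<gamma>. ?h k x \<partial>M)" for k \<gamma>
    proof -
      let ?l = "2 powr (real_of_int k - 1)"
      have l2: "2 powr real_of_int k = ?l + ?l" by (simp add: powr_diff)
      have "(\<integral>\<^sup>+x\<in>\<Omega> k \<gamma>. ennreal ?l \<partial>M) \<le> (\<integral>\<^sup>+x\<in>\<Omega> k \<gamma>. ?h k x \<partial>M)"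
      proof (rule nn_integral_saturated_mono[OF sat])
        fix x assume x: "x \<in> \<Omega> k \<gamma>"
        then have xs: "x \<in> space M" by (simp add: \<Omega>_def)
        let ?g = "\<lambda>y. H y * indicator {x. ?l < H x} y"
        have lg: "loc_int ?g" by (rule loc_int_bound[OF lH]) (use H0 in \<open>auto simp: indicator_def\<close>)
        have "avg \<gamma> H x \<le> avg \<gamma> (\<lambda>y. ?l + ?g y) x"
          by (rule avg_mono_AE) (use xs lH lg loc_intD(2) in \<open>auto simp: indicator_def\<close>)
        also have "\<dots> = ?l + avg \<gamma> ?g x" using xs lg loc_intD(2) by (subst avg_add) auto
        finally have "?l \<le> avg \<gamma> ?g x" using x l2 by (simp add: \<Omega>_def)
        then have "ennreal ?l * ennreal (P powr \<gamma>) \<le> ennreal (avg \<gamma> ?g x) * ennreal (P powr \<gamma>)"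
          by (intro mult_right_mono ennreal_leI) auto
        also have "\<dots> = (\<integral>\<^sup>+y\<in>B \<gamma> x. ennreal (?g y) \<partial>M)"
          by (rule nn_integral_avg[symmetric]) (use xs lg loc_intD(2) H0 in \<open>auto simp: indicator_def\<close>)
        also have "\<dots> = (\<integral>\<^sup>+y\<in>B \<gamma> x. ?h k y \<partial>M)"
          by (intro nn_integral_cong) (auto simp: indicator_def)
        finally show "(\<integral>\<^sup>+y\<in>B \<gamma> x. ennreal ?l \<partial>M) \<le> (\<integral>\<^sup>+y\<in>B \<gamma> x. ?h k y \<partial>M)"
          using xs by (simp add: nn_integral_cmult_indicator ball_sets emeasure_ball)
      qed auto
      then show ?thesis by (simp add: nn_integral_cmult_indicator)
    qed
    define d where "d k = ennreal (K * 2 powr (s + 1) * 2 powr (real_of_int k * (s - 1)))" for k :: int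
    have step: "c k * (\<integral>\<^sup>+x\<in>\<Omega> k \<gamma>. \<Phi> \<gamma> x \<partial>M) \<le> d k * (\<integral>\<^sup>+x\<in>\<Omega> k \<gamma>. ?h k x \<partial>M)" for k \<gamma>
    proof -
      have "(\<integral>\<^sup>+x\<in>\<Omega> k \<gamma>. \<Phi> \<gamma> x \<partial>M) \<le> ennreal K * emeasure M (\<Omega> k \<gamma>)"
      proof (rule nn_integral_saturated_le[OF sat])
        fix x assume "x \<in> \<Omega> k \<gamma>"
        then have "x \<in> space M" by (simp add: \<Omega>_def)
        then show "(\<integral>\<^sup>+y\<in>B \<gamma> x. \<Phi> \<gamma> y \<partial>M) \<le> ennreal K * ennreal (P powr \<gamma>)"
          unfolding \<Phi>_def by (rule \<Psi>)
      qed simp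
      then have "c k * (\<integral>\<^sup>+x\<in>\<Omega> k \<gamma>. \<Phi> \<gamma> x \<partial>M) \<le> c k * (ennreal K * emeasure M (\<Omega> k \<gamma>))"
        by (rule mult_left_mono) simp
      also have "\<dots> = d k * (ennreal (2 powr (real_of_int k - 1)) * emeasure M (\<Omega> k \<gamma>))"
      proof -
        have "2 powr ((real_of_int k + 1) * s) * K = K * 2 powr (s + 1) * 2 powr (real_of_int k * (s - 1)) * 2 powr (real_of_int k - 1)"
          by (simp add: mult.assoc algebra_simps flip: powr_add)
        then have "c k * ennreal K = d k * ennreal (2 powr (real_of_int k - 1))"
          unfolding c_def d_def using K by (simp flip: ennreal_mult)
        then show ?thesis by (simp add: mult.assoc[symmetric])
      qed
      also have "\<dots> \<le> d k * (\<integral>\<^sup>+x\<in>\<Omega> k \<gamma>. ?h k x \<partial>M)"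
        by (intro mult_left_mono weak) simp
      finally show ?thesis .
    qed
    have "(\<integral>\<^sup>+x. (SUP \<gamma>. \<Psi> \<gamma> x * ennreal (avg \<gamma> H x powr s)) \<partial>M)
       \<le> (\<integral>\<^sup>+x. (\<integral>\<^sup>+i. c (fst i) * (\<Phi> (snd i) x * indicator (\<Omega> (fst i) (snd i)) x) \<partial>count_space UNIV) \<partial>M)"
      by (intro nn_integral_mono pw)
    also have "\<dots> = (\<integral>\<^sup>+i. (\<integral>\<^sup>+x. c (fst i) * (\<Phi> (snd i) x * indicator (\<Omega> (fst i) (snd i)) x) \<partial>M) \<partial>count_space UNIV)"
      by (rule nn_integral_count_space_nn_integral) auto
    also have "\<dots> = (\<integral>\<^sup>+i. c (fst i) * (\<integral>\<^sup>+x\<in>\<Omega> (fst i) (snd i). \<Phi> (snd i) x \<partial>M) \<partial>count_space UNIV)"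
      by (intro nn_integral_cong nn_integral_cmult) measurable
    also have "\<dots> \<le> (\<integral>\<^sup>+i. d (fst i) * (\<integral>\<^sup>+x\<in>\<Omega> (fst i) (snd i). ?h (fst i) x \<partial>M) \<partial>count_space UNIV)"
      by (intro nn_integral_mono step)
    also have "\<dots> = (\<integral>\<^sup>+i. (\<integral>\<^sup>+x. d (fst i) * (?h (fst i) x * indicator (\<Omega> (fst i) (snd i)) x) \<partial>M) \<partial>count_space UNIV)"
      by (intro nn_integral_cong nn_integral_cmult[symmetric]) measurable
    also have "\<dots> = (\<integral>\<^sup>+x. (\<integral>\<^sup>+i. d (fst i) * (?h (fst i) x * indicator (\<Omega> (fst i) (snd i)) x) \<partial>count_space UNIV) \<partial>M)"
      by (rule nn_integral_count_space_nn_integral[symmetric]) auto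
    \<comment> \<open>For fixed \<open>x\<close> at most one \<open>\<gamma>\<close> contributes to
      each \<open>k\<close>, and only those \<open>k\<close> with \<open>2 powr k < 2 * H x\<close>
      remain: a geometric sum with exponent \<open>s - 1\<close>.\<close>
    also have "\<dots> \<le> (\<integral>\<^sup>+x. ennreal C * ennreal (H x powr s) \<partial>M)"
    proof (rule nn_integral_mono)
      fix x
      have "(\<integral>\<^sup>+i. d (fst i) * (?h (fst i) x * indicator (\<Omega> (fst i) (snd i)) x) \<partial>count_space UNIV)
         = (\<integral>\<^sup>+k. (\<integral>\<^sup>+\<gamma>. d k * (?h k x * indicator (\<Omega> k \<gamma>) x) \<partial>count_space UNIV) \<partial>count_space UNIV)"
        using nn_integral_fst_count_space[of "\<lambda>i. d (fst i) * (?h (fst i) x * indicator (\<Omega> (fst i) (snd i)) x)"] by simp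
      also have "\<dots> \<le> (\<integral>\<^sup>+k. d k * ?h k x \<partial>count_space UNIV)"
      proof (rule nn_integral_mono)
        fix k
        have "(\<integral>\<^sup>+\<gamma>. d k * (?h k x * indicator (\<Omega> k \<gamma>) x) \<partial>count_space UNIV) = d k * ?h k x * (\<integral>\<^sup>+\<gamma>. indicator (\<Omega> k \<gamma>) x \<partial>count_space UNIV)"
          by (subst nn_integral_cmult[symmetric]) (auto simp: mult.assoc)
        also have "\<dots> \<le> d k * ?h k x * 1" by (intro mult_left_mono one) simp
        finally show "(\<integral>\<^sup>+\<gamma>. d k * (?h k x * indicator (\<Omega> k \<gamma>) x) \<partial>count_space UNIV) \<le> d k * ?h k x" by simp
      qed
      also have "\<dots> \<le> ennreal C * ennreal (H x powr s)"
      proof (cases "H x = 0")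
        case False
        then have hx: "0 < H x" using H0[of x] by simp
        have "(\<integral>\<^sup>+k. d k * ?h k x \<partial>count_space UNIV) = (\<integral>\<^sup>+k. ennreal (K * 2 powr (s + 1) * H x) *
            (if 2 powr real_of_int k < 2 * H x then ennreal (2 powr ((s - 1) * real_of_int k)) else 0) \<partial>count_space UNIV)"
        proof (intro nn_integral_cong)
          fix k :: int
          have "2 powr (real_of_int k - 1) < H x \<longleftrightarrow> 2 powr real_of_int k < 2 * H x" by (simp add: powr_diff mult.commute)
          then show "d k * ?h k x = ennreal (K * 2 powr (s + 1) * H x) *
            (if 2 powr real_of_int k < 2 * H x then ennreal (2 powr ((s - 1) * real_of_int k)) else 0)"
            using K hx unfolding d_def by (auto simp: ennreal_mult[symmetric] mult_ac)
        qed
        also have "\<dots> = ennreal (K * 2 powr (s + 1) * H x) *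
            (\<integral>\<^sup>+k. (if 2 powr real_of_int k < 2 * H x then ennreal (2 powr ((s - 1) * real_of_int k)) else 0) \<partial>count_space UNIV)"
          by (rule nn_integral_cmult) simp
        also have "\<dots> \<le> ennreal (K * 2 powr (s + 1) * H x) * ennreal ((2 * H x) powr (s - 1) / (1 - 2 powr - (s - 1)))"
          using s hx by (intro mult_left_mono geometric_sum_below) auto
        also have "\<dots> = ennreal (C * H x powr s)"
        proof -
          have "H x * (2 * H x) powr (s - 1) = 2 powr (s - 1) * H x powr s"
            using hx by (simp add: powr_mult powr_mult_base mult_ac flip: powr_add)
          then have "K * 2 powr (s + 1) * H x * ((2 * H x) powr (s - 1) / (1 - 2 powr - (s - 1))) = C * H x powr s"
            unfolding C_def G_def by (simp add: mult_ac)
          then show ?thesis using K hx G0 unfolding G_def by (subst ennreal_mult[symmetric]) (auto simp: divide_nonneg_nonneg)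
        qed
        also have "\<dots> = ennreal C * ennreal (H x powr s)" using C0 by (simp add: ennreal_mult)
        finally show ?thesis .
      qed simp
      finally show "(\<integral>\<^sup>+i. d (fst i) * (?h (fst i) x * indicator (\<Omega> (fst i) (snd i)) x) \<partial>count_space UNIV) \<le> ennreal C * ennreal (H x powr s)" .
    qed
    also have "\<dots> = ennreal C * (\<integral>\<^sup>+x. ennreal (H x powr s) \<partial>M)" by (rule nn_integral_cmult) simp
    finally show ?thesis .
  qed
  then show ?thesis using C0 by blast
qed

section \<open>An integrable weight that decays away from the origin\<close>

definition level :: "'a \<Rightarrow> nat" where "level x = (LEAST k. x \<in> B (int k) org)"

text \<open>Comparable to |x|^(-2n) outside the unit ball. The ball of level k has measure P^k, so
  the exponent -2 gives integrability. Constancy on unit balls makes the weight compatible with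
  averages over balls of scale at most 0.\<close>

definition decay :: "'a \<Rightarrow> real" where "decay x = P powr (- 2 * real (level x))"

lemma in_level_ball: 
  assumes "x \<in> space M" shows "x \<in> B (int (level x)) org"
proof -
  obtain \<gamma> where "x \<in> B \<gamma> org" using cover assms by blast
  then have "x \<in> B (int (nat \<gamma>)) org" using ball_mono[OF org_space, of \<gamma> "int (nat \<gamma>)"] by auto
  then show ?thesis unfolding level_def by (rule LeastI)
qed

lemma level_locally_const: "locally_const 0 level"
  unfolding locally_const_def
proof (intro ballI)
  fix x y assume xy: "x \<in> space M" "y \<in> B 0 x"
  have "y \<in> B (int k) org \<longleftrightarrow> x \<in> B (int k) org" for k
  proof -
    have "y \<in> B (int k) x" using ball_mono[OF xy(1), of 0 "int k"] xy by auto
    then have "B (int k) y = B (int k) x" using ball_eq xy by blast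
    then show ?thesis
      using ball_eq ball_sym org_space center_in_ball xy ball_in_space by metis
  qed
  then show "level y = level x" by (simp add: level_def)
qed

lemma decay_locally_const: "locally_const 0 decay"
  using level_locally_const by (simp add: locally_const_def decay_def)

lemma decay_measurable [measurable]: "decay \<in> borel_measurable M"
  using decay_locally_const locally_const_measurable by blast

lemma decay_pos [simp]: "0 < decay x" "0 \<le> decay x" "decay x \<le> 1"
  using powr_mono[of "- 2 * real (level x)" 0 P] by (auto simp: decay_def)

text \<open>The sum over the levels is the geometric series of \<open>1 / P\<close>, and
  \<open>2 \<le> P\<close> bounds it by 2.\<close>

lemma decay_integral: "(\<integral>\<^sup>+x. ennreal (decay x) \<partial>M) \<le> 2"
proof -
  have [measurable]: "B \<gamma> org \<in> sets M" for \<gamma> by (simp add: ball_sets org_space)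
  have "(\<integral>\<^sup>+x. ennreal (decay x) \<partial>M) \<le> (\<integral>\<^sup>+x. (\<integral>\<^sup>+k. ennreal (P powr (- 2 * real k)) * indicator (B (int k) org) x \<partial>count_space UNIV) \<partial>M)"
  proof (intro nn_integral_mono)
    fix x assume "x \<in> space M"
    then have "ennreal (decay x) = ennreal (P powr (- 2 * real (level x))) * indicator (B (int (level x)) org) x"
      using in_level_ball by (simp add: decay_def)
    also have "\<dots> \<le> (\<integral>\<^sup>+k. ennreal (P powr (- 2 * real k)) * indicator (B (int k) org) x \<partial>count_space UNIV)"
      by (rule nn_integral_ge_point) simp
    finally show "ennreal (decay x) \<le> (\<integral>\<^sup>+k. ennreal (P powr (- 2 * real k)) * indicator (B (int k) org) x \<partial>count_space UNIV)" .
  qed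
  also have "\<dots> = (\<integral>\<^sup>+k. (\<integral>\<^sup>+x. ennreal (P powr (- 2 * real k)) * indicator (B (int k) org) x \<partial>M) \<partial>count_space UNIV)"
    by (rule nn_integral_count_space_nn_integral) auto
  also have "\<dots> = (\<integral>\<^sup>+k. ennreal (P powr (- 2 * real k)) * ennreal (P powr (int k)) \<partial>count_space UNIV)"
    by (intro nn_integral_cong) (simp add: nn_integral_cmult_indicator emeasure_ball org_space)
  also have "\<dots> = (\<Sum>k. ennreal (P powr (- 2 * real k)) * ennreal (P powr (int k)))"
    by (rule nn_integral_count_space_nat)
  also have "\<dots> = (\<Sum>k. ennreal ((1 / P) ^ k))"
  proof (intro suminf_cong)
    fix k
    have "P powr (- 2 * real k) * P powr (int k) = P powr (- real k)" by (simp flip: powr_add)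
    also have "\<dots> = (1 / P) ^ k" by (simp add: powr_minus_divide powr_realpow power_one_over)
    finally show "ennreal (P powr (- 2 * real k)) * ennreal (P powr (int k)) = ennreal ((1 / P) ^ k)"
      by (simp only: ennreal_mult[symmetric] powr_ge_zero)
  qed
  also have "\<dots> = ennreal (\<Sum>k. (1 / P) ^ k)"
    by (intro suminf_ennreal2 summable_geometric) auto
  also have "(\<Sum>k. (1 / P) ^ k) = 1 / (1 - 1 / P)" by (intro suminf_geometric) simp
  also have "\<dots> \<le> 2" using P_ge_2 by (simp add: field_simps)
  finally show ?thesis by (simp add: ennreal_leI)
qed

text \<open>On each unit ball \<open>decay\<close> is constant and the moments of \<open>b\<close>
  are bounded. The errors from all large balls are later reduced to this single scale.\<close>

lemma decay_moments:
  assumes b: "bmo b D"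
  shows "\<exists>C\<ge>0. (\<integral>\<^sup>+x. ennreal (decay x) * ennreal ((1 + \<bar>b x - avg 0 b x\<bar>) ^ N) \<partial>M) \<le> ennreal C"
proof -
  have [measurable]: "b \<in> borel_measurable M" using b loc_intD by (auto simp: bmo_def)
  obtain C where C: "0 < C" "\<And>\<gamma> z. z \<in> space M \<Longrightarrow> 
    (\<integral>\<^sup>+y\<in>B \<gamma> z. (SUP j\<in>{..\<gamma>}. ennreal ((1 + \<bar>b y - avg j b y\<bar>) ^ N)) \<partial>M) \<le> ennreal C * ennreal (P powr \<gamma>)"
    using bmo_maximal_moments[OF b, of N] by blast
  let ?w = "\<lambda>x. ennreal ((1 + \<bar>b x - avg 0 b x\<bar>) ^ N)"
  have "(\<integral>\<^sup>+x\<in>space M. ennreal (decay x) * ?w x \<partial>M) \<le> (\<integral>\<^sup>+x\<in>space M. ennreal C * ennreal (decay x) \<partial>M)"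
  proof (rule nn_integral_saturated_mono[of 0])
    show "saturated 0 (space M)" using ball_subset_space by (auto simp: saturated_def)
    fix x assume x: "x \<in> space M"
    have [measurable]: "B 0 x \<in> sets M" using x by (simp add: ball_sets)
    have d: "decay y = decay x" if "y \<in> B 0 x" for y using locally_constD[OF decay_locally_const x that] .
    have "(\<integral>\<^sup>+y\<in>B 0 x. ennreal (decay y) * ?w y \<partial>M) = (\<integral>\<^sup>+y. ennreal (decay x) * (?w y * indicator (B 0 x) y) \<partial>M)"
      using d by (intro nn_integral_cong) (auto simp: indicator_def)
    also have "\<dots> = ennreal (decay x) * (\<integral>\<^sup>+y\<in>B 0 x. ?w y \<partial>M)"
      by (intro nn_integral_cmult) auto
    also have "(\<integral>\<^sup>+y\<in>B 0 x. ?w y \<partial>M) \<le> (\<integral>\<^sup>+y\<in>B 0 x. (SUP j\<in>{..0}. ennreal ((1 + \<bar>b y - avg j b y\<bar>) ^ N)) \<partial>M)"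
      by (intro nn_integral_mono mult_right_mono SUP_upper) auto
    also have "\<dots> \<le> ennreal C" using C(2)[OF x, of 0] by simp
    finally have "(\<integral>\<^sup>+y\<in>B 0 x. ennreal (decay y) * ?w y \<partial>M) \<le> ennreal (decay x) * ennreal C"
      by (simp add: mult_left_mono)
    also have "\<dots> = (\<integral>\<^sup>+y. (ennreal C * ennreal (decay x)) * indicator (B 0 x) y \<partial>M)"
      using x by (subst nn_integral_cmult_indicator) (auto simp: emeasure_ball mult.commute)
    also have "\<dots> = (\<integral>\<^sup>+y\<in>B 0 x. ennreal C * ennreal (decay y) \<partial>M)"
      using d by (intro nn_integral_cong) (auto simp: indicator_def)
    finally show "(\<integral>\<^sup>+y\<in>B 0 x. ennreal (decay y) * ?w y \<partial>M) \<le> (\<integral>\<^sup>+y\<in>B 0 x. ennreal C * ennreal (decay y) \<partial>M)" .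
  qed auto
  also have "(\<integral>\<^sup>+x\<in>space M. ennreal C * ennreal (decay x) \<partial>M) = (\<integral>\<^sup>+x. ennreal C * ennreal (decay x) \<partial>M)"
    by (intro nn_integral_cong) simp
  also have "\<dots> = ennreal C * (\<integral>\<^sup>+x. ennreal (decay x) \<partial>M)" by (rule nn_integral_cmult) simp
  also have "\<dots> \<le> ennreal C * 2" by (intro mult_left_mono decay_integral) simp
  also have "\<dots> = ennreal (C * 2)" using C by (simp add: ennreal_mult)
  also have "(\<integral>\<^sup>+x\<in>space M. ennreal (decay x) * ?w x \<partial>M) = (\<integral>\<^sup>+x. ennreal (decay x) * ?w x \<partial>M)"
    by (intro nn_integral_cong) simp
  finally show ?thesis using C by (intro exI[of _ "C * 2"]) auto
qed

end

section \<open>Averages and variable exponents\<close>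

lemma powr_add_le:
  fixes a c s :: real
  assumes "0 \<le> a" "0 \<le> c" "0 \<le> s"
  shows "(a + c) powr s \<le> 2 powr s * (a powr s + c powr s)"
proof -
  have "(a + c) powr s \<le> (2 * max a c) powr s" using assms by (intro powr_mono2) auto
  also have "\<dots> = 2 powr s * max a c powr s" using assms by (subst powr_mult) auto
  also have "\<dots> \<le> 2 powr s * (a powr s + c powr s)" by (intro mult_left_mono) (auto simp: max_def)
  finally show ?thesis .
qed

text \<open>Hedberg's argument for one ball, with \<open>v\<close> its measure and \<open>t\<close>
  an average. The relation of the exponents gives
  \<open>\<kappa> / \<rho> = 1 + \<kappa> * \<beta>\<close>: one factor \<open>X\<close> is kept,
  and the remaining power of \<open>X\<close> is bounded by \<open>m / v\<close>, which cancels the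
  power of \<open>v\<close>.\<close>

lemma fractional_powr_le:
  fixes t v \<rho> \<kappa> \<beta> X m :: real
  assumes t: "0 \<le> t" "t powr \<rho> \<le> X" and v: "0 < v" and \<rho>: "0 < \<rho>" and \<beta>: "0 \<le> \<beta>" and \<kappa>: "0 < \<kappa>"
    and eq: "1 / \<kappa> = 1 / \<rho> - \<beta>" and X: "X \<le> m / v" "0 \<le> m"
  shows "(v powr \<beta> * t) powr \<kappa> \<le> m powr (\<kappa> * \<beta>) * X"
proof -
  have X0: "0 \<le> X" using t by (meson order_trans powr_ge_zero)
  have k: "\<kappa> / \<rho> = 1 + \<kappa> * \<beta>"
  proof -
    have "1 / \<rho> = 1 / \<kappa> + \<beta>" using eq by simp
    then have "\<kappa> * (1 / \<rho>) = \<kappa> * (1 / \<kappa> + \<beta>)" by simp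
    then show ?thesis using \<kappa> by (simp add: distrib_left)
  qed
  have "t powr \<kappa> = (t powr \<rho>) powr (\<kappa> / \<rho>)" using \<rho> by (simp add: powr_powr)
  also have "\<dots> \<le> X powr (\<kappa> / \<rho>)" using t \<rho> \<kappa> by (intro powr_mono2) auto
  also have "\<dots> = X * X powr (\<kappa> * \<beta>)" unfolding k using X0 by (cases "X = 0") (auto simp: powr_add)
  also have "\<dots> \<le> X * (m / v) powr (\<kappa> * \<beta>)" using X X0 \<beta> \<kappa> by (intro mult_left_mono powr_mono2) auto
  finally have "t powr \<kappa> \<le> X * (m / v) powr (\<kappa> * \<beta>)" .
  then have "v powr (\<kappa> * \<beta>) * t powr \<kappa> \<le> v powr (\<kappa> * \<beta>) * (X * (m / v) powr (\<kappa> * \<beta>))"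
    by (intro mult_left_mono) auto
  also have "\<dots> = m powr (\<kappa> * \<beta>) * X" using v X by (simp add: powr_divide)
  also have "v powr (\<kappa> * \<beta>) * t powr \<kappa> = (v powr \<beta> * t) powr \<kappa>"
    using v t by (simp add: powr_mult powr_powr mult.commute)
  finally show ?thesis .
qed

context ball_space begin

lemma loc_int_bound_AE:
  assumes "loc_int g" "f \<in> borel_measurable M" "AE x in M. \<bar>f x\<bar> \<le> g x"
  shows "loc_int f"
  unfolding loc_int_def
proof (intro conjI allI ballI)
  fix \<gamma> x assume x: "x \<in> space M"
  show "set_integrable M (B \<gamma> x) f"
    by (rule set_integrable_bound[OF loc_intD(2)[OF assms(1) x, of \<gamma>]])
       (use assms x in \<open>auto simp: set_borel_measurable_def ball_sets intro: order_trans[OF _ abs_ge_self]\<close>)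
qed (use assms in auto)

text \<open>Either l is at least decay x, and changing the exponent costs at most a power of decay x that the
  logarithmic condition at infinity keeps bounded, or l^a is itself below the integrable error decay x.\<close>

lemma exchange_exponent:
  assumes l: "0 \<le> l" "l \<le> 1" and ab: "\<bar>a - c\<bar> * real (level x) \<le> C" and d: "\<delta> \<le> a - 1"
  shows "l powr a \<le> P powr (2 * C) * l powr c + decay x * l powr \<delta>"
proof (cases "l = 0")
  case False
  then have l0: "0 < l" using l by simp
  show ?thesis
  proof (cases "decay x \<le> l")
    case True
    have "l powr (a - c) \<le> decay x powr (- \<bar>a - c\<bar>)"
    proof (cases "c \<le> a")
      case True
      have "l powr (a - c) \<le> 1" using True l l0 by (intro powr_le1) auto
      also have "1 \<le> decay x powr (- \<bar>a - c\<bar>)"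
        using powr_mono'[of "- \<bar>a - c\<bar>" 0 "decay x"] decay_pos[of x] by simp
      finally show ?thesis .
    next
      case c: False
      then have "l powr (a - c) \<le> decay x powr (a - c)" using True by (intro powr_mono2') auto
      then show ?thesis using c by simp
    qed
    also have "\<dots> = P powr (2 * (\<bar>a - c\<bar> * real (level x)))" by (simp add: decay_def powr_powr mult_ac)
    also have "\<dots> \<le> P powr (2 * C)" using ab by (intro powr_mono) auto
    finally have "l powr (a - c) * l powr c \<le> P powr (2 * C) * l powr c" by (intro mult_right_mono) auto
    then have "l powr a \<le> P powr (2 * C) * l powr c" using l0 by (simp flip: powr_add)
    then show ?thesis by (simp add: add_increasing2)
  next
    case False
    \<comment> \<open>Only one factor \<open>l\<close> is spent on \<open>decay x\<close>. The
      remaining power is kept since it carries the smallness on large balls that later beats the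
      growth of the weights.\<close>
    have "l powr a = l * l powr (a - 1)" using l0 by (simp add: powr_mult_base)
    also have "\<dots> \<le> decay x * l powr \<delta>"
      using False l l0 d by (intro mult_mono powr_mono') auto
    finally show ?thesis by (simp add: add_increasing)
  qed
qed (auto)

text \<open>Division by \<open>L\<close> reduces to values in the unit interval; undoing it costs at
  most \<open>L powr h\<close>.\<close>

lemma exchange_exponent_bounded:
  assumes l: "0 \<le> l" "l \<le> L" "1 \<le> L" and ab: "\<bar>a - c\<bar> * real (level x) \<le> C" and d: "0 \<le> \<delta>" "\<delta> \<le> a - 1"
    and c: "0 \<le> c" and h: "a \<le> h"
  shows "l powr a \<le> L powr h * (P powr (2 * C) * l powr c + decay x * l powr \<delta>)"
proof -
  have le: "l / L \<le> l" using l by (simp add: divide_le_eq mult_le_cancel_left1)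
  have "l powr a = L powr a * (l / L) powr a" using l by (simp add: powr_divide)
  also have "\<dots> \<le> L powr h * (P powr (2 * C) * (l / L) powr c + decay x * (l / L) powr \<delta>)"
    by (intro mult_mono exchange_exponent[OF _ _ ab d(2)] powr_mono) (use l h in auto)
  also have "\<dots> \<le> L powr h * (P powr (2 * C) * l powr c + decay x * l powr \<delta>)"
    by (intro mult_left_mono add_mono powr_mono2) (use l le d c in auto)
  finally show ?thesis .
qed

text \<open>The real ri is the limit of r at infinity, and u plays the role of the essential infimum of r over the
  ball; |r x - ri| * level x is bounded because the norm of x is about p^{level x}.\<close>

definition log_exponent :: "('a \<Rightarrow> real) \<Rightarrow> real \<Rightarrow> real \<Rightarrow> real \<Rightarrow> real \<Rightarrow> bool" where
  "log_exponent r lo hi ri C \<longleftrightarrow> r \<in> borel_measurable M \<and> lo \<le> ri \<and> ri \<le> hi \<and> 0 \<le> C \<and>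
     (AE x in M. lo \<le> r x \<and> r x \<le> hi \<and> \<bar>r x - ri\<bar> * real (level x) \<le> C) \<and>
     (\<forall>\<gamma><0. \<forall>z\<in>space M. \<exists>u. lo \<le> u \<and> u \<le> hi \<and>
        (AE y in M. y \<in> B \<gamma> z \<longrightarrow> u \<le> r y \<and> - real_of_int \<gamma> * (r y - u) \<le> C))"

lemma log_exponentD:
  assumes "log_exponent r lo hi ri C"
  shows "r \<in> borel_measurable M" "lo \<le> ri" "ri \<le> hi" "0 \<le> C"
    "AE x in M. lo \<le> r x \<and> r x \<le> hi \<and> \<bar>r x - ri\<bar> * real (level x) \<le> C"
    "\<And>\<gamma> z. \<gamma> < 0 \<Longrightarrow> z \<in> space M \<Longrightarrow> \<exists>u. lo \<le> u \<and> u \<le> hi \<and>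
        (AE y in M. y \<in> B \<gamma> z \<longrightarrow> u \<le> r y \<and> - real_of_int \<gamma> * (r y - u) \<le> C)"
  using assms unfolding log_exponent_def by auto

text \<open>Hoelder's inequality replaces g by the s-th power of g, whose natural exponent is r /
  s.\<close>

lemma log_exponent_divide:
  assumes r: "log_exponent r lo hi ri C" and s: "0 < s"
  shows "log_exponent (\<lambda>x. r x / s) (lo / s) (hi / s) (ri / s) (C / s)"
  unfolding log_exponent_def
proof (intro conjI allI impI ballI)
  show "(\<lambda>x. r x / s) \<in> borel_measurable M" using log_exponentD(1)[OF r] by simp
  show "lo / s \<le> ri / s" "ri / s \<le> hi / s" "0 \<le> C / s"
    using log_exponentD[OF r] s by (auto intro: divide_right_mono)
  have d: "\<bar>a / s - c / s\<bar> = \<bar>a - c\<bar> / s" for a c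
    using s by (simp flip: diff_divide_distrib)
  show "AE x in M. lo / s \<le> r x / s \<and> r x / s \<le> hi / s \<and> \<bar>r x / s - ri / s\<bar> * real (level x) \<le> C / s"
    using log_exponentD(5)[OF r] s unfolding d by (auto simp: divide_right_mono)
  fix \<gamma> :: int and z assume g: "\<gamma> < 0" "z \<in> space M"
  obtain u where u: "lo \<le> u" "u \<le> hi" "AE y in M. y \<in> B \<gamma> z \<longrightarrow> u \<le> r y \<and> - real_of_int \<gamma> * (r y - u) \<le> C"
    using log_exponentD(6)[OF r g] by blast
  have e: "- real_of_int \<gamma> * (r y / s - u / s) = (- real_of_int \<gamma> * (r y - u)) / s" for y
    by (simp flip: diff_divide_distrib)
  have "AE y in M. y \<in> B \<gamma> z \<longrightarrow> u / s \<le> r y / s \<and> - real_of_int \<gamma> * (r y / s - u / s) \<le> C / s"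
    using u(3) by eventually_elim (unfold e, use s divide_right_mono[of _ _ s] in force)
  then show "\<exists>u. lo / s \<le> u \<and> u \<le> hi / s \<and> (AE y in M. y \<in> B \<gamma> z \<longrightarrow> u \<le> r y / s \<and> - real_of_int \<gamma> * (r y / s - u) \<le> C / s)"
    using u s by (intro exI[of _ "u / s"]) (auto intro: divide_right_mono)
qed

text \<open>The single function H of the overview. Its first summand turns the modular of
  \<open>f\<close> into an integral of an s-th power; the second one makes the errors of size
  \<open>decay\<close> part of the same bound.\<close>

definition maj :: "('a \<Rightarrow> real) \<Rightarrow> real \<Rightarrow> ('a \<Rightarrow> real) \<Rightarrow> 'a \<Rightarrow> real" where
  "maj r s f y = f y powr (r y / s) + decay y powr (1 / s)"

lemma maj_measurable [measurable]:
  assumes [measurable]: "r \<in> borel_measurable M" "f \<in> borel_measurable M"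
  shows "maj r s f \<in> borel_measurable M"
  unfolding maj_def by measurable

lemma maj_nonneg [simp]: "0 \<le> maj r s f y"
  by (simp add: maj_def)

lemma maj_integral:
  assumes [measurable]: "r \<in> borel_measurable M" "f \<in> borel_measurable M" and f: "\<And>x. 0 \<le> f x"
    and s: "1 \<le> s" and fin: "(\<integral>\<^sup>+x. ennreal (f x powr r x) \<partial>M) \<le> 1"
  shows "(\<integral>\<^sup>+x. ennreal (maj r s f x powr s) \<partial>M) \<le> ennreal (2 powr s * 3)"
proof -
  have "(\<integral>\<^sup>+x. ennreal (maj r s f x powr s) \<partial>M) \<le> (\<integral>\<^sup>+x. ennreal (2 powr s) * (ennreal (f x powr r x) + ennreal (decay x)) \<partial>M)"
  proof (intro nn_integral_mono)
    fix x
    have "maj r s f x powr s \<le> 2 powr s * ((f x powr (r x / s)) powr s + (decay x powr (1 / s)) powr s)"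
      unfolding maj_def using s by (intro powr_add_le) auto
    also have "\<dots> = 2 powr s * (f x powr r x + decay x)" using s by (simp add: powr_powr)
    finally show "ennreal (maj r s f x powr s) \<le> ennreal (2 powr s) * (ennreal (f x powr r x) + ennreal (decay x))"
      by (simp add: ennreal_leI flip: ennreal_mult ennreal_plus)
  qed
  also have "\<dots> = ennreal (2 powr s) * ((\<integral>\<^sup>+x. ennreal (f x powr r x) \<partial>M) + (\<integral>\<^sup>+x. ennreal (decay x) \<partial>M))"
    by (simp add: nn_integral_cmult nn_integral_add)
  also have "\<dots> \<le> ennreal (2 powr s) * (1 + 2)"
    by (intro mult_left_mono add_mono fin decay_integral) auto
  also have "\<dots> = ennreal (2 powr s * 3)" by (simp add: ennreal_mult)
  finally show ?thesis .
qed

text \<open>The lower bound by \<open>decay\<close> is restricted to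
  \<open>\<gamma> \<le> 0\<close>, the scales at which \<open>decay\<close> is constant on the ball;
  this is why errors on large balls are carried along separately.\<close>

lemma maj_facts:
  assumes r: "r \<in> borel_measurable M" and f: "f \<in> borel_measurable M" "\<And>x. 0 \<le> f x"
    and s: "1 \<le> s" and fin: "(\<integral>\<^sup>+x. ennreal (f x powr r x) \<partial>M) \<le> 1"
  shows "loc_int (maj r s f)"
    "x \<in> space M \<Longrightarrow> avg \<gamma> (maj r s f) x powr s \<le> (2 powr s * (2 powr s * 3)) / P powr \<gamma>"
    "x \<in> space M \<Longrightarrow> \<gamma> \<le> 0 \<Longrightarrow> decay x \<le> avg \<gamma> (maj r s f) x powr s"
    "0 \<le> avg \<gamma> (maj r s f) x"
    "loc_int (\<lambda>y. f y powr (r y / s))"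
    "x \<in> space M \<Longrightarrow> avg \<gamma> (\<lambda>y. f y powr (r y / s)) x \<le> avg \<gamma> (maj r s f) x"
proof -
  note [measurable] = r f(1)
  note mi = maj_integral[OF r f s fin]
  have fi: "(\<integral>\<^sup>+x. ennreal (maj r s f x powr s) \<partial>M) < \<infinity>" using mi by (rule order.strict_trans1) simp
  show l: "loc_int (maj r s f)" by (rule powr_integrable_imp_loc_int(2)[OF _ _ s fi]) auto
  show "0 \<le> avg \<gamma> (maj r s f) x" by (intro avg_nonneg) simp
  show lF: "loc_int (\<lambda>y. f y powr (r y / s))"
    by (rule loc_int_bound[OF l]) (auto simp: maj_def)
  assume x: "x \<in> space M"
  show "avg \<gamma> (maj r s f) x powr s \<le> (2 powr s * (2 powr s * 3)) / P powr \<gamma>"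
    by (rule avg_powr_le_integral[OF x _ _ s mi]) auto
  show "avg \<gamma> (\<lambda>y. f y powr (r y / s)) x \<le> avg \<gamma> (maj r s f) x"
    using x l lF loc_intD(2) by (intro avg_mono_AE) (auto simp: maj_def)
  assume g: "\<gamma> \<le> 0"
  have "decay x powr (1 / s) = avg \<gamma> (\<lambda>_. decay x powr (1 / s)) x" using x by simp
  also have "\<dots> \<le> avg \<gamma> (maj r s f) x"
  proof (rule avg_mono_AE[OF x])
    show "AE y in M. y \<in> B \<gamma> x \<longrightarrow> decay x powr (1 / s) \<le> maj r s f y"
      using locally_constD[OF locally_const_antimono[OF decay_locally_const g] x]
      by (intro AE_I2) (auto simp: maj_def)
  qed (use x l loc_intD(2) in auto)
  finally have "(decay x powr (1 / s)) powr s \<le> avg \<gamma> (maj r s f) x powr s"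
    using s by (intro powr_mono2) auto
  then show "decay x \<le> avg \<gamma> (maj r s f) x powr s" using s by (simp add: powr_powr)
qed

lemma variable_loc_int:
  assumes r: "log_exponent r lo hi ri C" and lo: "1 \<le> lo" and f: "f \<in> borel_measurable M" "\<And>x. 0 \<le> f x"
    and fin: "(\<integral>\<^sup>+x. ennreal (f x powr r x) \<partial>M) \<le> 1"
  shows "loc_int f"
proof (rule loc_int_bound_AE[where g="\<lambda>x. 1 + f x powr r x"])
  note [measurable] = log_exponentD(1)[OF r] f(1)
  have "integrable M (\<lambda>x. f x powr r x)"
    using order.strict_trans1[OF fin] by (intro integrableI_bounded) auto
  then show "loc_int (\<lambda>x. 1 + f x powr r x)" using integrable_imp_loc_int loc_int_add by auto
  show "AE x in M. \<bar>f x\<bar> \<le> 1 + f x powr r x"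
    using log_exponentD(5)[OF r]
    by eventually_elim (use le_add_powr[of "f _" 1] f(2) lo in force)
qed (use f in auto)

text \<open>Where f > 1 the exponent u resp. s is the smaller one, and where f is at most 1 the exponent is exchanged
  for ri; below scale 0 the average is raised to the exponent r x, above to ri.\<close>

theorem average_powr_le:
  assumes r: "log_exponent r lo hi ri C" and s: "1 \<le> s" "s \<le> lo"
  shows "\<exists>K\<ge>1. \<forall>f. f \<in> borel_measurable M \<longrightarrow> (\<forall>x. 0 \<le> f x) \<longrightarrow> (\<integral>\<^sup>+x. ennreal (f x powr r x) \<partial>M) \<le> 1 \<longrightarrow>
    (AE x in M. \<forall>\<gamma><0. avg \<gamma> f x powr r x \<le> K * avg \<gamma> (maj r s f) x powr s) \<and>
    (\<forall>\<gamma>\<ge>0. \<forall>x\<in>space M. avg \<gamma> f x powr ri \<le> K * avg \<gamma> (maj r s f) x powr s)"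
proof -
  note R = log_exponentD[OF r]
  have [measurable]: "r \<in> borel_measurable M" by (rule R)
  \<comment> \<open>\<open>2 powr s * 3\<close> bounds the integral of
    \<open>maj r s f powr s\<close>, and the other \<open>2 powr s\<close> is the loss in
    \<open>weak_jensen\<close>.\<close>
  define m where "m = 2 powr s * (2 powr s * 3)"
  have "1 \<le> 2 powr s" using s by (intro ge_one_powr_ge_zero) auto
  then have m1: "1 \<le> m" unfolding m_def using mult_mono[of 1 "2 powr s" 1 "2 powr s * 3"] by simp
  define Q where "Q = P powr (2 * C)"
  have Q1: "1 \<le> Q" unfolding Q_def using R(4) by (intro ge_one_powr_ge_zero) auto
  define K1 where "K1 = 2 powr hi * ((2 powr hi * m) powr hi * P powr C)"
  define K2 where "K2 = 2 powr hi * (2 * Q) powr s"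
  define K3 where "K3 = m powr hi"
  define K where "K = 2 powr hi * (K1 + (Q * K2 + 1) + K3 + K2)"
  have hi1: "1 \<le> hi" using R s by linarith
  have h1: "1 \<le> 2 powr hi" using hi1 by (intro ge_one_powr_ge_zero) auto
  have K0: "0 \<le> K1" "0 \<le> K2" "0 \<le> K3" by (auto simp: K1_def K2_def K3_def)
  have K1: "1 \<le> K" unfolding K_def using mult_mono[OF h1, of 1 "K1 + (Q * K2 + 1) + K3 + K2"] K0 Q1 by simp
  have "(AE x in M. \<forall>\<gamma><0. avg \<gamma> f x powr r x \<le> K * avg \<gamma> (maj r s f) x powr s) \<and>
    (\<forall>\<gamma>\<ge>0. \<forall>x\<in>space M. avg \<gamma> f x powr ri \<le> K * avg \<gamma> (maj r s f) x powr s)"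
    if f [measurable]: "f \<in> borel_measurable M" and f0: "\<And>x. 0 \<le> f x" and fin: "(\<integral>\<^sup>+x. ennreal (f x powr r x) \<partial>M) \<le> 1" for f
  proof -
    define H where "H = maj r s f"
    define X where "X \<gamma> x = avg \<gamma> H x powr s" for \<gamma> x
    note MF = maj_facts[OF R(1) f f0 s(1) fin, folded H_def]
    have X0: "0 \<le> X \<gamma> x" for \<gamma> x by (simp add: X_def)
    have Xm: "X \<gamma> x \<le> m / P powr \<gamma>" if "x \<in> space M" for \<gamma> x
      using MF(2)[OF that] by (simp add: X_def m_def)
    have lf: "loc_int f" by (rule variable_loc_int[OF r _ f f0 fin]) (use s in linarith)
    define f1 where "f1 y = (if f y \<le> 1 then 0 else f y)" for y
    define f2 where "f2 y = (if f y \<le> 1 then f y else 0)" for y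
    have [measurable]: "f1 \<in> borel_measurable M" "f2 \<in> borel_measurable M"
      unfolding f1_def f2_def by measurable
    have f10: "0 \<le> f1 y" and f20: "0 \<le> f2 y" "f2 y \<le> 1" for y using f0 by (auto simp: f1_def f2_def)
    have lf1: "loc_int f1" and lf2: "loc_int f2"
      using f0 by (auto intro!: loc_int_bound[OF lf] simp: f1_def f2_def)
    have split: "avg \<gamma> f x = avg \<gamma> f1 x + avg \<gamma> f2 x" if "x \<in> space M" for \<gamma> x
    proof -
      have "(\<lambda>y. f1 y + f2 y) = f" by (auto simp: f1_def f2_def)
      moreover have "avg \<gamma> (\<lambda>y. f1 y + f2 y) x = avg \<gamma> f1 x + avg \<gamma> f2 x"
        using that lf1 lf2 loc_intD(2) by (intro avg_add) auto
      ultimately show ?thesis by (simp only:)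
    qed
    have t10: "0 \<le> avg \<gamma> f1 x" and t20: "0 \<le> avg \<gamma> f2 x" for \<gamma> x using f10 f20 by (auto intro: avg_nonneg)
    have t21: "avg \<gamma> f2 x \<le> 1" if "x \<in> space M" for \<gamma> x
    proof -
      have "avg \<gamma> f2 x \<le> avg \<gamma> (\<lambda>_. 1) x"
        using that lf2 loc_intD(2) f20 by (intro avg_mono_AE) auto
      then show ?thesis using that by simp
    qed
    have t2: "avg \<gamma> f2 x powr ri \<le> K2 * X \<gamma> x" if x: "x \<in> space M" for \<gamma> x
    proof -
      \<comment> \<open>As \<open>f2\<close> is at most 1, the exponent can be exchanged pointwise
        inside the ball. The error \<open>decay y powr (1 / s)\<close> is the second summand of
        \<open>maj\<close>.\<close>
      have pw: "AE y in M. y \<in> B \<gamma> x \<longrightarrow> f2 y powr (ri / s) \<le> 2 * Q * H y"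
        using R(5)
      proof eventually_elim
        fix y assume y: "lo \<le> r y \<and> r y \<le> hi \<and> \<bar>r y - ri\<bar> * real (level y) \<le> C"
        have ineq: "f2 y powr ri \<le> Q * f2 y powr r y + decay y * f2 y powr 0"
          unfolding Q_def by (rule exchange_exponent) (use f20 y R s in \<open>auto simp: abs_minus_commute\<close>)
        have "f2 y powr ri \<le> Q * f2 y powr r y + decay y"
          using order_trans[OF ineq add_left_mono[of "decay y * f2 y powr 0" "decay y"]] by simp
        then have "(f2 y powr ri) powr (1 / s) \<le> (Q * f2 y powr r y + decay y) powr (1 / s)"
          using s by (intro powr_mono2) auto
        also have "\<dots> \<le> 2 powr (1 / s) * ((Q * f2 y powr r y) powr (1 / s) + decay y powr (1 / s))"
          using s Q1 by (intro powr_add_le) auto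
        also have "\<dots> \<le> 2 * (Q * f2 y powr (r y / s) + Q * decay y powr (1 / s))"
        proof (intro mult_mono add_mono)
          show "2 powr (1 / s) \<le> (2::real)" using powr_mono[of "1 / s" 1 2] s by simp
          have "Q powr (1 / s) \<le> Q" using powr_mono[of "1 / s" 1 Q] s Q1 by simp
          then have "Q powr (1 / s) * f2 y powr (r y / s) \<le> Q * f2 y powr (r y / s)" by (intro mult_right_mono) auto
          then show "(Q * f2 y powr r y) powr (1 / s) \<le> Q * f2 y powr (r y / s)"
            using Q1 by (simp add: powr_mult powr_powr)
          show "decay y powr (1 / s) \<le> Q * decay y powr (1 / s)" using Q1 mult_right_mono[of 1 Q] by simp
        qed auto
        also have "\<dots> = 2 * Q * (f2 y powr (r y / s) + decay y powr (1 / s))" by (simp add: algebra_simps)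
        also have "\<dots> \<le> 2 * Q * H y"
          unfolding H_def maj_def using Q1 by (intro mult_left_mono add_right_mono) (auto simp: f2_def)
        finally show "y \<in> B \<gamma> x \<longrightarrow> f2 y powr (ri / s) \<le> 2 * Q * H y" by (simp add: powr_powr)
      qed
      have "avg \<gamma> f2 x powr (ri / s) \<le> 2 powr (ri / s) * avg \<gamma> (\<lambda>y. 2 * Q * H y) x"
        by (rule weak_jensen[OF x _ f20(1) _ _ pw]) (use x lf2 MF(1) R s loc_intD(2) loc_int_cmult in \<open>auto simp: pos_le_divide_eq\<close>)
      also have "\<dots> = 2 powr (ri / s) * (2 * Q) * avg \<gamma> H x" by (simp add: avg_cmult)
      finally have "(avg \<gamma> f2 x powr (ri / s)) powr s \<le> (2 powr (ri / s) * (2 * Q) * avg \<gamma> H x) powr s"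
        using s by (intro powr_mono2) auto
      also have "\<dots> = 2 powr ri * (2 * Q) powr s * X \<gamma> x"
        using s Q1 MF(4)[of \<gamma> x] by (simp add: powr_mult powr_powr X_def)
      also have "\<dots> \<le> 2 powr hi * (2 * Q) powr s * X \<gamma> x"
        using R(3) X0 by (intro mult_right_mono powr_mono) auto
      finally show ?thesis using s by (simp add: powr_powr K2_def)
    qed
    have small: "AE y in M. y \<in> B \<gamma> z \<longrightarrow> avg \<gamma> f y powr r y \<le> K * X \<gamma> y" if g: "\<gamma> < 0" and z: "z \<in> space M" for \<gamma> z
    proof -
      obtain u where u: "lo \<le> u" "u \<le> hi" "AE y in M. y \<in> B \<gamma> z \<longrightarrow> u \<le> r y \<and> - real_of_int \<gamma> * (r y - u) \<le> C"
        using R(6)[OF g z] by blast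
      have u1: "1 \<le> u" "s \<le> u" using u s by linarith+
      let ?t = "avg \<gamma> f1 z"
      have "?t powr (u / s) \<le> 2 powr (u / s) * avg \<gamma> (\<lambda>y. f y powr (r y / s)) z"
      proof (rule weak_jensen[OF z _ f10])
        show "AE y in M. y \<in> B \<gamma> z \<longrightarrow> f1 y powr (u / s) \<le> f y powr (r y / s)"
          using u(3) by eventually_elim (use s in \<open>auto simp: f1_def intro!: powr_mono divide_right_mono\<close>)
        show "1 \<le> u / s" using u1 s by (simp add: pos_le_divide_eq)
      qed (use z lf1 MF(5) loc_intD(2) in auto)
      also have "\<dots> \<le> 2 powr (u / s) * avg \<gamma> H z" by (intro mult_left_mono MF(6) z) simp
      finally have "(?t powr (u / s)) powr s \<le> (2 powr (u / s) * avg \<gamma> H z) powr s"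
        using s by (intro powr_mono2) auto
      then have "?t powr u \<le> 2 powr u * X \<gamma> z"
        using s MF(4)[of \<gamma> z] by (simp add: powr_mult powr_powr X_def)
      also have "\<dots> \<le> 2 powr hi * X \<gamma> z" using u X0 by (intro mult_right_mono powr_mono) auto
      finally have tu: "?t powr u \<le> 2 powr hi * X \<gamma> z" .
      have t1y: "?t powr r y \<le> K1 * X \<gamma> z" if y: "u \<le> r y" "r y \<le> hi" "- real_of_int \<gamma> * (r y - u) \<le> C" for y
      proof (cases "?t = 0")
        case False
        then have tp: "0 < ?t" using t10[of \<gamma> z] by simp
        \<comment> \<open>The exponent \<open>u\<close> has to be raised to \<open>r y\<close>. The
          power \<open>?t powr u\<close> is at most a constant times
          \<open>P powr (- \<gamma>)\<close>, and \<open>P powr (- \<gamma> * ?e)\<close> stays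
          bounded by the local logarithmic condition.\<close>
        let ?e = "(r y - u) / u"
        have e: "0 \<le> ?e" "?e \<le> hi"
          using y u1 hi1 by (auto simp: divide_le_eq mult_le_cancel_left1 intro: order_trans[of _ hi])
        have ge: "- real_of_int \<gamma> * ?e \<le> C"
        proof -
          have "- real_of_int \<gamma> * ?e = (- real_of_int \<gamma> * (r y - u)) / u" by simp
          also have "\<dots> \<le> C / u" using y u1 by (intro divide_right_mono) auto
          also have "\<dots> \<le> C" using u1 R(4) by (simp add: divide_le_eq mult_le_cancel_left1)
          finally show ?thesis .
        qed
        have "?t powr u \<le> 2 powr hi * (m / P powr \<gamma>)"
          using tu order_trans mult_left_mono[OF Xm[OF z, of \<gamma>], of "2 powr hi"] by auto
        then have "(?t powr u) powr ?e \<le> (2 powr hi * m * P powr (- \<gamma>)) powr ?e"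
          using e by (intro powr_mono2) (auto simp: powr_minus_divide)
        also have "\<dots> = (2 powr hi * m) powr ?e * P powr (- \<gamma> * ?e)"
          using m1 by (simp add: powr_mult powr_powr)
        also have "\<dots> \<le> (2 powr hi * m) powr hi * P powr C"
        proof (intro mult_mono powr_mono e ge)
          show "1 \<le> 2 powr hi * m" using mult_mono[OF h1 m1] by simp
          show "real_of_int (- \<gamma>) * ?e \<le> C" using ge by simp
        qed auto
        finally have "(?t powr u) powr ?e \<le> (2 powr hi * m) powr hi * P powr C" .
        then have "?t powr u * (?t powr u) powr ?e \<le> (2 powr hi * X \<gamma> z) * ((2 powr hi * m) powr hi * P powr C)"
          using tu X0 by (intro mult_mono) auto
        moreover have "?t powr u * (?t powr u) powr ?e = ?t powr r y"
          using tp u1 by (simp add: powr_powr flip: powr_add)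
        ultimately show ?thesis by (simp add: K1_def mult_ac)
      qed (use K0 X0 in auto)
      show ?thesis using u(3) R(5)
      proof eventually_elim
        fix y assume a: "y \<in> B \<gamma> z \<longrightarrow> u \<le> r y \<and> - real_of_int \<gamma> * (r y - u) \<le> C"
          and b: "lo \<le> r y \<and> r y \<le> hi \<and> \<bar>r y - ri\<bar> * real (level y) \<le> C"
        show "y \<in> B \<gamma> z \<longrightarrow> avg \<gamma> f y powr r y \<le> K * X \<gamma> y"
        proof
          assume y: "y \<in> B \<gamma> z"
          have ys: "y \<in> space M" using y z ball_in_space by blast
          have Xy: "X \<gamma> y = X \<gamma> z" using avg_eq[OF z y] by (simp add: X_def)
          have A1: "avg \<gamma> f1 y powr r y \<le> K1 * X \<gamma> y"
            unfolding Xy avg_eq[OF z y] using t1y[of y] a b y by blast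
          have "avg \<gamma> f2 y powr r y \<le> Q * avg \<gamma> f2 y powr ri + decay y * avg \<gamma> f2 y powr 0"
            unfolding Q_def by (rule exchange_exponent) (use t20 t21 ys b s in auto)
          \<comment> \<open>At negative scales \<open>decay y\<close> lies below the power of the
            average of \<open>maj\<close>, so no separate error term survives.\<close>
          also have "\<dots> \<le> Q * (K2 * X \<gamma> y) + X \<gamma> y * 1"
            by (intro add_mono mult_mono t2 ys) (use Q1 X0 MF(3)[OF ys, of \<gamma>] g in \<open>auto simp: X_def\<close>)
          finally have A2: "avg \<gamma> f2 y powr r y \<le> (Q * K2 + 1) * X \<gamma> y" by (simp add: algebra_simps)
          have "avg \<gamma> f y powr r y \<le> 2 powr r y * (avg \<gamma> f1 y powr r y + avg \<gamma> f2 y powr r y)"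
            unfolding split[OF ys] using b s by (intro powr_add_le t10 t20) auto
          also have "\<dots> \<le> 2 powr hi * (K1 * X \<gamma> y + (Q * K2 + 1) * X \<gamma> y)"
            using b A1 A2 by (intro mult_mono add_mono powr_mono) auto
          also have "\<dots> \<le> 2 powr hi * ((K1 + (Q * K2 + 1) + K3 + K2) * X \<gamma> y)"
            using K0 X0[of \<gamma> y] by (intro mult_left_mono) (auto simp: algebra_simps)
          finally show "avg \<gamma> f y powr r y \<le> K * X \<gamma> y" by (simp add: K_def mult.assoc)
        qed
      qed
    qed
    \<comment> \<open>Nonzero values of \<open>f1\<close> exceed 1, hence \<open>f1\<close> is below
      its power with exponent \<open>r y / s\<close>. The average of \<open>maj\<close> is bounded
      at these scales, so raising the exponent from \<open>s\<close> to \<open>ri\<close> costs only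
      a constant.\<close>
    have large: "avg \<gamma> f x powr ri \<le> K * X \<gamma> x" if g: "0 \<le> \<gamma>" and x: "x \<in> space M" for \<gamma> x
    proof -
      have "avg \<gamma> f1 x \<le> avg \<gamma> (\<lambda>y. f y powr (r y / s)) x"
      proof (rule avg_mono_AE[OF x])
        show "AE y in M. y \<in> B \<gamma> x \<longrightarrow> f1 y \<le> f y powr (r y / s)"
          using R(5)
        proof eventually_elim
          fix y assume y: "lo \<le> r y \<and> r y \<le> hi \<and> \<bar>r y - ri\<bar> * real (level y) \<le> C"
          have "1 \<le> r y / s" using y s by (simp add: pos_le_divide_eq)
          then show "y \<in> B \<gamma> x \<longrightarrow> f1 y \<le> f y powr (r y / s)"
            using powr_mono[of 1 "r y / s" "f y"] by (auto simp: f1_def)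
        qed
      qed (use x lf1 MF(5) loc_intD(2) in auto)
      also have "\<dots> \<le> avg \<gamma> H x" by (rule MF(6)[OF x])
      finally have t1: "avg \<gamma> f1 x \<le> avg \<gamma> H x" .
      have Xle: "X \<gamma> x \<le> m"
      proof -
        have "1 \<le> P powr \<gamma>" using g by (intro ge_one_powr_ge_zero) auto
        then have "m / P powr \<gamma> \<le> m" using m1 by (simp add: divide_le_eq mult_le_cancel_left1)
        then show ?thesis using Xm[OF x, of \<gamma>] by linarith
      qed
      have "avg \<gamma> f1 x powr ri \<le> avg \<gamma> H x powr ri"
        using t1 t10 R s by (intro powr_mono2) auto
      also have "\<dots> = X \<gamma> x powr (ri / s)" using s by (simp add: X_def powr_powr)
      also have "\<dots> = X \<gamma> x * X \<gamma> x powr (ri / s - 1)"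
        using X0[of \<gamma> x] by (simp add: powr_mult_base)
      also have "\<dots> \<le> X \<gamma> x * m powr (ri / s - 1)"
        using X0 Xle R s by (intro mult_left_mono powr_mono2) (auto simp: pos_le_divide_eq)
      also have "\<dots> \<le> X \<gamma> x * m powr hi"
      proof -
        have "ri / s \<le> ri" using s R by (simp add: divide_le_eq mult_le_cancel_left1)
        then have "ri / s - 1 \<le> hi" using R by linarith
        then show ?thesis using X0 m1 by (intro mult_left_mono powr_mono) auto
      qed
      finally have A1: "avg \<gamma> f1 x powr ri \<le> K3 * X \<gamma> x" by (simp add: K3_def mult.commute)
      have "avg \<gamma> f x powr ri \<le> 2 powr ri * (avg \<gamma> f1 x powr ri + avg \<gamma> f2 x powr ri)"
        unfolding split[OF x] using R s by (intro powr_add_le t10 t20) auto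
      also have "\<dots> \<le> 2 powr hi * (K3 * X \<gamma> x + K2 * X \<gamma> x)"
        using R A1 t2[OF x] by (intro mult_mono add_mono powr_mono) auto
      also have "\<dots> \<le> 2 powr hi * ((K1 + (Q * K2 + 1) + K3 + K2) * X \<gamma> x)"
        using K0 X0[of \<gamma> x] Q1 by (intro mult_left_mono) (auto simp: algebra_simps)
      finally show ?thesis by (simp add: K_def mult.assoc)
    qed
    have "\<forall>\<gamma>\<in>{..<0}. AE y in M. avg \<gamma> f y powr r y \<le> K * X \<gamma> y"
    proof
      fix \<gamma> :: int assume "\<gamma> \<in> {..<0}"
      then show "AE y in M. avg \<gamma> f y powr r y \<le> K * X \<gamma> y"
        by (intro AE_ballwise[of \<gamma>, OF small]) auto
    qed
    then have "AE y in M. \<forall>\<gamma>\<in>{..<0}. avg \<gamma> f y powr r y \<le> K * X \<gamma> y"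
      by (subst AE_ball_countable) auto
    then have "AE y in M. \<forall>\<gamma><0. avg \<gamma> f y powr r y \<le> K * X \<gamma> y"
      by eventually_elim simp
    then show ?thesis using large unfolding X_def H_def by blast
  qed
  then show ?thesis using K1 by blast
qed

end

text \<open>Young's inequality with a natural number in place of the conjugate exponent, because the
  moments of the oscillation are available for natural powers. It follows by comparing
  \<open>w\<close> with \<open>v powr (s - 1)\<close>.\<close>

lemma young_power_le:
  fixes w v s :: real
  assumes w: "1 \<le> w" and v: "0 \<le> v" and s: "1 < s" and N: "s / (s - 1) \<le> real N"
  shows "w * v \<le> w ^ N + v powr s"
proof (cases "w \<le> v powr (s - 1)")
  case True
  then have "0 < v" using w v by (cases "v = 0") auto
  have "w * v \<le> v powr (s - 1) * v" using True v by (intro mult_right_mono) auto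
  also have "\<dots> = v powr s" using \<open>0 < v\<close> by (simp add: powr_diff)
  finally show ?thesis using w by (simp add: add_increasing)
next
  case False
  have "v = (v powr (s - 1)) powr (1 / (s - 1))" using s v by (simp add: powr_powr)
  also have "\<dots> \<le> w powr (1 / (s - 1))" using False s by (intro powr_mono2) auto
  finally have "w * v \<le> w * w powr (1 / (s - 1))" using w by (intro mult_left_mono) auto
  also have "\<dots> = w powr (s / (s - 1))"
  proof -
    have "s / (s - 1) = 1 + 1 / (s - 1)" using s by (simp add: field_simps)
    then show ?thesis using w by (simp add: powr_add)
  qed
  also have "\<dots> \<le> w powr real N" using w N by (intro powr_mono) auto
  also have "\<dots> = w ^ N" using w by (simp add: powr_realpow)
  finally show ?thesis by (simp add: add_increasing2)
qed

section \<open>Fractional averages with variable exponents\<close>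

context ball_space begin

text \<open>On small balls Hedberg's argument runs with \<open>r x\<close> and \<open>q x\<close>,
  on large ones with \<open>ri\<close> and \<open>qi\<close>, after which \<open>qi\<close> is
  exchanged for \<open>q x\<close>. There the fractional average is at most a constant times
  \<open>P powr (- (\<gamma> / qi))\<close>; its power with exponent \<open>lo' - 1\<close>, left
  over by the exchange, is the decaying factor of the error term.\<close>

theorem fractional_average_powr_le:
  assumes r: "log_exponent r lo hi ri C" and q: "log_exponent q lo' hi' qi C'"
    and rq: "AE x in M. 1 / q x = 1 / r x - \<beta>" "1 / qi = 1 / ri - \<beta>" and \<beta>: "0 \<le> \<beta>"
    and s: "1 \<le> s" "s \<le> lo" and lo': "1 \<le> lo'"
  shows "\<exists>K\<ge>1. \<forall>f. f \<in> borel_measurable M \<longrightarrow> (\<forall>x. 0 \<le> f x) \<longrightarrow> (\<integral>\<^sup>+x. ennreal (f x powr r x) \<partial>M) \<le> 1 \<longrightarrow>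
    (AE x in M. \<forall>\<gamma>. ((P powr \<gamma>) powr \<beta> * avg \<gamma> f x) powr q x \<le>
      K * (avg \<gamma> (maj r s f) x powr s + (if 0 \<le> \<gamma> then decay x * P powr (- (real_of_int \<gamma> * ((lo' - 1) / qi))) else 0)))"
proof -
  note R = log_exponentD[OF r] and Q = log_exponentD[OF q]
  obtain K0 where K0: "1 \<le> K0" and key: "\<And>f. f \<in> borel_measurable M \<Longrightarrow> (\<And>x. 0 \<le> f x) \<Longrightarrow> (\<integral>\<^sup>+x. ennreal (f x powr r x) \<partial>M) \<le> 1 \<Longrightarrow>
    (AE x in M. \<forall>\<gamma><0. avg \<gamma> f x powr r x \<le> K0 * avg \<gamma> (maj r s f) x powr s) \<and>
    (\<forall>\<gamma>\<ge>0. \<forall>x\<in>space M. avg \<gamma> f x powr ri \<le> K0 * avg \<gamma> (maj r s f) x powr s)"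
    using average_powr_le[OF r s] by blast
  define m where "m = 2 powr s * (2 powr s * 3)"
  have "1 \<le> 2 powr s" using s by (intro ge_one_powr_ge_zero) auto
  then have m1: "1 \<le> m" unfolding m_def using mult_mono[of 1 "2 powr s" 1 "2 powr s * 3"] by simp
  define M1 where "M1 = K0 * m"
  have M1: "1 \<le> M1" unfolding M1_def using mult_mono[OF K0 m1] K0 by simp
  have hi0: "0 \<le> hi' * \<beta>" using Q lo' \<beta> by simp
  define K2 where "K2 = M1 powr (hi' * \<beta>) * K0"
  have "1 \<le> M1 powr (hi' * \<beta>)" using M1 hi0 by (intro ge_one_powr_ge_zero) auto
  then have K2: "1 \<le> K2" unfolding K2_def using mult_mono[of 1 _ 1 K0] K0 by simp
  define L where "L = K2 * m"
  have L: "1 \<le> L" unfolding L_def using mult_mono[OF K2 m1] K2 by simp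
  define \<delta> where "\<delta> = lo' - 1"
  define K where "K = K2 + L powr hi' * (P powr (2 * C') * K2 + L powr \<delta>)"
  have "0 \<le> L powr hi' * (P powr (2 * C') * K2 + L powr \<delta>)" using K2 by simp
  then have Kge: "1 \<le> K" "K2 \<le> K" using K2 unfolding K_def by linarith+
  have ri1: "1 \<le> ri" and qi1: "1 \<le> qi" using R Q s lo' by linarith+
  have "AE x in M. \<forall>\<gamma>. ((P powr \<gamma>) powr \<beta> * avg \<gamma> f x) powr q x \<le>
      K * (avg \<gamma> (maj r s f) x powr s + (if 0 \<le> \<gamma> then decay x * P powr (- (real_of_int \<gamma> * (\<delta> / qi))) else 0))"
    if f [measurable]: "f \<in> borel_measurable M" and f0: "\<And>x. 0 \<le> f x" and fin: "(\<integral>\<^sup>+x. ennreal (f x powr r x) \<partial>M) \<le> 1" for f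
  proof -
    define X where "X \<gamma> x = avg \<gamma> (maj r s f) x powr s" for \<gamma> x
    note MF = maj_facts[OF R(1) f f0 s(1) fin]
    have X0: "0 \<le> X \<gamma> x" for \<gamma> x by (simp add: X_def)
    have Xm: "K0 * X \<gamma> x \<le> M1 / P powr \<gamma>" if "x \<in> space M" for \<gamma> x
      using mult_left_mono[OF MF(2)[OF that, of \<gamma>], of K0] K0 by (simp add: X_def M1_def m_def)
    have a0: "0 \<le> avg \<gamma> f x" for \<gamma> x using f0 by (intro avg_nonneg) auto
    \<comment> \<open>Stated for arbitrary exponents, since it serves both the pair
      \<open>r x\<close>, \<open>q x\<close> and the pair \<open>ri\<close>,
      \<open>qi\<close>.\<close>
    have frac: "((P powr \<gamma>) powr \<beta> * avg \<gamma> f x) powr \<kappa> \<le> K2 * X \<gamma> x"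
      if x: "x \<in> space M" and le: "avg \<gamma> f x powr \<rho> \<le> K0 * X \<gamma> x" and \<rho>: "1 \<le> \<rho>" and \<kappa>: "1 \<le> \<kappa>" "\<kappa> \<le> hi'" "1 / \<kappa> = 1 / \<rho> - \<beta>"
      for x \<gamma> \<rho> \<kappa>
    proof -
      have "((P powr \<gamma>) powr \<beta> * avg \<gamma> f x) powr \<kappa> \<le> M1 powr (\<kappa> * \<beta>) * (K0 * X \<gamma> x)"
        by (rule fractional_powr_le[OF a0 le]) (use \<rho> \<kappa> \<beta> Xm[OF x] M1 in auto)
      also have "\<dots> \<le> M1 powr (hi' * \<beta>) * (K0 * X \<gamma> x)"
        using \<kappa> \<beta> K0 X0 M1 by (intro mult_right_mono powr_mono) auto
      finally show ?thesis by (simp add: K2_def)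
    qed
    have "AE x in M. x \<in> space M" by simp
    with conjunct1[OF key[OF f f0 fin]] R(5) Q(5) rq(1) show ?thesis
    proof eventually_elim
      fix x assume small: "\<forall>\<gamma><0. avg \<gamma> f x powr r x \<le> K0 * avg \<gamma> (maj r s f) x powr s"
        and rx: "lo \<le> r x \<and> r x \<le> hi \<and> \<bar>r x - ri\<bar> * real (level x) \<le> C"
        and qx: "lo' \<le> q x \<and> q x \<le> hi' \<and> \<bar>q x - qi\<bar> * real (level x) \<le> C'"
        and eq: "1 / q x = 1 / r x - \<beta>" and x: "x \<in> space M"
      show "\<forall>\<gamma>. ((P powr \<gamma>) powr \<beta> * avg \<gamma> f x) powr q x \<le>
          K * (avg \<gamma> (maj r s f) x powr s + (if 0 \<le> \<gamma> then decay x * P powr (- (real_of_int \<gamma> * (\<delta> / qi))) else 0))"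
      proof
        fix \<gamma> :: int
        let ?A = "(P powr \<gamma>) powr \<beta> * avg \<gamma> f x"
        have A0: "0 \<le> ?A" using a0 by simp
        show "?A powr q x \<le> K * (avg \<gamma> (maj r s f) x powr s + (if 0 \<le> \<gamma> then decay x * P powr (- (real_of_int \<gamma> * (\<delta> / qi))) else 0))"
        proof (cases "0 \<le> \<gamma>")
          case False
          have "?A powr q x \<le> K2 * X \<gamma> x"
            by (rule frac[OF x _ _ _ _ eq]) (use small False rx qx s lo' in \<open>auto simp: X_def\<close>)
          also have "\<dots> \<le> K * X \<gamma> x" using X0 Kge by (intro mult_right_mono) auto
          finally show ?thesis using False by (simp add: X_def)
        next
          case True
          have Aq: "?A powr qi \<le> K2 * X \<gamma> x"
            by (rule frac[OF x _ ri1 qi1 Q(3) rq(2)]) (use conjunct2[OF key[OF f f0 fin]] True x in \<open>auto simp: X_def\<close>)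
          also have "\<dots> \<le> K2 * (m / P powr \<gamma>)"
            using MF(2)[OF x, of \<gamma>] K2 by (intro mult_left_mono) (auto simp: X_def m_def)
          also have "\<dots> = L * P powr (- \<gamma>)" by (simp add: L_def powr_minus_divide)
          finally have "?A powr qi \<le> L * P powr (- \<gamma>)" .
          then have "(?A powr qi) powr (1 / qi) \<le> (L * P powr (- \<gamma>)) powr (1 / qi)"
            using qi1 by (intro powr_mono2) auto
          also have "(?A powr qi) powr (1 / qi) = ?A powr (qi * (1 / qi))" by (rule powr_powr)
          also have "qi * (1 / qi) = 1" using qi1 by simp
          also have "?A powr 1 = ?A" using A0 by (rule powr_one)
          also have "(L * P powr (- \<gamma>)) powr (1 / qi) = L powr (1 / qi) * P powr (- (real_of_int \<gamma> / qi))"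
            using L by (simp add: powr_powr powr_mult)
          finally have "?A \<le> L powr (1 / qi) * P powr (- (real_of_int \<gamma> / qi))" .
          also have "\<dots> \<le> L * P powr (- (real_of_int \<gamma> / qi))"
            using L qi1 powr_mono[of "1 / qi" 1 L] by (intro mult_right_mono) (auto simp: divide_le_eq)
          finally have AL: "?A \<le> L * P powr (- (real_of_int \<gamma> / qi))" .
          also have "\<dots> \<le> L * 1"
            using True qi1 L powr_mono[of "- (real_of_int \<gamma> / qi)" 0 P] by (intro mult_left_mono) auto
          finally have AL1: "?A \<le> L" by simp
          have d0: "0 \<le> \<delta>" using lo' by (simp add: \<delta>_def)
          have "?A powr \<delta> \<le> (L * P powr (- (real_of_int \<gamma> / qi))) powr \<delta>"
            using AL A0 d0 by (intro powr_mono2) auto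
          also have "\<dots> = L powr \<delta> * P powr (- (real_of_int \<gamma> * (\<delta> / qi)))"
            using L by (simp add: powr_mult powr_powr mult.commute)
          finally have Ad: "?A powr \<delta> \<le> L powr \<delta> * P powr (- (real_of_int \<gamma> * (\<delta> / qi)))" .
          let ?E = "decay x * P powr (- (real_of_int \<gamma> * (\<delta> / qi)))"
          have E0: "0 \<le> ?E" by simp
          have "?A powr q x \<le> L powr hi' * (P powr (2 * C') * ?A powr qi + decay x * ?A powr \<delta>)"
            by (rule exchange_exponent_bounded[OF A0 AL1 L _ d0]) (use qx qi1 \<delta>_def in auto)
          also have "\<dots> \<le> L powr hi' * (P powr (2 * C') * (K2 * X \<gamma> x) + decay x * (L powr \<delta> * P powr (- (real_of_int \<gamma> * (\<delta> / qi)))))"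
            by (intro mult_left_mono add_mono Aq Ad) auto
          also have "\<dots> = L powr hi' * (P powr (2 * C') * K2) * X \<gamma> x + L powr hi' * L powr \<delta> * ?E"
            by (simp add: algebra_simps)
          also have "\<dots> \<le> K * X \<gamma> x + K * ?E"
            using K2 by (intro add_mono mult_right_mono X0 E0) (auto simp: K_def algebra_simps)
          finally show ?thesis using True by (simp add: X_def algebra_simps)
        qed
      qed
    qed
  qed
  then show ?thesis using Kge unfolding \<delta>_def by blast
qed

text \<open>The case \<open>\<beta> = 0\<close>, \<open>s = 1\<close>. The factor 14 is 12, bounding
  the average of \<open>maj\<close> times the measure of the ball, plus 2 for the integral of
  \<open>decay\<close>.\<close>

corollary average_modular_bounded:
  assumes r: "log_exponent r lo hi ri C" and lo: "1 \<le> lo"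
  shows "\<exists>K\<ge>1. \<forall>f. f \<in> borel_measurable M \<longrightarrow> (\<forall>x. 0 \<le> f x) \<longrightarrow> (\<integral>\<^sup>+x. ennreal (f x powr r x) \<partial>M) \<le> 1 \<longrightarrow>
    (\<forall>\<gamma>. \<forall>z\<in>space M. (\<integral>\<^sup>+x\<in>B \<gamma> z. ennreal (avg \<gamma> f z powr r x) \<partial>M) \<le> ennreal K)"
proof -
  note R = log_exponentD[OF r]
  obtain K where K: "1 \<le> K" and key: "\<And>f. f \<in> borel_measurable M \<Longrightarrow> (\<And>x. 0 \<le> f x) \<Longrightarrow> (\<integral>\<^sup>+x. ennreal (f x powr r x) \<partial>M) \<le> 1 \<Longrightarrow>
    (AE x in M. \<forall>\<gamma>. ((P powr \<gamma>) powr 0 * avg \<gamma> f x) powr r x \<le>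
      K * (avg \<gamma> (maj r 1 f) x powr 1 + (if 0 \<le> \<gamma> then decay x * P powr (- (real_of_int \<gamma> * ((lo - 1) / ri))) else 0)))"
    using fractional_average_powr_le[OF r r, of 0 1] lo by auto
  have "(\<integral>\<^sup>+x\<in>B \<gamma> z. ennreal (avg \<gamma> f z powr r x) \<partial>M) \<le> ennreal (K * 14)"
    if f [measurable]: "f \<in> borel_measurable M" and f0: "\<And>x. 0 \<le> f x" and fin: "(\<integral>\<^sup>+x. ennreal (f x powr r x) \<partial>M) \<le> 1" and z: "z \<in> space M" for f \<gamma> z
  proof -
    have [measurable]: "B \<gamma> z \<in> sets M" using z by (simp add: ball_sets)
    define h where "h = avg \<gamma> (maj r 1 f) z"
    have h: "h \<le> 12 / P powr \<gamma>" "0 \<le> h"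
      using maj_facts(2)[OF R(1) f f0 order_refl fin z, of \<gamma>] maj_facts(4)[OF R(1) f f0 order_refl fin, of \<gamma> z]
      by (auto simp: h_def)
    have "AE x in M. ennreal (avg \<gamma> f z powr r x) * indicator (B \<gamma> z) x \<le> ennreal K * (ennreal h * indicator (B \<gamma> z) x + ennreal (decay x))"
      using key[OF f f0 fin]
    proof eventually_elim
      fix x assume x: "\<forall>\<gamma>. ((P powr \<gamma>) powr 0 * avg \<gamma> f x) powr r x \<le>
        K * (avg \<gamma> (maj r 1 f) x powr 1 + (if 0 \<le> \<gamma> then decay x * P powr (- (real_of_int \<gamma> * ((lo - 1) / ri))) else 0))"
      show "ennreal (avg \<gamma> f z powr r x) * indicator (B \<gamma> z) x \<le> ennreal K * (ennreal h * indicator (B \<gamma> z) x + ennreal (decay x))"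
      proof (cases "x \<in> B \<gamma> z")
        case True
        have "avg \<gamma> f z powr r x \<le> K * (h powr 1 + (if 0 \<le> \<gamma> then decay x * P powr (- (real_of_int \<gamma> * ((lo - 1) / ri))) else 0))"
          using x[rule_format, of \<gamma>] avg_eq[OF z True] by (simp add: h_def)
        also have "\<dots> \<le> K * (h + decay x)"
        proof (intro mult_left_mono add_mono)
          have "P powr (- (real_of_int \<gamma> * ((lo - 1) / ri))) \<le> 1" if "0 \<le> \<gamma>"
            using powr_mono[of "- (real_of_int \<gamma> * ((lo - 1) / ri))" 0 P] that lo R by simp
          then show "(if 0 \<le> \<gamma> then decay x * P powr (- (real_of_int \<gamma> * ((lo - 1) / ri))) else 0) \<le> decay x"
            by (auto intro: mult_left_le)
        qed (use h K in auto)
        finally show ?thesis using True K h by (simp add: ennreal_leI flip: ennreal_mult ennreal_plus)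
      qed simp
    qed
    then have "(\<integral>\<^sup>+x\<in>B \<gamma> z. ennreal (avg \<gamma> f z powr r x) \<partial>M) \<le> (\<integral>\<^sup>+x. ennreal K * (ennreal h * indicator (B \<gamma> z) x + ennreal (decay x)) \<partial>M)"
      by (rule nn_integral_mono_AE)
    also have "\<dots> = ennreal K * (ennreal h * ennreal (P powr \<gamma>) + (\<integral>\<^sup>+x. ennreal (decay x) \<partial>M))"
      using z by (simp add: nn_integral_cmult nn_integral_add nn_integral_cmult_indicator emeasure_ball)
    also have "\<dots> \<le> ennreal K * (ennreal 12 + 2)"
    proof (intro mult_left_mono add_mono decay_integral)
      have "h * P powr \<gamma> \<le> 12" using h by (simp add: pos_le_divide_eq)
      then show "ennreal h * ennreal (P powr \<gamma>) \<le> ennreal 12"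
        using h ennreal_mult[of h "P powr \<gamma>"] by (metis ennreal_leI powr_ge_zero)
    qed auto
    also have "\<dots> = ennreal (K * 14)" using K by (simp add: ennreal_mult)
    finally show ?thesis .
  qed
  then show ?thesis using K by (intro exI[of _ "K * 14"]) auto
qed

section \<open>The commutator on a single ball\<close>

definition comm :: "real \<Rightarrow> ('a \<Rightarrow> real) \<Rightarrow> ('a \<Rightarrow> real) \<Rightarrow> int \<Rightarrow> 'a \<Rightarrow> ennreal" where
  "comm \<beta> b g \<gamma> x = ennreal ((P powr \<gamma>) powr (\<beta> - 1)) * (\<integral>\<^sup>+y\<in>B \<gamma> x. ennreal (\<bar>b x - b y\<bar> * g y) \<partial>M)"

text \<open>Hoelder's inequality in the form of Young's inequality for normalised functions. The
  product (1 + |b(x) - c|)(1 + |b(y) - c|) dominates |b(x) - b(y)|, and it separates the two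
  variables, so the y-factor meets only the moments of \<open>b\<close> on the ball.\<close>

lemma comm_le:
  assumes b: "bmo b D" and s: "1 < s"
  shows "\<exists>C\<ge>1. \<forall>g. g \<in> borel_measurable M \<longrightarrow> (\<forall>x. 0 \<le> g x) \<longrightarrow> loc_int (\<lambda>y. g y powr s) \<longrightarrow>
    (\<forall>x\<in>space M. \<forall>\<gamma>. comm \<beta> b g \<gamma> x \<le>
      ennreal (C * (1 + \<bar>b x - avg \<gamma> b x\<bar>) * ((P powr \<gamma>) powr \<beta> * avg \<gamma> (\<lambda>y. g y powr s) x powr (1 / s))))"
proof -
  have [measurable]: "b \<in> borel_measurable M" using b loc_intD by (auto simp: bmo_def)
  define N where "N = nat \<lceil>s / (s - 1)\<rceil>"
  have N: "s / (s - 1) \<le> real N" unfolding N_def by linarith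
  obtain C where C: "0 < C" "\<And>\<gamma> z. z \<in> space M \<Longrightarrow>
    (\<integral>\<^sup>+y\<in>B \<gamma> z. (SUP j\<in>{..\<gamma>}. ennreal ((1 + \<bar>b y - avg j b y\<bar>) ^ N)) \<partial>M) \<le> ennreal C * ennreal (P powr \<gamma>)"
    using bmo_maximal_moments[OF b, of N] by blast
  have "comm \<beta> b g \<gamma> x \<le>
      ennreal ((C + 1) * (1 + \<bar>b x - avg \<gamma> b x\<bar>) * ((P powr \<gamma>) powr \<beta> * avg \<gamma> (\<lambda>y. g y powr s) x powr (1 / s)))"
    if g [measurable]: "g \<in> borel_measurable M" and g0: "\<And>x. 0 \<le> g x" and lg: "loc_int (\<lambda>y. g y powr s)" and x: "x \<in> space M" for g x \<gamma>
  proof -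
    have [measurable]: "B \<gamma> x \<in> sets M" using x by (simp add: ball_sets)
    define c where "c = avg \<gamma> b x"
    define G where "G = avg \<gamma> (\<lambda>y. g y powr s) x"
    have G0: "0 \<le> G" unfolding G_def by (intro avg_nonneg) simp
    have iG: "(\<integral>\<^sup>+y\<in>B \<gamma> x. ennreal (g y powr s) \<partial>M) = ennreal G * ennreal (P powr \<gamma>)"
      unfolding G_def by (rule nn_integral_avg) (use x lg loc_intD(2) in auto)
    show ?thesis
    proof (cases "G = 0")
      \<comment> \<open>No normalisation is possible here, but \<open>g\<close> vanishes almost
        everywhere on the ball and so does the commutator.\<close>
      case True
      then have "(\<integral>\<^sup>+y\<in>B \<gamma> x. ennreal (g y powr s) \<partial>M) = 0" using iG by simp
      then have "AE y in M. ennreal (g y powr s) * indicator (B \<gamma> x) y = 0"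
        by (subst (asm) nn_integral_0_iff_AE) auto
      then have "AE y in M. ennreal (\<bar>b x - b y\<bar> * g y) * indicator (B \<gamma> x) y = 0"
        by eventually_elim (auto simp: indicator_def split: if_splits)
      then have "(\<integral>\<^sup>+y\<in>B \<gamma> x. ennreal (\<bar>b x - b y\<bar> * g y) \<partial>M) = 0"
        by (subst nn_integral_0_iff_AE) auto
      then show ?thesis by (simp add: comm_def)
    next
      case False
      then have Gp: "0 < G" using G0 by simp
      \<comment> \<open>With this \<open>a\<close> the mean of \<open>(g y / a) powr s\<close> over
        the ball is 1.\<close>
      define a where "a = G powr (1 / s)"
      have a: "0 < a" "a powr s = G" using Gp s by (auto simp: a_def powr_powr)
      let ?W = "\<lambda>y. ennreal ((1 + \<bar>b y - c\<bar>) ^ N)"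
      let ?k = "(1 + \<bar>b x - c\<bar>) * a"
      have k0: "0 \<le> ?k" using a by simp
      have pw: "ennreal (\<bar>b x - b y\<bar> * g y) \<le> ennreal ?k * (?W y + ennreal (1 / G) * ennreal (g y powr s))" for y
      proof -
        have "(1 + \<bar>b y - c\<bar>) * (g y / a) \<le> (1 + \<bar>b y - c\<bar>) ^ N + (g y / a) powr s"
          by (rule young_power_le) (use g0 a s N in auto)
        also have "(g y / a) powr s = 1 / G * g y powr s" using a g0 by (simp add: powr_divide)
        finally have Y: "(1 + \<bar>b y - c\<bar>) * (g y / a) \<le> (1 + \<bar>b y - c\<bar>) ^ N + 1 / G * g y powr s" .
        have "\<bar>b x - b y\<bar> \<le> (1 + \<bar>b x - c\<bar>) * (1 + \<bar>b y - c\<bar>)"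
        proof -
          have "\<bar>b x - b y\<bar> \<le> \<bar>b x - c\<bar> + \<bar>b y - c\<bar>" by linarith
          moreover have "0 \<le> \<bar>b x - c\<bar> * \<bar>b y - c\<bar>" by simp
          moreover have "(1 + \<bar>b x - c\<bar>) * (1 + \<bar>b y - c\<bar>) = 1 + \<bar>b x - c\<bar> + \<bar>b y - c\<bar> + \<bar>b x - c\<bar> * \<bar>b y - c\<bar>"
            by (simp add: algebra_simps)
          ultimately show ?thesis by linarith
        qed
        then have "\<bar>b x - b y\<bar> * g y \<le> (1 + \<bar>b x - c\<bar>) * (1 + \<bar>b y - c\<bar>) * g y"
          using g0 by (intro mult_right_mono) auto
        also have "\<dots> = ?k * ((1 + \<bar>b y - c\<bar>) * (g y / a))" using a by simp
        also have "\<dots> \<le> ?k * ((1 + \<bar>b y - c\<bar>) ^ N + 1 / G * g y powr s)"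
          by (intro mult_left_mono Y k0)
        finally have "ennreal (\<bar>b x - b y\<bar> * g y) \<le> ennreal (?k * ((1 + \<bar>b y - c\<bar>) ^ N + 1 / G * g y powr s))"
          by (rule ennreal_leI)
        also have "\<dots> = ennreal ?k * (?W y + ennreal (1 / G) * ennreal (g y powr s))"
        proof -
          have "ennreal (1 / G) * ennreal (g y powr s) = ennreal (1 / G * g y powr s)"
            using Gp by (intro ennreal_mult[symmetric]) auto
          then show ?thesis using k0 Gp by (simp only: ennreal_mult ennreal_plus zero_le_power add_nonneg_nonneg zero_le_one abs_ge_zero mult_nonneg_nonneg powr_ge_zero zero_le_divide_1_iff less_imp_le)
        qed
        finally show ?thesis .
      qed
      have "(\<integral>\<^sup>+y\<in>B \<gamma> x. ennreal (\<bar>b x - b y\<bar> * g y) \<partial>M) \<le>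
         (\<integral>\<^sup>+y. ennreal ?k * (?W y * indicator (B \<gamma> x) y + ennreal (1 / G) * (ennreal (g y powr s) * indicator (B \<gamma> x) y)) \<partial>M)"
      proof (intro nn_integral_mono)
        fix y show "ennreal (\<bar>b x - b y\<bar> * g y) * indicator (B \<gamma> x) y \<le>
          ennreal ?k * (?W y * indicator (B \<gamma> x) y + ennreal (1 / G) * (ennreal (g y powr s) * indicator (B \<gamma> x) y))"
          using pw[of y] by (cases "y \<in> B \<gamma> x") auto
      qed
      also have "\<dots> = ennreal ?k * ((\<integral>\<^sup>+y\<in>B \<gamma> x. ?W y \<partial>M) + ennreal (1 / G) * (\<integral>\<^sup>+y\<in>B \<gamma> x. ennreal (g y powr s) \<partial>M))"
        by (simp add: nn_integral_cmult nn_integral_add)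
      also have "\<dots> \<le> ennreal ?k * (ennreal C * ennreal (P powr \<gamma>) + ennreal (1 / G) * (ennreal G * ennreal (P powr \<gamma>)))"
        unfolding iG
      proof (intro mult_left_mono add_right_mono)
        have "(\<integral>\<^sup>+y\<in>B \<gamma> x. ?W y \<partial>M) \<le> (\<integral>\<^sup>+y\<in>B \<gamma> x. (SUP j\<in>{..\<gamma>}. ennreal ((1 + \<bar>b y - avg j b y\<bar>) ^ N)) \<partial>M)"
        proof (intro nn_integral_mono)
          fix y show "?W y * indicator (B \<gamma> x) y \<le> (SUP j\<in>{..\<gamma>}. ennreal ((1 + \<bar>b y - avg j b y\<bar>) ^ N)) * indicator (B \<gamma> x) y"
            using avg_eq[OF x, of y \<gamma> b] by (cases "y \<in> B \<gamma> x") (auto simp: c_def intro!: SUP_upper2[of \<gamma>])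
        qed
        also have "\<dots> \<le> ennreal C * ennreal (P powr \<gamma>)" by (rule C(2)[OF x])
        finally show "(\<integral>\<^sup>+y\<in>B \<gamma> x. ?W y \<partial>M) \<le> ennreal C * ennreal (P powr \<gamma>)" .
      qed auto
      also have "\<dots> = ennreal (?k * ((C + 1) * P powr \<gamma>))"
      proof -
        have "ennreal (1 / G) * (ennreal G * ennreal (P powr \<gamma>)) = ennreal (P powr \<gamma>)"
          using Gp by (simp add: mult.assoc[symmetric] flip: ennreal_mult)
        moreover have "ennreal C * ennreal (P powr \<gamma>) + ennreal (P powr \<gamma>) = ennreal ((C + 1) * P powr \<gamma>)"
          using C by (simp add: distrib_right ennreal_mult)
        ultimately show ?thesis using ennreal_mult'[OF k0] by simp
      qed
      finally have "comm \<beta> b g \<gamma> x \<le> ennreal ((P powr \<gamma>) powr (\<beta> - 1)) * ennreal (?k * ((C + 1) * P powr \<gamma>))"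
        unfolding comm_def by (intro mult_left_mono) auto
      also have "\<dots> = ennreal ((P powr \<gamma>) powr (\<beta> - 1) * (?k * ((C + 1) * P powr \<gamma>)))"
        by (rule ennreal_mult'[symmetric]) simp
      also have "(P powr \<gamma>) powr (\<beta> - 1) * (?k * ((C + 1) * P powr \<gamma>)) = (C + 1) * (1 + \<bar>b x - c\<bar>) * ((P powr \<gamma>) powr \<beta> * a)"
        by (simp add: powr_diff)
      finally show ?thesis by (simp add: c_def a_def G_def)
    qed
  qed
  then show ?thesis using C by (intro exI[of _ "C + 1"]) auto
qed

end

section \<open>The maximal commutator\<close>

context ball_space begin

text \<open>The measurable majorant \<open>W\<close> stands in for the modular, whose integrand
  contains a supremum of commutators. It is the weighted maximal function of \<open>maj\<close> plus
  the errors from large balls.\<close>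

theorem commutator_modular_bounded:
  assumes b: "bmo b D" and r: "log_exponent r lo hi ri C" and q: "log_exponent q lo hi' qi C'"
    and rq: "AE x in M. 1 / q x = 1 / r x - \<beta>" "1 / qi = 1 / ri - \<beta>" and \<beta>: "0 \<le> \<beta>" and lo: "1 < lo"
  shows "\<exists>K\<ge>1. \<forall>g. g \<in> borel_measurable M \<longrightarrow> (\<forall>x. 0 \<le> g x) \<longrightarrow> (\<integral>\<^sup>+x. ennreal (g x powr r x) \<partial>M) \<le> 1 \<longrightarrow>
    (\<exists>W\<in>borel_measurable M. (\<integral>\<^sup>+x. W x \<partial>M) \<le> ennreal K \<and>
      (AE x in M. (if (SUP \<gamma>. comm \<beta> b g \<gamma> x) = \<top> then \<top> else ennreal (enn2real (SUP \<gamma>. comm \<beta> b g \<gamma> x) powr q x)) \<le> W x))"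
proof -
  note R = log_exponentD[OF r] and Q = log_exponentD[OF q]
  have [measurable]: "b \<in> borel_measurable M" using b loc_intD by (auto simp: bmo_def)
  \<comment> \<open>Then \<open>lo / s = s\<close>: the exponents divided by \<open>s\<close> are
    still at least \<open>s > 1\<close>.\<close>
  define s where "s = sqrt lo"
  have s1: "1 < s" and ss: "s * s = lo" using lo by (auto simp: s_def)
  have slo: "s \<le> lo / s" using s1 ss by (simp add: pos_le_divide_eq)
  have s0: "0 < s" "s \<noteq> 0" "1 \<le> s" using s1 by auto
  \<comment> \<open>The weight is at least 1, so its power with exponent \<open>q x\<close> is
    bounded by its N-th power.\<close>
  define N where "N = nat \<lceil>hi'\<rceil>"
  have N: "hi' \<le> real N" unfolding N_def by linarith
  define \<Psi> where "\<Psi> \<gamma> x = ennreal ((1 + \<bar>b x - avg \<gamma> b x\<bar>) ^ N)" for \<gamma> :: int and x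
  have [measurable]: "\<Psi> \<gamma> \<in> borel_measurable M" for \<gamma> unfolding \<Psi>_def by measurable
  obtain Cm where Cm: "0 < Cm" "\<And>\<gamma> z. z \<in> space M \<Longrightarrow> (\<integral>\<^sup>+y\<in>B \<gamma> z. (SUP j\<in>{..\<gamma>}. \<Psi> j y) \<partial>M) \<le> ennreal Cm * ennreal (P powr \<gamma>)"
    using bmo_maximal_moments[OF b, of N] unfolding \<Psi>_def by blast
  obtain Cw where Cw: "0 \<le> Cw" "\<And>H. H \<in> borel_measurable M \<Longrightarrow> (\<And>x. 0 \<le> H x) \<Longrightarrow> (\<integral>\<^sup>+x. ennreal (H x powr s) \<partial>M) < \<infinity> \<Longrightarrow>
    (\<integral>\<^sup>+x. (SUP \<gamma>. \<Psi> \<gamma> x * ennreal (avg \<gamma> H x powr s)) \<partial>M) \<le> ennreal Cw * (\<integral>\<^sup>+x. ennreal (H x powr s) \<partial>M)"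
    using weighted_maximal[of \<Psi> Cm s] Cm s1 by (auto simp: less_imp_le)
  obtain Cd where Cd: "0 \<le> Cd" "(\<integral>\<^sup>+x. ennreal (decay x) * \<Psi> 0 x \<partial>M) \<le> ennreal Cd"
    using decay_moments[OF b, of N] unfolding \<Psi>_def by blast
  obtain Cc where Cc: "1 \<le> Cc" "\<And>g x \<gamma>. g \<in> borel_measurable M \<Longrightarrow> (\<And>x. 0 \<le> g x) \<Longrightarrow> loc_int (\<lambda>y. g y powr s) \<Longrightarrow> x \<in> space M \<Longrightarrow>
    comm \<beta> b g \<gamma> x \<le> ennreal (Cc * (1 + \<bar>b x - avg \<gamma> b x\<bar>) * ((P powr \<gamma>) powr \<beta> * avg \<gamma> (\<lambda>y. g y powr s) x powr (1 / s)))"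
    using comm_le[OF b s1, of \<beta>] by blast
  define r' q' where "r' x = r x / s" and "q' x = q x / s" for x
  note r' = log_exponent_divide[OF r s0(1), folded r'_def] and q' = log_exponent_divide[OF q s0(1), folded q'_def]
  \<comment> \<open>For the s-th power of \<open>g\<close> the fractional parameter becomes
    \<open>s * \<beta>\<close>, since taking the s-th root at the end brings it back to
    \<open>\<beta>\<close>.\<close>
  have rq': "AE x in M. 1 / q' x = 1 / r' x - s * \<beta>"
    using rq(1) by eventually_elim (simp add: r'_def q'_def, metis mult.right_neutral right_diff_distrib times_divide_eq_right)
  have rqi': "1 / (qi / s) = 1 / (ri / s) - s * \<beta>"
    using rq(2) by (simp, metis mult.right_neutral right_diff_distrib times_divide_eq_right)
  have sb: "0 \<le> s * \<beta>" using \<beta> s0 by simp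
  have los: "1 \<le> lo / s" using s0(3) slo by (rule order_trans)
  obtain K0 where K0: "1 \<le> K0" and key: "\<And>f. f \<in> borel_measurable M \<Longrightarrow> (\<And>x. 0 \<le> f x) \<Longrightarrow> (\<integral>\<^sup>+x. ennreal (f x powr r' x) \<partial>M) \<le> 1 \<Longrightarrow>
    (AE x in M. \<forall>\<gamma>. ((P powr \<gamma>) powr (s * \<beta>) * avg \<gamma> f x) powr q' x \<le>
      K0 * (avg \<gamma> (maj r' s f) x powr s + (if 0 \<le> \<gamma> then decay x * P powr (- (real_of_int \<gamma> * ((lo / s - 1) / (qi / s)))) else 0)))"
    using fractional_average_powr_le[OF r' q' rq' rqi' sb s0(3) slo los] by blast
  \<comment> \<open>The rate at which the error decays with the scale; it is positive because
    \<open>lo / s = s > 1\<close>.\<close>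
  define \<epsilon> where "\<epsilon> = (lo / s - 1) / (qi / s)"
  have "0 < lo / s - 1" "0 < qi / s" using slo s1 Q(2) lo by (linarith, simp)
  then have \<epsilon>: "0 < \<epsilon>" unfolding \<epsilon>_def by (rule divide_pos_pos)
  \<comment> \<open>The jump of the averages per scale; adding 1 keeps it positive if
    \<open>D = 0\<close>.\<close>
  define k where "k = P * D + 1"
  have k: "0 < k" "P * D \<le> k" using bmo_nonneg[OF b] unfolding k_def by (auto intro: add_nonneg_pos)
  have t: "0 < \<epsilon> * ln P" using \<epsilon> by simp
  obtain K4 where K4: "0 < K4" "\<And>u. 0 \<le> u \<Longrightarrow> (1 + k * u) ^ N \<le> K4 * exp (\<epsilon> * ln P * u)"
    using power_le_exp[OF t k(1), of N] by blast
  \<comment> \<open>Compared with scale 0, the weight grows at most by a factor linear in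
    \<open>\<gamma>\<close>, and the N-th power of this factor is absorbed by the exponential decay.
    The bound is free of \<open>\<gamma>\<close>, hence survives the supremum.\<close>
  have err: "(1 + \<bar>b x - avg \<gamma> b x\<bar>) ^ N * P powr (- (real_of_int \<gamma> * \<epsilon>)) \<le> K4 * (1 + \<bar>b x - avg 0 b x\<bar>) ^ N"
    if x: "x \<in> space M" and g: "0 \<le> \<gamma>" for x \<gamma>
  proof -
    have "\<bar>avg 0 b x - avg \<gamma> b x\<bar> \<le> real_of_int \<gamma> * (P * D)"
      using bmo_steps[OF b x, of 0 "nat \<gamma>"] g by simp
    also have "\<dots> \<le> real_of_int \<gamma> * k" using k g by (intro mult_left_mono) auto
    finally have "\<bar>avg 0 b x - avg \<gamma> b x\<bar> \<le> k * real_of_int \<gamma>" by (simp add: mult.commute)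
    moreover have "0 \<le> \<bar>b x - avg 0 b x\<bar> * (k * real_of_int \<gamma>)" using k g by simp
    moreover have "(1 + \<bar>b x - avg 0 b x\<bar>) * (1 + k * real_of_int \<gamma>) = 1 + \<bar>b x - avg 0 b x\<bar> + k * real_of_int \<gamma> + \<bar>b x - avg 0 b x\<bar> * (k * real_of_int \<gamma>)"
      by (simp add: algebra_simps)
    ultimately have "1 + \<bar>b x - avg \<gamma> b x\<bar> \<le> (1 + \<bar>b x - avg 0 b x\<bar>) * (1 + k * real_of_int \<gamma>)" by linarith
    then have "(1 + \<bar>b x - avg \<gamma> b x\<bar>) ^ N \<le> ((1 + \<bar>b x - avg 0 b x\<bar>) * (1 + k * real_of_int \<gamma>)) ^ N"
      by (intro power_mono) auto
    also have "\<dots> = (1 + \<bar>b x - avg 0 b x\<bar>) ^ N * (1 + k * real_of_int \<gamma>) ^ N" by (rule power_mult_distrib)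
    also have "\<dots> \<le> (1 + \<bar>b x - avg 0 b x\<bar>) ^ N * (K4 * exp (\<epsilon> * ln P * real_of_int \<gamma>))"
      using g by (intro mult_left_mono K4) auto
    also have "exp (\<epsilon> * ln P * real_of_int \<gamma>) = P powr (real_of_int \<gamma> * \<epsilon>)" by (simp add: powr_def mult_ac)
    finally have "(1 + \<bar>b x - avg \<gamma> b x\<bar>) ^ N * P powr (- (real_of_int \<gamma> * \<epsilon>)) \<le>
       (1 + \<bar>b x - avg 0 b x\<bar>) ^ N * (K4 * P powr (real_of_int \<gamma> * \<epsilon>)) * P powr (- (real_of_int \<gamma> * \<epsilon>))"
      by (intro mult_right_mono) auto
    also have "\<dots> = K4 * (1 + \<bar>b x - avg 0 b x\<bar>) ^ N * (P powr (real_of_int \<gamma> * \<epsilon>) * P powr (- (real_of_int \<gamma> * \<epsilon>)))"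
      by simp
    also have "P powr (real_of_int \<gamma> * \<epsilon>) * P powr (- (real_of_int \<gamma> * \<epsilon>)) = 1" by (simp flip: powr_add)
    finally show ?thesis by simp
  qed
  define K3 where "K3 = Cc powr hi' * K0"
  have K30: "0 \<le> K3" using K0 by (simp add: K3_def)
  define K where "K = K3 * (Cw * (2 powr s * 3) + K4 * Cd) + 1"
  have K1: "1 \<le> K" using K30 Cw Cd K4 by (simp add: K_def)
  have "\<exists>W\<in>borel_measurable M. (\<integral>\<^sup>+x. W x \<partial>M) \<le> ennreal K \<and>
      (AE x in M. (if (SUP \<gamma>. comm \<beta> b g \<gamma> x) = \<top> then \<top> else ennreal (enn2real (SUP \<gamma>. comm \<beta> b g \<gamma> x) powr q x)) \<le> W x)"
    if g [measurable]: "g \<in> borel_measurable M" and g0: "\<And>x. 0 \<le> g x" and fin: "(\<integral>\<^sup>+x. ennreal (g x powr r x) \<partial>M) \<le> 1" for g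
  proof -
    define f where "f y = g y powr s" for y
    have f [measurable]: "f \<in> borel_measurable M" and f0: "\<And>x. 0 \<le> f x" unfolding f_def by auto
    have finf: "(\<integral>\<^sup>+x. ennreal (f x powr r' x) \<partial>M) \<le> 1"
      using fin s0 by (simp add: f_def r'_def powr_powr)
    define H where "H = maj r' s f"
    have r'm: "r' \<in> borel_measurable M" using log_exponentD(1)[OF r'] .
    have [measurable]: "H \<in> borel_measurable M" unfolding H_def using r'm f by (rule maj_measurable)
    have mi: "(\<integral>\<^sup>+x. ennreal (H x powr s) \<partial>M) \<le> ennreal (2 powr s * 3)"
      unfolding H_def by (rule maj_integral[OF r'm f f0 s0(3) finf])
    have lf: "loc_int f" by (rule variable_loc_int[OF r' los f f0 finf])
    define W where "W x = ennreal K3 * ((SUP \<gamma>. \<Psi> \<gamma> x * ennreal (avg \<gamma> H x powr s)) + ennreal K4 * (ennreal (decay x) * \<Psi> 0 x))" for x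
    have [measurable]: "W \<in> borel_measurable M" unfolding W_def by measurable
    have "AE x in M. x \<in> space M" by simp
    with key[OF f f0 finf] Q(5) have pw: "AE x in M. (if (SUP \<gamma>. comm \<beta> b g \<gamma> x) = \<top> then \<top> else ennreal (enn2real (SUP \<gamma>. comm \<beta> b g \<gamma> x) powr q x)) \<le> W x"
    proof eventually_elim
      fix x
      assume kx: "\<forall>\<gamma>. ((P powr \<gamma>) powr (s * \<beta>) * avg \<gamma> f x) powr q' x \<le>
        K0 * (avg \<gamma> (maj r' s f) x powr s + (if 0 \<le> \<gamma> then decay x * P powr (- (real_of_int \<gamma> * ((lo / s - 1) / (qi / s)))) else 0))"
        and qx: "lo \<le> q x \<and> q x \<le> hi' \<and> \<bar>q x - qi\<bar> * real (level x) \<le> C'"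
        and x: "x \<in> space M"
      have q0: "0 < q x" using qx lo by linarith
      show "(if (SUP \<gamma>. comm \<beta> b g \<gamma> x) = \<top> then \<top> else ennreal (enn2real (SUP \<gamma>. comm \<beta> b g \<gamma> x) powr q x)) \<le> W x"
      \<comment> \<open>For finite \<open>W x\<close>, bounding the commutator on every ball by one
        real number shows at the same time that the supremum is finite.\<close>
      proof (cases "W x")
        case (real w)
        have "comm \<beta> b g \<gamma> x \<le> ennreal (w powr (1 / q x))" for \<gamma>
        proof -
          let ?z = "1 + \<bar>b x - avg \<gamma> b x\<bar>" and ?a = "avg \<gamma> f x"
          define u where "u = Cc * ?z * ((P powr \<gamma>) powr \<beta> * ?a powr (1 / s))"
          have a0: "0 \<le> ?a" using f0 by (intro avg_nonneg) auto
          have u0: "0 \<le> u" using Cc(1) by (simp add: u_def)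
          have cu: "comm \<beta> b g \<gamma> x \<le> ennreal u"
            unfolding u_def f_def by (rule Cc(2)[OF g g0 _ x]) (use lf in \<open>simp add: f_def[abs_def]\<close>)
          have "(P powr \<gamma>) powr \<beta> * ?a powr (1 / s) = ((P powr \<gamma>) powr (s * \<beta>) * ?a) powr (1 / s)"
            using s0 a0 by (simp add: powr_mult powr_powr)
          then have "((P powr \<gamma>) powr \<beta> * ?a powr (1 / s)) powr q x = ((P powr \<gamma>) powr (s * \<beta>) * ?a) powr q' x"
            by (simp add: powr_powr q'_def)
          then have "u powr q x = Cc powr q x * ?z powr q x * ((P powr \<gamma>) powr (s * \<beta>) * ?a) powr q' x"
            unfolding u_def using Cc(1) by (simp add: powr_mult)
          also have "\<dots> \<le> (Cc powr hi' * ?z ^ N) * (K0 * (avg \<gamma> H x powr s + (if 0 \<le> \<gamma> then decay x * P powr (- (real_of_int \<gamma> * \<epsilon>)) else 0)))"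
          proof (intro mult_mono)
            show "Cc powr q x \<le> Cc powr hi'" using Cc(1) qx by (intro powr_mono) auto
            have "?z powr q x \<le> ?z powr real N" using qx N by (intro powr_mono) auto
            then show "?z powr q x \<le> ?z ^ N" by (simp add: powr_realpow)
            show "((P powr \<gamma>) powr (s * \<beta>) * ?a) powr q' x \<le> K0 * (avg \<gamma> H x powr s + (if 0 \<le> \<gamma> then decay x * P powr (- (real_of_int \<gamma> * \<epsilon>)) else 0))"
              using kx unfolding H_def \<epsilon>_def by blast
          qed auto
          also have "\<dots> = K3 * (?z ^ N * avg \<gamma> H x powr s + (if 0 \<le> \<gamma> then decay x * (?z ^ N * P powr (- (real_of_int \<gamma> * \<epsilon>))) else 0))"
            by (simp add: K3_def algebra_simps)
          also have "\<dots> \<le> K3 * (?z ^ N * avg \<gamma> H x powr s + K4 * (decay x * (1 + \<bar>b x - avg 0 b x\<bar>) ^ N))"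
          proof (intro mult_left_mono add_left_mono K30)
            have "decay x * (?z ^ N * P powr (- (real_of_int \<gamma> * \<epsilon>))) \<le> decay x * (K4 * (1 + \<bar>b x - avg 0 b x\<bar>) ^ N)" if "0 \<le> \<gamma>"
              by (intro mult_left_mono err[OF x that]) simp
            then show "(if 0 \<le> \<gamma> then decay x * (?z ^ N * P powr (- (real_of_int \<gamma> * \<epsilon>))) else 0) \<le> K4 * (decay x * (1 + \<bar>b x - avg 0 b x\<bar>) ^ N)"
              using K4 by (auto simp: mult_ac)
          qed
          finally have "ennreal (u powr q x) \<le> ennreal (K3 * (?z ^ N * avg \<gamma> H x powr s + K4 * (decay x * (1 + \<bar>b x - avg 0 b x\<bar>) ^ N)))"
            by (rule ennreal_leI)
          also have "\<dots> = ennreal K3 * (\<Psi> \<gamma> x * ennreal (avg \<gamma> H x powr s) + ennreal K4 * (ennreal (decay x) * \<Psi> 0 x))"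
            unfolding \<Psi>_def using K30 K4 by (simp add: ennreal_mult ennreal_plus)
          also have "\<dots> \<le> W x"
            unfolding W_def by (intro mult_left_mono add_right_mono SUP_upper) auto
          finally have "ennreal (u powr q x) \<le> ennreal w" using real by simp
          then have "u powr q x \<le> w" using real by (simp add: ennreal_le_iff)
          then have "(u powr q x) powr (1 / q x) \<le> w powr (1 / q x)" using q0 by (intro powr_mono2) auto
          then have "u \<le> w powr (1 / q x)" using q0 u0 by (simp add: powr_powr)
          then show ?thesis using cu by (meson ennreal_leI order_trans)
        qed
        then have S: "(SUP \<gamma>. comm \<beta> b g \<gamma> x) \<le> ennreal (w powr (1 / q x))" by (intro SUP_least) auto
        then have nt: "(SUP \<gamma>. comm \<beta> b g \<gamma> x) \<noteq> \<top>" by (metis ennreal_neq_top neq_top_trans)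
        have "enn2real (SUP \<gamma>. comm \<beta> b g \<gamma> x) \<le> w powr (1 / q x)"
          using enn2real_mono[OF S] by simp
        then have "enn2real (SUP \<gamma>. comm \<beta> b g \<gamma> x) powr q x \<le> (w powr (1 / q x)) powr q x"
          using q0 by (intro powr_mono2) auto
        also have "\<dots> = w" using q0 real by (simp add: powr_powr)
        finally have le: "enn2real (SUP \<gamma>. comm \<beta> b g \<gamma> x) powr q x \<le> w" .
        show ?thesis by (simp only: if_not_P[OF nt] real ennreal_leI[OF le])
      qed simp
    qed
    have "(\<integral>\<^sup>+x. W x \<partial>M) = ennreal K3 * ((\<integral>\<^sup>+x. (SUP \<gamma>. \<Psi> \<gamma> x * ennreal (avg \<gamma> H x powr s)) \<partial>M) + ennreal K4 * (\<integral>\<^sup>+x. ennreal (decay x) * \<Psi> 0 x \<partial>M))"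
      unfolding W_def by (simp add: nn_integral_cmult nn_integral_add)
    also have "\<dots> \<le> ennreal K3 * (ennreal Cw * ennreal (2 powr s * 3) + ennreal K4 * ennreal Cd)"
    proof (intro mult_left_mono add_mono Cd(2))
      have "(\<integral>\<^sup>+x. (SUP \<gamma>. \<Psi> \<gamma> x * ennreal (avg \<gamma> H x powr s)) \<partial>M) \<le> ennreal Cw * (\<integral>\<^sup>+x. ennreal (H x powr s) \<partial>M)"
      proof (rule Cw(2))
        show "(\<integral>\<^sup>+x. ennreal (H x powr s) \<partial>M) < \<infinity>" using mi by (rule order.strict_trans1) simp
      qed (simp_all, simp add: H_def)
      also have "\<dots> \<le> ennreal Cw * ennreal (2 powr s * 3)" by (intro mult_left_mono mi) simp
      finally show "(\<integral>\<^sup>+x. (SUP \<gamma>. \<Psi> \<gamma> x * ennreal (avg \<gamma> H x powr s)) \<partial>M) \<le> ennreal Cw * ennreal (2 powr s * 3)" .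
    qed auto
    also have "\<dots> = ennreal (K3 * (Cw * (2 powr s * 3) + K4 * Cd))"
    proof -
      have "ennreal Cw * ennreal (2 powr s * 3) = ennreal (Cw * (2 powr s * 3))" "ennreal K4 * ennreal Cd = ennreal (K4 * Cd)"
        using Cw K4 Cd by (auto simp only: ennreal_mult less_imp_le mult_nonneg_nonneg powr_ge_zero zero_le_numeral)
      then show ?thesis using Cw(1) K4 Cd(1) K30 by (simp flip: ennreal_plus ennreal_mult')
    qed
    also have "\<dots> \<le> ennreal K" by (intro ennreal_leI) (simp add: K_def)
    finally show ?thesis using pw \<open>W \<in> borel_measurable M\<close> by blast
  qed
  then show ?thesis using K1 by blast
qed

text \<open>In terms of norms, that of the indicator of B in exponent r is at most a constant times
  |B|^\<beta> times that in exponent q. A small ball behaves as for constant exponents given by the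
  lower bound \<open>u\<close> of r on it, a large one as for the limits at infinity.\<close>

theorem ball_norm_transfer:
  assumes r: "log_exponent r lo hi ri C" and q: "log_exponent q lo' hi' qi C'"
    and rq: "AE x in M. 1 / q x = 1 / r x - \<beta>" "1 / qi = 1 / ri - \<beta>" and \<beta>: "0 \<le> \<beta>" "hi * \<beta> < 1"
    and lo: "1 \<le> lo" "1 \<le> lo'"
  shows "\<exists>K\<ge>1. \<forall>\<gamma> z l. z \<in> space M \<longrightarrow> 0 < l \<longrightarrow> (\<integral>\<^sup>+x\<in>B \<gamma> z. ennreal (l powr q x) \<partial>M) \<le> 1 \<longrightarrow>
    (\<integral>\<^sup>+x\<in>B \<gamma> z. ennreal ((l / (P powr \<gamma>) powr \<beta>) powr r x) \<partial>M) \<le> ennreal K"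
proof -
  note R = log_exponentD[OF r] and Q = log_exponentD[OF q]
  have [measurable]: "r \<in> borel_measurable M" "q \<in> borel_measurable M" using R Q by auto
  \<comment> \<open>It bounds \<open>l powr qi\<close> times the measure of a large ball: the first
    summand is the cost of exchanging \<open>q x\<close> for \<open>qi\<close>, and 2 is the
    integral of \<open>decay\<close>.\<close>
  define m where "m = P powr (2 * C') + 2"
  have m1: "1 \<le> m" unfolding m_def by (simp add: add_increasing)
  define K where "K = P powr C + (P powr (2 * C) * m + 2)"
  have K1: "1 \<le> K" using m1 by (simp add: K_def add_increasing)
  have "(\<integral>\<^sup>+x\<in>B \<gamma> z. ennreal ((l / (P powr \<gamma>) powr \<beta>) powr r x) \<partial>M) \<le> ennreal K"
    if z: "z \<in> space M" and l: "0 < l" and fin: "(\<integral>\<^sup>+x\<in>B \<gamma> z. ennreal (l powr q x) \<partial>M) \<le> 1" for \<gamma> z l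
  proof -
    have [measurable]: "B \<gamma> z \<in> sets M" using z by (simp add: ball_sets)
    have const: "(\<integral>\<^sup>+x\<in>B \<gamma> z. ennreal c \<partial>M) = ennreal (c * P powr \<gamma>)" for c
      using z by (simp add: nn_integral_cmult_indicator emeasure_ball ennreal_mult'')
    have lower: "c * P powr \<gamma> \<le> 1" if "AE x in M. x \<in> B \<gamma> z \<longrightarrow> c \<le> l powr q x" for c
    proof -
      have "ennreal (c * P powr \<gamma>) \<le> (\<integral>\<^sup>+x\<in>B \<gamma> z. ennreal (l powr q x) \<partial>M)"
        unfolding const[symmetric]
        by (rule nn_integral_mono_AE, use that in eventually_elim) (auto simp: indicator_def ennreal_leI)
      from order_trans[OF this fin] show ?thesis by simp
    qed
    define \<mu> where "\<mu> = l / (P powr \<gamma>) powr \<beta>"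
    have \<mu>0: "0 < \<mu>" using l by (simp add: \<mu>_def)
    show ?thesis
    proof (cases "\<gamma> < 0")
      case True
      obtain u where u: "lo \<le> u" "u \<le> hi" "AE y in M. y \<in> B \<gamma> z \<longrightarrow> u \<le> r y \<and> - real_of_int \<gamma> * (r y - u) \<le> C"
        using R(6)[OF True z] by blast
      have u1: "1 \<le> u" using u lo by simp
      have bu: "\<beta> < 1 / u"
      proof -
        have "u * \<beta> \<le> hi * \<beta>" using u \<beta> by (intro mult_right_mono)
        then show ?thesis using \<beta> u1 by (simp add: pos_less_divide_eq mult.commute)
      qed
      \<comment> \<open>The exponent that corresponds to \<open>u\<close> as q corresponds to r, and
        hence a lower bound for q on the ball. Its positivity rests on
        \<open>hi * \<beta> < 1\<close>.\<close>
      define \<kappa> where "\<kappa> = 1 / (1 / u - \<beta>)"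
      have \<kappa>: "0 < \<kappa>" "1 / \<kappa> = 1 / u - \<beta>" using bu by (auto simp: \<kappa>_def)
      have lk: "l \<le> P powr (- real_of_int \<gamma> / \<kappa>)"
      proof (cases "1 \<le> l")
        case l1: True
        have "l powr \<kappa> * P powr \<gamma> \<le> 1"
        proof (rule lower, use u(3) rq(1) Q(5) in eventually_elim, intro impI)
          fix y assume y: "y \<in> B \<gamma> z \<longrightarrow> u \<le> r y \<and> - real_of_int \<gamma> * (r y - u) \<le> C" "y \<in> B \<gamma> z"
            and eq: "1 / q y = 1 / r y - \<beta>" and qy: "lo' \<le> q y \<and> q y \<le> hi' \<and> \<bar>q y - qi\<bar> * real (level y) \<le> C'"
          have q0: "0 < q y" using qy lo by linarith
          have "1 / r y \<le> 1 / u" using y u1 by (intro divide_left_mono) auto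
          then have "1 / q y \<le> 1 / \<kappa>" using eq \<kappa> by simp
          then have "\<kappa> \<le> q y" using q0 \<kappa>(1) by (simp add: field_simps)
          then show "l powr \<kappa> \<le> l powr q y" using l1 by (rule powr_mono)
        qed
        then have "l powr \<kappa> \<le> P powr (- real_of_int \<gamma>)"
          by (simp add: powr_minus_divide pos_le_divide_eq)
        then have "(l powr \<kappa>) powr (1 / \<kappa>) \<le> (P powr (- real_of_int \<gamma>)) powr (1 / \<kappa>)"
          using \<kappa>(1) by (intro powr_mono2) auto
        then show ?thesis using \<kappa>(1) l by (simp add: powr_powr)
      next
        case False
        have "1 \<le> P powr (- real_of_int \<gamma> / \<kappa>)"
          using True \<kappa>(1) by (intro ge_one_powr_ge_zero) (auto intro: divide_nonpos_pos)
        then show ?thesis using False by simp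
      qed
      have \<mu>u: "\<mu> \<le> P powr (- real_of_int \<gamma> / u)"
      proof -
        have "\<mu> = l * P powr (- (real_of_int \<gamma> * \<beta>))" by (simp add: \<mu>_def powr_powr powr_minus_divide)
        also have "\<dots> \<le> P powr (- real_of_int \<gamma> / \<kappa>) * P powr (- (real_of_int \<gamma> * \<beta>))"
          using lk by (intro mult_right_mono) auto
        also have "\<dots> = P powr (- real_of_int \<gamma> * (1 / \<kappa> + \<beta>))" by (simp add: algebra_simps flip: powr_add)
        also have "1 / \<kappa> + \<beta> = 1 / u" using \<kappa>(2) by simp
        finally show ?thesis by simp
      qed
      have "(\<integral>\<^sup>+x\<in>B \<gamma> z. ennreal (\<mu> powr r x) \<partial>M) \<le> (\<integral>\<^sup>+x\<in>B \<gamma> z. ennreal (P powr (- real_of_int \<gamma> + C)) \<partial>M)"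
      proof (rule nn_integral_mono_AE, use u(3) in eventually_elim)
        fix y assume y: "y \<in> B \<gamma> z \<longrightarrow> u \<le> r y \<and> - real_of_int \<gamma> * (r y - u) \<le> C"
        show "ennreal (\<mu> powr r y) * indicator (B \<gamma> z) y \<le> ennreal (P powr (- real_of_int \<gamma> + C)) * indicator (B \<gamma> z) y"
        proof (cases "y \<in> B \<gamma> z")
          case True
          have "\<mu> powr r y \<le> (P powr (- real_of_int \<gamma> / u)) powr r y"
            using \<mu>u \<mu>0 y True u1 by (intro powr_mono2) auto
          also have "\<dots> = P powr (- real_of_int \<gamma> / u * r y)" by (simp only: powr_powr)
          \<comment> \<open>Raising the power from \<open>u\<close> to \<open>r y\<close> costs at
            most \<open>P powr C\<close>, by the local logarithmic condition. The remaining
            \<open>P powr (- \<gamma>)\<close> cancels the measure of the ball.\<close>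
          also have "\<dots> \<le> P powr (- real_of_int \<gamma> + C)"
          proof (intro powr_mono)
            have "- real_of_int \<gamma> / u * r y = - real_of_int \<gamma> + (- real_of_int \<gamma> * (r y - u)) / u"
              using u1 by (simp add: field_simps)
            also have "(- real_of_int \<gamma> * (r y - u)) / u \<le> C / u" using y True u1 by (intro divide_right_mono) auto
            also have "C / u \<le> C" using u1 R(4) by (simp add: divide_le_eq mult_le_cancel_left1)
            finally show "- real_of_int \<gamma> / u * r y \<le> - real_of_int \<gamma> + C" by simp
          qed simp
          finally show ?thesis by (intro mult_right_mono ennreal_leI) auto
        qed simp
      qed
      also have "\<dots> = ennreal (P powr C)" unfolding const by (simp flip: powr_add)
      also have "\<dots> \<le> ennreal K" using m1 by (intro ennreal_leI) (simp add: K_def)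
      finally show ?thesis by (simp add: \<mu>_def)
    next
      case False
      then have g: "0 \<le> \<gamma>" by simp
      have Pg: "1 \<le> P powr \<gamma>" using g by (intro ge_one_powr_ge_zero) auto
      have ri1: "1 \<le> ri" and qi1: "1 \<le> qi" using R Q lo by linarith+
      \<comment> \<open>On a ball of measure at least 1 a value above 1 would push the modular above
        1. With \<open>l\<close> at most 1 the exponent at infinity can be used.\<close>
      have l1: "l \<le> 1"
      proof (rule ccontr)
        assume n: "\<not> l \<le> 1"
        have "l * P powr \<gamma> \<le> 1"
        proof (rule lower, use Q(5) in eventually_elim, intro impI)
          fix y assume "lo' \<le> q y \<and> q y \<le> hi' \<and> \<bar>q y - qi\<bar> * real (level y) \<le> C'"
          then show "l \<le> l powr q y" using n lo powr_mono[of 1 "q y" l] by simp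
        qed
        moreover have "l * 1 \<le> l * P powr \<gamma>" using l Pg by (intro mult_left_mono) auto
        ultimately show False using n by simp
      qed
      have lq: "l powr qi \<le> m / P powr \<gamma>"
      proof -
        have "ennreal (l powr qi * P powr \<gamma>) = (\<integral>\<^sup>+x\<in>B \<gamma> z. ennreal (l powr qi) \<partial>M)" by (rule const[symmetric])
        also have "\<dots> \<le> (\<integral>\<^sup>+x. ennreal (P powr (2 * C')) * (ennreal (l powr q x) * indicator (B \<gamma> z) x) + ennreal (decay x) \<partial>M)"
        proof (rule nn_integral_mono_AE, use Q(5) in eventually_elim)
          fix y assume y: "lo' \<le> q y \<and> q y \<le> hi' \<and> \<bar>q y - qi\<bar> * real (level y) \<le> C'"
          have "l powr qi \<le> P powr (2 * C') * l powr q y + decay y * l powr 0"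
            by (rule exchange_exponent) (use l l1 y qi1 in \<open>auto simp: abs_minus_commute\<close>)
          then have "ennreal (l powr qi) \<le> ennreal (P powr (2 * C') * l powr q y + decay y)"
            using l by (intro ennreal_leI) simp
          then show "ennreal (l powr qi) * indicator (B \<gamma> z) y \<le> ennreal (P powr (2 * C')) * (ennreal (l powr q y) * indicator (B \<gamma> z) y) + ennreal (decay y)"
            by (cases "y \<in> B \<gamma> z") (auto simp: ennreal_mult ennreal_plus)
        qed
        also have "\<dots> = ennreal (P powr (2 * C')) * (\<integral>\<^sup>+x\<in>B \<gamma> z. ennreal (l powr q x) \<partial>M) + (\<integral>\<^sup>+x. ennreal (decay x) \<partial>M)"
          by (simp add: nn_integral_cmult nn_integral_add)
        also have "\<dots> \<le> ennreal (P powr (2 * C')) * 1 + 2"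
          by (intro add_mono mult_left_mono fin decay_integral) auto
        also have "\<dots> = ennreal m" by (simp add: m_def ennreal_plus)
        finally have "l powr qi * P powr \<gamma> \<le> m" using m1 by (subst (asm) ennreal_le_iff) auto
        then show ?thesis by (simp add: pos_le_divide_eq)
      qed
      have rqi: "ri / qi = 1 - \<beta> * ri"
      proof -
        have "ri * (1 / qi) = ri * (1 / ri - \<beta>)" using rq(2) by simp
        then show ?thesis using ri1 by (simp add: right_diff_distrib mult.commute)
      qed
      have \<mu>r: "\<mu> powr ri \<le> m / P powr \<gamma>"
      proof -
        have "l powr ri = (l powr qi) powr (ri / qi)" using qi1 by (simp add: powr_powr)
        also have "\<dots> \<le> (m / P powr \<gamma>) powr (ri / qi)" using lq qi1 ri1 by (intro powr_mono2) auto
        also have "\<dots> = m powr (ri / qi) / P powr (\<gamma> * (ri / qi))" using m1 by (simp add: powr_divide powr_powr)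
        also have "\<dots> \<le> m / P powr (\<gamma> * (ri / qi))"
        proof (intro divide_right_mono)
          have "ri / qi \<le> 1" unfolding rqi using \<beta> ri1 by simp
          then show "m powr (ri / qi) \<le> m" using powr_mono[of "ri / qi" 1 m] m1 by simp
        qed simp
        finally have "l powr ri \<le> m / P powr (\<gamma> * (ri / qi))" .
        then have "l powr ri / P powr (\<gamma> * (\<beta> * ri)) \<le> m / P powr (\<gamma> * (ri / qi)) / P powr (\<gamma> * (\<beta> * ri))"
          by (intro divide_right_mono) auto
        also have "\<dots> = m / P powr (\<gamma> * (ri / qi) + \<gamma> * (\<beta> * ri))" by (simp add: powr_add)
        also have "\<gamma> * (ri / qi) + \<gamma> * (\<beta> * ri) = \<gamma>" unfolding rqi by (simp add: algebra_simps)
        also have "l powr ri / P powr (\<gamma> * (\<beta> * ri)) = \<mu> powr ri"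
          using l by (simp add: \<mu>_def powr_divide powr_powr mult.assoc)
        finally show ?thesis .
      qed
      have \<mu>1: "\<mu> \<le> 1"
      proof -
        have "1 \<le> (P powr \<gamma>) powr \<beta>" using g \<beta> by (intro ge_one_powr_ge_zero) auto
        then have "\<mu> \<le> l" unfolding \<mu>_def using l by (simp add: divide_le_eq mult_le_cancel_left1)
        then show ?thesis using l1 by simp
      qed
      have "(\<integral>\<^sup>+x\<in>B \<gamma> z. ennreal (\<mu> powr r x) \<partial>M) \<le> (\<integral>\<^sup>+x. ennreal (P powr (2 * C) * (m / P powr \<gamma>)) * indicator (B \<gamma> z) x + ennreal (decay x) \<partial>M)"
      proof (rule nn_integral_mono_AE, use R(5) in eventually_elim)
        fix y assume y: "lo \<le> r y \<and> r y \<le> hi \<and> \<bar>r y - ri\<bar> * real (level y) \<le> C"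
        have "\<mu> powr r y \<le> P powr (2 * C) * \<mu> powr ri + decay y * \<mu> powr 0"
          by (rule exchange_exponent) (use \<mu>0 \<mu>1 y lo in auto)
        also have "\<dots> \<le> P powr (2 * C) * (m / P powr \<gamma>) + decay y"
          using \<mu>r \<mu>0 by (intro add_mono mult_left_mono) auto
        finally have "ennreal (\<mu> powr r y) \<le> ennreal (P powr (2 * C) * (m / P powr \<gamma>) + decay y)" by (rule ennreal_leI)
        then show "ennreal (\<mu> powr r y) * indicator (B \<gamma> z) y \<le> ennreal (P powr (2 * C) * (m / P powr \<gamma>)) * indicator (B \<gamma> z) y + ennreal (decay y)"
          using m1 by (cases "y \<in> B \<gamma> z") (auto simp: ennreal_plus)
      qed
      also have "\<dots> = ennreal (P powr (2 * C) * m) + (\<integral>\<^sup>+x. ennreal (decay x) \<partial>M)"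
        using const[of "P powr (2 * C) * (m / P powr \<gamma>)"] by (simp add: nn_integral_add)
      also have "\<dots> \<le> ennreal (P powr (2 * C) * m) + 2" by (intro add_left_mono decay_integral)
      also have "\<dots> = ennreal (P powr (2 * C) * m + 2)" using m1 by (simp add: ennreal_plus)
      also have "\<dots> \<le> ennreal K" by (intro ennreal_leI) (simp add: K_def)
      finally show ?thesis by (simp add: \<mu>_def)
    qed
  qed
  then show ?thesis using K1 by blast
qed

end

section \<open>Haar measure\<close>

lemma digits_unique:
  fixes a b p :: nat
  assumes p: "2 \<le> p" and eq: "\<And>i. a div p ^ i mod p = b div p ^ i mod p"
  shows "a = b"
  using eq
proof (induction "a + b" arbitrary: a b rule: less_induct)
  case less
  show ?case
  proof (cases "a + b = 0")
    case False
    have "a div p + b div p < a + b"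
    proof (cases "a = 0")
      case True
      then show ?thesis using False p by simp
    next
      case a: False
      then have "a div p < a" using p by simp
      moreover have "b div p \<le> b" by simp
      ultimately show ?thesis by linarith
    qed
    moreover have "a div p div p ^ i mod p = b div p div p ^ i mod p" for i
      using less.prems[of "Suc i"] by (simp add: div_mult2_eq)
    ultimately have "a div p = b div p" using less.hyps by blast
    moreover have "a mod p = b mod p" using less.prems[of 0] by simp
    ultimately show ?thesis by (metis div_mult_mod_eq)
  qed simp
qed

text \<open>Horner's scheme: the digits at places below \<open>c\<close>, with the most negative
  place leading, spell a natural number because \<open>X\<close> vanishes far to the left.\<close>

lemma digits_exist:
  fixes X :: "int \<Rightarrow> nat"
  assumes X: "\<And>m. X m < p" and X0: "\<And>m. m < m0 \<Longrightarrow> X m = 0"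
  shows "\<exists>N. \<forall>i. N div p ^ i mod p = X (c - 1 - int i)"
proof (cases "c \<le> m0")
  case True
  then show ?thesis by (intro exI[of _ 0]) (simp add: X0)
next
  case False
  have "\<exists>N. \<forall>i. N div p ^ i mod p = X (m0 + int d - 1 - int i)" for d
  proof (induction d)
    case 0
    then show ?case by (intro exI[of _ 0]) (simp add: X0)
  next
    case (Suc d)
    then obtain N where N: "\<And>i. N div p ^ i mod p = X (m0 + int d - 1 - int i)" by blast
    have p0: "0 < p" using X[of 0] by simp
    show ?case
    proof (intro exI[of _ "X (m0 + int d) + N * p"] allI)
      fix i
      show "(X (m0 + int d) + N * p) div p ^ i mod p = X (m0 + int (Suc d) - 1 - int i)"
      proof (cases i)
        case 0
        then show ?thesis using X by simp
      next
        case (Suc k)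
        have "(X (m0 + int d) + N * p) div p ^ i = N div p ^ k"
          using X[of "m0 + int d"] p0 by (simp add: Suc div_mult2_eq)
        then show ?thesis using N[of k] by (simp add: Suc algebra_simps)
      qed
    qed
  qed
  from this[of "nat (c - m0)"] show ?thesis using False by simp
qed

lemma int_div_less:
  fixes m K n :: int assumes n: "0 < n" and m: "m < n * K" shows "m div n < K"
proof (rule ccontr)
  assume "\<not> ?thesis"
  then have "n * K \<le> n * (m div n)" using n by (intro mult_left_mono) auto
  moreover have "n * (m div n) + m mod n = m" "0 \<le> m mod n" using n by auto
  ultimately show False using m by linarith
qed

section \<open>Balls described by digits\<close>

lemma padic_dist_le_iff:
  assumes p: "2 \<le> p" and a: "a \<in> padic_digits p" "b \<in> padic_digits p"
  shows "padic_dist p a b \<le> real p powr real_of_int \<gamma> \<longleftrightarrow> (\<forall>k < - \<gamma>. a k = b k)"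
proof (cases "a = b")
  case False
  obtain m1 m2 where "\<And>k. k < m1 \<Longrightarrow> a k = 0" "\<And>k. k < m2 \<Longrightarrow> b k = 0"
    using a by (auto simp: padic_digits_def)
  then have m: "a k = b k" if "k < min m1 m2" for k using that by simp
  \<comment> \<open>On the integers a least element need not exist, so the first difference is
    sought among natural offsets from a place before which both expansions vanish.\<close>
  define i0 where "i0 = (LEAST i::nat. a (min m1 m2 + int i) \<noteq> b (min m1 m2 + int i))"
  obtain k' where k': "a k' \<noteq> b k'" using False by blast
  then have "min m1 m2 \<le> k'" using m by force
  then have "a (min m1 m2 + int (nat (k' - min m1 m2))) \<noteq> b (min m1 m2 + int (nat (k' - min m1 m2)))" using k' by simp
  then have i0: "a (min m1 m2 + int i0) \<noteq> b (min m1 m2 + int i0)" unfolding i0_def by (rule LeastI)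
  define k0 where "k0 = min m1 m2 + int i0"
  have k0: "a k0 \<noteq> b k0" using i0 by (simp add: k0_def)
  have below: "a k = b k" if "k < k0" for k
  proof (rule ccontr)
    assume n: "a k \<noteq> b k"
    then have "min m1 m2 \<le> k" using m by force
    then obtain i where i: "k = min m1 m2 + int i" by (metis zle_iff_zadd)
    then have "i0 \<le> i" unfolding i0_def using n by (intro Least_le) simp
    then show False using that i by (simp add: k0_def)
  qed
  have "(LEAST k. a k \<noteq> b k) = k0" using k0 below by (intro Least_equality) (auto simp: not_less[symmetric])
  then have "padic_dist p a b = real p powr (- real_of_int k0)" using False by (simp add: padic_dist_def)
  moreover have "real p powr (- real_of_int k0) \<le> real p powr real_of_int \<gamma> \<longleftrightarrow> - k0 \<le> \<gamma>"
    using p by (subst powr_le_cancel_iff) auto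
  moreover have "- k0 \<le> \<gamma> \<longleftrightarrow> (\<forall>k < - \<gamma>. a k = b k)"
  proof
    assume "\<forall>k < - \<gamma>. a k = b k"
    then show "- k0 \<le> \<gamma>" using k0 by force
  qed (use below in auto)
  ultimately show ?thesis by simp
qed (simp add: padic_dist_def)

lemma qball_iff:
  assumes p: "2 \<le> p" and n: "0 < n" and x: "x \<in> Qpn p n"
  shows "y \<in> qball p n \<gamma> x \<longleftrightarrow> y \<in> Qpn p n \<and> (\<forall>j<n. \<forall>k < - \<gamma>. y j k = x j k)"
proof (cases "y \<in> Qpn p n")
  case True
  have "Qpn_dist p n y x \<le> real p powr real_of_int \<gamma> \<longleftrightarrow> (\<forall>j<n. padic_dist p (y j) (x j) \<le> real p powr real_of_int \<gamma>)"
    unfolding Qpn_dist_def using n by (subst Max_le_iff) auto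
  also have "\<dots> \<longleftrightarrow> (\<forall>j<n. \<forall>k < - \<gamma>. y j k = x j k)"
    using True x padic_dist_le_iff[OF p] by (simp add: Qpn_def)
  finally show ?thesis using True by (simp add: qball_def)
qed (simp add: qball_def)

text \<open>The digit in front of p^(-(m+1)), as in the inverse of the Monna map. Low p-adic places
  become leading real digits, so agreement at all places below \<open>c\<close> means equality of
  the integer parts of \<open>t * p powr c\<close>.\<close>

definition real_digit :: "nat \<Rightarrow> real \<Rightarrow> int \<Rightarrow> nat" where
  "real_digit p t m = nat (\<lfloor>t * real p powr real_of_int (m + 1)\<rfloor> mod int p)"

text \<open>The base p digits of a nonnegative real, dealt out cyclically to n coordinates. Balls pull
  back to intervals of length p^(n gamma), so the image of Lebesgue measure is Haar measure.\<close>

definition real_to_padic :: "nat \<Rightarrow> nat \<Rightarrow> real \<Rightarrow> nat \<Rightarrow> int \<Rightarrow> nat" where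
  "real_to_padic p n t j k = (if j < n then real_digit p t (int n * k + int j) else 0)"

lemma real_digit_eq:
  assumes p: "2 \<le> p" and t: "0 \<le> t"
  shows "real_digit p t (c - 1 - int i) = nat \<lfloor>t * real p powr real_of_int c\<rfloor> div p ^ i mod p"
proof -
  have "real p powr real_of_int (c - int i) = real p powr real_of_int c / real (p ^ i)"
    using p by (simp add: powr_diff powr_realpow)
  then have "\<lfloor>t * real p powr real_of_int (c - 1 - int i + 1)\<rfloor> = \<lfloor>t * real p powr real_of_int c / real (p ^ i)\<rfloor>"
    by (simp add: algebra_simps)
  also have "\<dots> = \<lfloor>t * real p powr real_of_int c\<rfloor> div int (p ^ i)"
    using floor_divide_real_eq_div[of "int (p ^ i)" "t * real p powr real_of_int c"] by simp
  also have "\<dots> = int (nat \<lfloor>t * real p powr real_of_int c\<rfloor> div p ^ i)"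
    using t by (simp add: zdiv_int)
  finally have "\<lfloor>t * real p powr real_of_int (c - 1 - int i + 1)\<rfloor> = int (nat \<lfloor>t * real p powr real_of_int c\<rfloor> div p ^ i)" .
  then show ?thesis unfolding real_digit_def by (simp flip: zmod_int)
qed

lemma real_to_padic_in:
  assumes p: "2 \<le> p" and t: "0 \<le> t" shows "real_to_padic p n t \<in> Qpn p n"
proof -
  have less: "real_digit p t m < p" for m
    using p unfolding real_digit_def by (simp add: nat_less_iff)
  \<comment> \<open>Chosen such that \<open>t * p powr k0 < 1\<close>, which makes all earlier
    digits vanish. The extra 1 makes \<open>k0\<close> negative, so multiplying a place below
    \<open>k0\<close> by \<open>n\<close> moves it further left.\<close>
  define k0 where "k0 = - (\<lceil>log p (t + 1)\<rceil> + 1)"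
  have k0: "k0 < 0"
  proof -
    have "0 \<le> log p (t + 1)" using p t by (simp add: zero_le_log_cancel_iff)
    then show ?thesis unfolding k0_def by linarith
  qed
  have zero: "real_digit p t m = 0" if m: "m + 1 \<le> k0" for m
  proof -
    have "real p powr real_of_int (m + 1) \<le> real p powr real_of_int k0"
      using p m by (intro powr_mono) auto
    also have "\<dots> \<le> real p powr (- log p (t + 1))"
      using p unfolding k0_def by (intro powr_mono) linarith+
    also have "\<dots> = 1 / (t + 1)" using p t by (simp add: powr_minus_divide)
    finally have "t * real p powr real_of_int (m + 1) \<le> t * (1 / (t + 1))" using t by (intro mult_left_mono)
    also have "\<dots> < 1" using t by simp
    finally have "\<lfloor>t * real p powr real_of_int (m + 1)\<rfloor> = 0" using t by (simp add: floor_eq_iff)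
    then show ?thesis by (simp add: real_digit_def)
  qed
  have "real_to_padic p n t j \<in> padic_digits p" if j: "j < n" for j
    unfolding padic_digits_def
  proof (intro CollectI conjI allI exI[of _ k0] impI)
    fix k
    show "real_to_padic p n t j k < p" using less p by (simp add: real_to_padic_def)
    assume k: "k < k0"
    have "int n * k + int j + 1 \<le> int n * (k + 1)" using j by (simp add: algebra_simps)
    also have "\<dots> \<le> 1 * (k + 1)" using j k k0 by (intro mult_right_mono_neg) auto
    finally show "real_to_padic p n t j k = 0" using zero k by (simp add: real_to_padic_def)
  qed
  then show ?thesis by (auto simp: Qpn_def real_to_padic_def)
qed

text \<open>Membership in the ball prescribes the dealt-out digits at all places below
  \<open>c\<close>, and hence the integer part of \<open>t * p powr c\<close>.\<close>

lemma real_to_padic_preimage: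
  assumes p: "2 \<le> p" and n: "0 < n" and x: "x \<in> Qpn p n"
  shows "\<exists>N::nat. \<forall>t\<ge>0. real_to_padic p n t \<in> qball p n \<gamma> x \<longleftrightarrow>
    real N * real p powr (real n * real_of_int \<gamma>) \<le> t \<and> t < (real N + 1) * real p powr (real n * real_of_int \<gamma>)"
proof -
  \<comment> \<open>The places below \<open>- \<gamma>\<close> of the \<open>n\<close> coordinates
    occupy exactly the places below \<open>c\<close> after dealing, and \<open>X\<close> is the
    interleaved expansion of \<open>x\<close>.\<close>
  define c where "c = - (int n * \<gamma>)"
  define X where "X m = x (nat (m mod int n)) (m div int n)" for m
  have mn: "nat (m mod int n) < n" for m using n by (simp add: nat_less_iff)
  have Xp: "X m < p" for m using x mn by (auto simp: X_def Qpn_def padic_digits_def)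
  have "\<forall>j<n. \<exists>m. \<forall>k<m. x j k = 0" using x by (auto simp: Qpn_def padic_digits_def)
  then obtain mm where mm: "\<And>j k. j < n \<Longrightarrow> k < mm j \<Longrightarrow> x j k = 0" by metis
  define K where "K = Min (mm ` {..<n})"
  have K: "K \<le> mm j" if "j < n" for j using that by (simp add: K_def)
  define m0 where "m0 = int n * K"
  have X0: "X m = 0" if "m < m0" for m
  proof -
    have "m div int n < K"
      using that n unfolding m0_def by (intro int_div_less) auto
    also have "\<dots> \<le> mm (nat (m mod int n))" using mn by (rule K)
    finally show ?thesis unfolding X_def using mm mn by blast
  qed
  obtain N where N: "\<And>i. N div p ^ i mod p = X (c - 1 - int i)"
    using digits_exist[of X p m0 c] Xp X0 by blast
  have "real_to_padic p n t \<in> qball p n \<gamma> x \<longleftrightarrow>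
    real N * real p powr (real n * real_of_int \<gamma>) \<le> t \<and> t < (real N + 1) * real p powr (real n * real_of_int \<gamma>)"
    if t: "0 \<le> t" for t
  proof -
    let ?u = "\<lfloor>t * real p powr real_of_int c\<rfloor>"
    have u0: "0 \<le> ?u" using t by simp
    have "real_to_padic p n t \<in> qball p n \<gamma> x \<longleftrightarrow> (\<forall>j<n. \<forall>k < - \<gamma>. real_digit p t (int n * k + int j) = x j k)"
      using real_to_padic_in[OF p t] by (simp add: qball_iff[OF p n x] real_to_padic_def)
    also have "\<dots> \<longleftrightarrow> (\<forall>m<c. real_digit p t m = X m)"
    proof safe
      fix m assume *: "\<forall>j<n. \<forall>k < - \<gamma>. real_digit p t (int n * k + int j) = x j k" and m: "m < c"
      have "m div int n < - \<gamma>" using m n unfolding c_def by (intro int_div_less) auto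
      then have "real_digit p t (int n * (m div int n) + int (nat (m mod int n))) = X m"
        using * mn unfolding X_def by blast
      then show "real_digit p t m = X m" using n by simp
    next
      fix j k assume *: "\<forall>m<c. real_digit p t m = X m" and j: "j < n" and k: "k < - \<gamma>"
      have "int n * k + int j < int n * (k + 1)" using j by (simp add: algebra_simps)
      also have "\<dots> \<le> int n * (- \<gamma>)" using k by (intro mult_left_mono) auto
      finally have "int n * k + int j < c" by (simp add: c_def)
      then have "real_digit p t (int n * k + int j) = X (int n * k + int j)" using * by blast
      also have "\<dots> = x j k" using j by (simp add: X_def)
      finally show "real_digit p t (int n * k + int j) = x j k" .
    qed
    also have "\<dots> \<longleftrightarrow> (\<forall>i. real_digit p t (c - 1 - int i) = X (c - 1 - int i))"
    proof safe
      fix m assume *: "\<forall>i. real_digit p t (c - 1 - int i) = X (c - 1 - int i)" and m: "m < c"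
      from *[rule_format, of "nat (c - 1 - m)"] m show "real_digit p t m = X m" by simp
    qed auto
    also have "\<dots> \<longleftrightarrow> nat ?u = N"
      unfolding real_digit_eq[OF p t] N[symmetric] using digits_unique[OF p] by blast
    also have "\<dots> \<longleftrightarrow> ?u = int N" using u0 by auto
    also have "\<dots> \<longleftrightarrow> real N \<le> t * real p powr real_of_int c \<and> t * real p powr real_of_int c < real N + 1"
      by (simp add: floor_eq_iff)
    also have "real p powr real_of_int c = 1 / real p powr (real n * real_of_int \<gamma>)"
      by (simp add: c_def powr_minus_divide)
    finally show ?thesis using p by (simp add: pos_le_divide_eq pos_divide_less_eq)
  qed
  then show ?thesis by blast
qed

section \<open>Haar measure as an image of Lebesgue measure\<close>

lemma haar_exists:
  assumes p: "2 \<le> p" and n: "0 < n"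
  shows "\<exists>M. space M = Qpn p n \<and>
      sets M = sigma_sets (Qpn p n) {qball p n \<gamma> x | \<gamma> x. x \<in> Qpn p n} \<and>
      (\<forall>\<gamma> x. x \<in> Qpn p n \<longrightarrow> emeasure M (qball p n \<gamma> x) = ennreal (real p powr (real n * real_of_int \<gamma>)))"
proof -
  let ?G = "{qball p n \<gamma> x | \<gamma> x. x \<in> Qpn p n}"
  let ?L = "restrict_space lborel {0::real..}"
  let ?S = "sigma (Qpn p n) ?G"
  have G: "?G \<subseteq> Pow (Qpn p n)" by (auto simp: qball_def)
  have pre: "\<exists>N::nat. real_to_padic p n -` qball p n \<gamma> x \<inter> {0..} =
      {real N * real p powr (real n * real_of_int \<gamma>) ..< (real N + 1) * real p powr (real n * real_of_int \<gamma>)}"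
    if x: "x \<in> Qpn p n" for \<gamma> x
  proof -
    obtain N :: nat where N: "\<And>t. 0 \<le> t \<Longrightarrow> real_to_padic p n t \<in> qball p n \<gamma> x \<longleftrightarrow>
      real N * real p powr (real n * real_of_int \<gamma>) \<le> t \<and> t < (real N + 1) * real p powr (real n * real_of_int \<gamma>)"
      using real_to_padic_preimage[OF p n x] by blast
    have "0 \<le> t" if "real N * real p powr (real n * real_of_int \<gamma>) \<le> t" for t
      using that by (rule order_trans[rotated]) simp
    then show ?thesis using N by (intro exI[of _ N]) auto
  qed
  have meas: "real_to_padic p n \<in> measurable ?L ?S"
  proof (rule measurable_sigma_sets)
    show "sets ?S = sigma_sets (Qpn p n) ?G" using G by (rule sets_measure_of)
    show "real_to_padic p n \<in> space ?L \<rightarrow> Qpn p n" using real_to_padic_in[OF p] by (auto simp: space_restrict_space)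
    fix A assume "A \<in> ?G"
    then obtain \<gamma> x where A: "A = qball p n \<gamma> x" "x \<in> Qpn p n" by blast
    obtain N :: nat where N: "real_to_padic p n -` A \<inter> {0..} =
      {real N * real p powr (real n * real_of_int \<gamma>) ..< (real N + 1) * real p powr (real n * real_of_int \<gamma>)}"
      using pre[OF A(2)] A(1) by blast
    have "real_to_padic p n -` A \<inter> {0..} \<in> sets ?L"
    proof (subst sets_restrict_space_iff)
      show "real_to_padic p n -` A \<inter> {0..} \<subseteq> {0..} \<and> real_to_padic p n -` A \<inter> {0..} \<in> sets lborel"
        by (rule conjI, blast, unfold N, simp)
    qed simp
    then show "real_to_padic p n -` A \<inter> space ?L \<in> sets ?L" by (simp add: space_restrict_space)
  qed (rule G)
  show ?thesis
  proof (intro exI[of _ "distr ?L ?S (real_to_padic p n)"] conjI allI impI)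
    show "space (distr ?L ?S (real_to_padic p n)) = Qpn p n" using G by (simp add: space_measure_of)
    show "sets (distr ?L ?S (real_to_padic p n)) = sigma_sets (Qpn p n) ?G" using G by (simp add: sets_measure_of)
    fix \<gamma> x assume x: "x \<in> Qpn p n"
    obtain N :: nat where N: "real_to_padic p n -` qball p n \<gamma> x \<inter> {0..} =
      {real N * real p powr (real n * real_of_int \<gamma>) ..< (real N + 1) * real p powr (real n * real_of_int \<gamma>)}"
      using pre[OF x] by blast
    have "qball p n \<gamma> x \<in> sets ?S" using G x by (auto simp: sets_measure_of)
    then have "emeasure (distr ?L ?S (real_to_padic p n)) (qball p n \<gamma> x) = emeasure ?L (real_to_padic p n -` qball p n \<gamma> x \<inter> {0..})"
      using meas by (simp add: emeasure_distr space_restrict_space)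
    also have "\<dots> = emeasure lborel (real_to_padic p n -` qball p n \<gamma> x \<inter> {0..})"
      by (rule emeasure_restrict_space) auto
    also have "\<dots> = ennreal (real p powr (real n * real_of_int \<gamma>))"
      unfolding N by (simp add: mult_right_mono algebra_simps)
    finally show "emeasure (distr ?L ?S (real_to_padic p n)) (qball p n \<gamma> x) = ennreal (real p powr (real n * real_of_int \<gamma>))" .
  qed
qed

lemma haar_spec:
  assumes p: "2 \<le> p" and n: "0 < n"
  shows "space (haar p n) = Qpn p n"
    "sets (haar p n) = sigma_sets (Qpn p n) {qball p n \<gamma> x | \<gamma> x. x \<in> Qpn p n}"
    "x \<in> Qpn p n \<Longrightarrow> emeasure (haar p n) (qball p n \<gamma> x) = ennreal (real p powr (real n * real_of_int \<gamma>))"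
  using someI_ex[OF haar_exists[OF p n]] unfolding haar_def[symmetric] by blast+

lemma ball_space_haar:
  assumes p: "2 \<le> p" and n: "0 < n"
  shows "ball_space (haar p n) (qball p n) (real p powr real n) (\<lambda>_ _. 0)"
proof -
  note H = haar_spec[OF p n] and Q = qball_iff[OF p n]
  have zero: "(\<lambda>_ _. 0) \<in> Qpn p n" using p by (auto simp: Qpn_def padic_digits_def)
  have eq: "qball p n \<gamma> y = qball p n \<gamma> x" if "x \<in> Qpn p n" "y \<in> qball p n \<gamma> x" for \<gamma> x y
  proof -
    have "y \<in> Qpn p n" using that by (simp add: qball_def)
    then show ?thesis using that Q by auto
  qed
  show ?thesis
  proof (unfold_locales, unfold H(1))
    have "2 powr 1 \<le> real p powr 1" using p by simp
    also have "\<dots> \<le> real p powr real n" using p n by (intro powr_mono) auto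
    finally show "2 \<le> real p powr real n" by simp
    show "qball p n \<gamma> x \<in> sets (haar p n)" if "x \<in> Qpn p n" for \<gamma> x
      using that unfolding H(2) by (intro sigma_sets.Basic) auto
    show "emeasure (haar p n) (qball p n \<gamma> x) = ennreal ((real p powr real n) powr real_of_int \<gamma>)" if "x \<in> Qpn p n" for \<gamma> x
      using H(3)[OF that] by (simp add: powr_powr)
    show "x \<in> qball p n \<gamma> x" if "x \<in> Qpn p n" for \<gamma> x using that Q by simp
    show "qball p n \<gamma> y = qball p n \<gamma> x" if "x \<in> Qpn p n" "y \<in> qball p n \<gamma> x" for \<gamma> x y
      using eq that .
    show "qball p n \<gamma> x \<subseteq> qball p n \<delta> x" if "x \<in> Qpn p n" "\<gamma> \<le> \<delta>" for \<gamma> \<delta> x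
      using that Q by auto
    show "(\<lambda>_ _. 0) \<in> Qpn p n" by (rule zero)
    show "\<exists>\<gamma>. x \<in> qball p n \<gamma> (\<lambda>_ _. 0)" if x: "x \<in> Qpn p n" for x
    proof -
      have "\<forall>j<n. \<exists>m. \<forall>k<m. x j k = 0" using x by (auto simp: Qpn_def padic_digits_def)
      then obtain mm where mm: "\<And>j k. j < n \<Longrightarrow> k < mm j \<Longrightarrow> x j k = 0" by metis
      define K where "K = Min (mm ` {..<n})"
      have "K \<le> mm j" if "j < n" for j using that by (simp add: K_def)
      then have "x j k = 0" if "j < n" "k < K" for j k using mm that by (meson less_le_trans)
      then have "x \<in> qball p n (- K) (\<lambda>_ _. 0)" using x Q[OF zero] by simp
      then show ?thesis by blast
    qed
    show "countable (qball p n \<gamma> ` Qpn p n)" for \<gamma>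
    proof (rule countable_subset)
      \<comment> \<open>Balls of this scale pull back to intervals whose left end points are
        multiples of their length; the images of these points meet every ball.\<close>
      let ?y = "\<lambda>N::nat. real_to_padic p n (real N * real p powr (real n * real_of_int \<gamma>))"
      show "qball p n \<gamma> ` Qpn p n \<subseteq> range (\<lambda>N. qball p n \<gamma> (?y N))"
      proof
        fix A assume "A \<in> qball p n \<gamma> ` Qpn p n"
        then obtain x where A: "A = qball p n \<gamma> x" and x: "x \<in> Qpn p n" by blast
        obtain N :: nat where N: "\<And>t. 0 \<le> t \<Longrightarrow> real_to_padic p n t \<in> qball p n \<gamma> x \<longleftrightarrow>
          real N * real p powr (real n * real_of_int \<gamma>) \<le> t \<and> t < (real N + 1) * real p powr (real n * real_of_int \<gamma>)"
          using real_to_padic_preimage[OF p n x] by blast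
        have "?y N \<in> qball p n \<gamma> x" using p by (subst N) auto
        then have "A = qball p n \<gamma> (?y N)" using eq[OF x] A by simp
        then show "A \<in> range (\<lambda>N. qball p n \<gamma> (?y N))" by blast
      qed
    qed simp
    show "sets (haar p n) = sigma_sets (Qpn p n) {qball p n \<gamma> x |\<gamma> x. x \<in> Qpn p n}" by (rule H(2))
  qed
qed

section \<open>Luxemburg norms and admissible exponents\<close>

lemma var_norm_upper:
  "0 < \<eta> \<Longrightarrow> var_modular M q F \<eta> \<le> 1 \<Longrightarrow> var_norm M q F \<le> ennreal \<eta>"
  unfolding var_norm_def by (rule INF_lower) simp

text \<open>For exponents at least 1, dividing by \<open>K \<ge> 1\<close> lowers the integrand by
  at least the factor \<open>K\<close>. The measurable majorant \<open>W\<close> allows pulling that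
  factor out of the integral.\<close>

lemma var_norm_upper_scaled:
  assumes \<eta>: "0 < \<eta>" and K: "1 \<le> K" and q: "AE x in M. 1 \<le> q x"
    and [measurable]: "W \<in> borel_measurable M" and W: "(\<integral>\<^sup>+x. W x \<partial>M) \<le> ennreal K"
    and le: "AE x in M. (if F x = \<top> then \<top> else ennreal ((enn2real (F x) / \<eta>) powr q x)) \<le> W x"
  shows "var_norm M q F \<le> ennreal (K * \<eta>)"
proof (rule var_norm_upper)
  have "var_modular M q F (K * \<eta>) \<le> (\<integral>\<^sup>+x. ennreal (1 / K) * W x \<partial>M)"
    unfolding var_modular_def
  proof (rule nn_integral_mono_AE, use q le in eventually_elim)
    fix x assume q: "1 \<le> q x" and le: "(if F x = \<top> then \<top> else ennreal ((enn2real (F x) / \<eta>) powr q x)) \<le> W x"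
    show "(if F x = \<top> then \<top> else ennreal ((enn2real (F x) / (K * \<eta>)) powr q x)) \<le> ennreal (1 / K) * W x"
    proof (cases "F x = \<top>")
      case True
      then have "W x = \<top>" using le by (simp add: top_unique)
      then show ?thesis using K by (simp add: ennreal_mult_top)
    next
      case False
      let ?a = "enn2real (F x) / \<eta>"
      have a0: "0 \<le> ?a" using \<eta> by simp
      have "(enn2real (F x) / (K * \<eta>)) powr q x = (?a / K) powr q x" by (simp add: mult.commute)
      also have "\<dots> = ?a powr q x / K powr q x" by (rule powr_divide)
      also have "\<dots> \<le> ?a powr q x / K"
        using powr_mono[of 1 "q x" K] q K by (intro divide_left_mono) auto
      finally have "ennreal ((enn2real (F x) / (K * \<eta>)) powr q x) \<le> ennreal (1 / K * ?a powr q x)"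
        by (intro ennreal_leI) simp
      also have "\<dots> = ennreal (1 / K) * ennreal (?a powr q x)" using K by (intro ennreal_mult) auto
      also have "\<dots> \<le> ennreal (1 / K) * W x" using le False by (intro mult_left_mono) auto
      finally show ?thesis using False by simp
    qed
  qed
  also have "\<dots> = ennreal (1 / K) * (\<integral>\<^sup>+x. W x \<partial>M)" by (rule nn_integral_cmult) simp
  also have "\<dots> \<le> ennreal (1 / K) * ennreal K" by (intro mult_left_mono W) simp
  also have "\<dots> = 1" using K by (simp flip: ennreal_mult)
  finally show "var_modular M q F (K * \<eta>) \<le> 1" .
qed (use \<eta> K in simp)

text \<open>The infimum on the right is handled by testing each admissible \<open>\<eta>\<close>; if
  there is none, the right side is infinite.\<close>

lemma var_norm_transfer:
  assumes K: "0 < K" and le: "\<And>\<eta>. 0 < \<eta> \<Longrightarrow> var_modular M r G \<eta> \<le> 1 \<Longrightarrow> var_norm N q F \<le> ennreal (K * \<eta>)"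
  shows "var_norm N q F \<le> ennreal K * var_norm M r G"
proof -
  let ?X = "var_norm N q F"
  have "ennreal (1 / K) * ?X \<le> var_norm M r G"
    unfolding var_norm_def[of M]
  proof (rule INF_greatest)
    fix \<eta> assume "\<eta> \<in> {\<eta>. 0 < \<eta> \<and> var_modular M r G \<eta> \<le> 1}"
    then have \<eta>: "0 < \<eta>" "?X \<le> ennreal (K * \<eta>)" using le by auto
    have "ennreal (1 / K) * ?X \<le> ennreal (1 / K) * ennreal (K * \<eta>)" by (intro mult_left_mono \<eta>) simp
    also have "\<dots> = ennreal \<eta>" using K \<eta> by (simp flip: ennreal_mult)
    finally show "ennreal (1 / K) * ?X \<le> ennreal \<eta>" .
  qed
  then have "ennreal K * (ennreal (1 / K) * ?X) \<le> ennreal K * var_norm M r G" by (intro mult_left_mono) auto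
  moreover have "ennreal K * (ennreal (1 / K) * ?X) = ?X"
    using K by (simp add: mult.assoc[symmetric] flip: ennreal_mult)
  ultimately show ?thesis by simp
qed

lemma var_modular_real:
  assumes "\<And>x. x \<in> space M \<Longrightarrow> 0 \<le> f x"
  shows "var_modular M q (\<lambda>x. ennreal (f x)) \<eta> = (\<integral>\<^sup>+x. ennreal ((f x / \<eta>) powr q x) \<partial>M)"
  unfolding var_modular_def using assms by (intro nn_integral_cong) auto

lemma var_modular_indicator:
  "var_modular M q (\<lambda>x. ennreal (indicator E x)) \<eta> = (\<integral>\<^sup>+x\<in>E. ennreal ((1 / \<eta>) powr q x) \<partial>M)"
  by (subst var_modular_real) (auto intro!: nn_integral_cong simp: indicator_def)

locale padic_space =
  fixes p n :: nat
  assumes p2: "2 \<le> p" and n0: "0 < n"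

sublocale padic_space \<subseteq> ball_space "haar p n" "qball p n" "real p powr real n" "\<lambda>_ _. 0"
  by (rule ball_space_haar[OF p2 n0])

context padic_space begin

abbreviation (input) H where "H \<equiv> haar p n"

lemma space_haar: "space H = Qpn p n"
  by (rule haar_spec(1)[OF p2 n0])

lemma ball_powr: "(real p powr real n) powr real_of_int \<gamma> = real p powr (real n * real_of_int \<gamma>)"
  by (simp add: powr_powr)

lemma ball_avg_eq: "x \<in> Qpn p n \<Longrightarrow> ball_avg p n f \<gamma> x = avg \<gamma> f x"
  by (simp add: ball_avg_def avg_def measure_ball space_haar)

lemma loc_int_iff: "loc_int f \<longleftrightarrow> loc_integrable p n f"
  by (auto simp: loc_int_def loc_integrable_def space_haar)

lemma BMO_iff: "b \<in> BMO p n \<longleftrightarrow> (\<exists>D. bmo b D)"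
  unfolding BMO_def bmo_def loc_int_iff space_haar
  by (auto simp: avg_def ball_avg_eq measure_ball space_haar)

lemma max_comm_eq: "max_comm p n \<alpha> b f x = (SUP \<gamma>. comm (\<alpha> / real n) b (\<lambda>y. \<bar>f y\<bar>) \<gamma> x)"
  by (simp add: max_comm_def comm_def ball_powr)

section \<open>From the logarithmic conditions to quantitative bounds\<close>

lemma AE_ball_ex:
  assumes "z \<in> space H" "AE y in H. y \<in> qball p n \<gamma> z \<longrightarrow> Q y"
  shows "\<exists>y\<in>qball p n \<gamma> z. Q y"
proof (rule ccontr)
  assume "\<not> ?thesis"
  with assms(2) have "AE y in H. y \<notin> qball p n \<gamma> z" by (auto elim!: eventually_mono)
  then have "emeasure H (qball p n \<gamma> z) = 0"
    using assms(1) ball_sets by (subst (asm) AE_iff_measurable[OF _ refl]) (auto simp: ball_subset_space Int_absorb1 Collect_conj_eq)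
  then show False using emeasure_ball[OF assms(1), of \<gamma>] p2 by simp
qed

text \<open>The next larger ball has strictly larger measure. This permits choosing points that tend
  to infinity and avoid a given null set.\<close>

lemma AE_far_ex:
  assumes G: "AE x in H. G x"
  shows "\<exists>x\<in>space H. G x \<and> x \<notin> qball p n \<gamma> (\<lambda>_ _. 0)"
proof (rule ccontr)
  assume n: "\<not> ?thesis"
  have "AE x in H. x \<in> space H" by simp
  with G have "AE x in H. x \<in> qball p n \<gamma> (\<lambda>_ _. 0)"
    by eventually_elim (use n in blast)
  then have "emeasure H (qball p n (\<gamma> + 1) (\<lambda>_ _. 0)) \<le> emeasure H (qball p n \<gamma> (\<lambda>_ _. 0))"
    using ball_sets[OF org_space] by (intro emeasure_mono_AE) auto
  then have "(real p powr real n) powr (\<gamma> + 1) \<le> (real p powr real n) powr \<gamma>"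
    by (simp add: emeasure_ball org_space)
  then show False using P_pos(4) by (subst (asm) powr_le_cancel_iff) auto
qed

lemma ess_on_AE:
  assumes "A \<in> sets H"
  shows "AE y in H. y \<in> A \<longrightarrow> ereal (r y) \<le> ess_sup_on H A r"
    "AE y in H. y \<in> A \<longrightarrow> ess_inf_on H A r \<le> ereal (r y)"
proof -
  have A: "A \<inter> space H \<in> sets H" using assms by auto
  show "AE y in H. y \<in> A \<longrightarrow> ereal (r y) \<le> ess_sup_on H A r"
    using esssup_AE[of "\<lambda>x. ereal (r x)" "restrict_space H A"] unfolding AE_restrict_space_iff[OF A] ess_sup_on_def .
  have "AE y in H. y \<in> A \<longrightarrow> - ereal (r y) \<le> esssup (restrict_space H A) (\<lambda>x. - ereal (r x))"
    using esssup_AE[of "\<lambda>x. - ereal (r x)" "restrict_space H A"] unfolding AE_restrict_space_iff[OF A] .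
  then show "AE y in H. y \<in> A \<longrightarrow> ess_inf_on H A r \<le> ereal (r y)"
    unfolding ess_inf_on_def by eventually_elim (use ereal_uminus_le_reorder in auto)
qed

lemma ess_on_bounds:
  assumes [measurable]: "r \<in> borel_measurable H" and A: "A \<in> sets H"
    and b: "AE y in H. y \<in> A \<longrightarrow> lo \<le> r y \<and> r y \<le> hi"
  shows "ess_sup_on H A r \<le> ereal hi" "ereal lo \<le> ess_inf_on H A r"
proof -
  have A': "A \<inter> space H \<in> sets H" using A by auto
  have m: "r \<in> borel_measurable (restrict_space H A)" by (rule measurable_restrict_space1) simp
  show "ess_sup_on H A r \<le> ereal hi"
    unfolding ess_sup_on_def using m b by (intro esssup_I) (auto simp: AE_restrict_space_iff[OF A'] elim!: eventually_mono)
  have "esssup (restrict_space H A) (\<lambda>x. - ereal (r x)) \<le> ereal (- lo)"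
    using m b by (intro esssup_I) (auto simp: AE_restrict_space_iff[OF A'] elim!: eventually_mono)
  then show "ereal lo \<le> ess_inf_on H A r"
    unfolding ess_inf_on_def ereal_minus_le_minus[symmetric, of _ "ereal (- lo)"] by simp
qed

text \<open>The number \<open>u\<close> is the essential infimum over the ball. For negative
  \<open>\<gamma>\<close> the condition bounds \<open>- \<gamma>\<close> times the width of the
  essential range.\<close>

lemma Clog0_local:
  assumes r: "r \<in> borel_measurable H" and b: "AE y in H. lo \<le> r y \<and> r y \<le> hi" and c: "r \<in> Clog0 p n"
  shows "\<exists>C\<ge>0. \<forall>\<gamma><0. \<forall>z\<in>space H. \<exists>u. lo \<le> u \<and> u \<le> hi \<and>
    (AE y in H. y \<in> qball p n \<gamma> z \<longrightarrow> u \<le> r y \<and> - real_of_int \<gamma> * (r y - u) \<le> C)"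
proof -
  obtain C where C: "\<And>\<gamma> x. x \<in> Qpn p n \<Longrightarrow> ereal (real_of_int \<gamma>) *
    (ess_inf_on H (qball p n \<gamma> x) r - ess_sup_on H (qball p n \<gamma> x) r) \<le> ereal C"
    using c unfolding Clog0_def by blast
  have "\<exists>u. lo \<le> u \<and> u \<le> hi \<and> (AE y in H. y \<in> qball p n \<gamma> z \<longrightarrow> u \<le> r y \<and> - real_of_int \<gamma> * (r y - u) \<le> max C 0)"
    if g: "\<gamma> < 0" and z: "z \<in> space H" for \<gamma> z
  proof -
    let ?A = "qball p n \<gamma> z"
    let ?I = "ess_inf_on H ?A r" and ?S = "ess_sup_on H ?A r"
    have A: "?A \<in> sets H" using z by (rule ball_sets)
    have b': "AE y in H. y \<in> ?A \<longrightarrow> lo \<le> r y \<and> r y \<le> hi" using b by eventually_elim simp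
    note bd = ess_on_bounds[OF r A b']
    have "AE y in H. y \<in> ?A \<longrightarrow> ?I \<le> ereal (r y) \<and> ereal (r y) \<le> ?S \<and> r y \<le> hi"
      using ess_on_AE[OF A, of r] b by eventually_elim simp
    \<comment> \<open>A single point at which all the almost sure bounds hold shows that both
      essential bounds are real numbers.\<close>
    from AE_ball_ex[OF z this] obtain y where y: "?I \<le> ereal (r y)" "ereal (r y) \<le> ?S" "r y \<le> hi" by blast
    obtain i where i: "?I = ereal i" using bd(2) y(1) by (cases ?I) auto
    obtain s where s: "?S = ereal s" using bd(1) y(2) by (cases ?S) auto
    have width: "real_of_int \<gamma> * (i - s) \<le> C" using C[of z \<gamma>] z by (simp add: i s space_haar)
    have "AE y in H. y \<in> ?A \<longrightarrow> i \<le> r y \<and> - real_of_int \<gamma> * (r y - i) \<le> max C 0"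
      using ess_on_AE[OF A, of r]
    proof eventually_elim
      fix y assume y: "y \<in> ?A \<longrightarrow> ereal (r y) \<le> ?S" "y \<in> ?A \<longrightarrow> ?I \<le> ereal (r y)"
      show "y \<in> ?A \<longrightarrow> i \<le> r y \<and> - real_of_int \<gamma> * (r y - i) \<le> max C 0"
      proof
        assume "y \<in> ?A"
        then have ry: "i \<le> r y" "r y \<le> s" using y by (auto simp: i s)
        have "- real_of_int \<gamma> * (r y - i) \<le> - real_of_int \<gamma> * (s - i)" using ry g by (intro mult_left_mono) auto
        also have "\<dots> = real_of_int \<gamma> * (i - s)" by (simp add: algebra_simps)
        finally show "i \<le> r y \<and> - real_of_int \<gamma> * (r y - i) \<le> max C 0" using width ry by linarith
      qed
    qed
    moreover have "lo \<le> i" "i \<le> hi" using bd(2) y by (auto simp: i)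
    ultimately show ?thesis by blast
  qed
  then show ?thesis by (intro exI[of _ "max C 0"]) auto
qed

lemma ball_org_iff: "x \<in> Qpn p n \<Longrightarrow> x \<in> qball p n \<gamma> (\<lambda>_ _. 0) \<longleftrightarrow> Qpn_norm p n x \<le> real p powr real_of_int \<gamma>"
  by (simp add: qball_def Qpn_norm_def)

text \<open>The condition makes the values along a sequence going to infinity Cauchy. The sequence
  is a parameter so that r and q can use the same one. A point of level k > 0 has norm above
  p^(k-1), so k - 1 is at most the logarithm in the condition; as that is at least 1, k is at most
  twice it.\<close>

lemma ClogInf_limit:
  assumes c: "r \<in> ClogInf p n"
    and y: "\<And>k. y k \<in> Qpn p n" "\<And>k. y k \<notin> qball p n (int k) (\<lambda>_ _. 0)"
  shows "\<exists>ri C. 0 \<le> C \<and> (\<lambda>k. r (y k)) \<longlonglongrightarrow> ri \<and> (\<forall>x\<in>Qpn p n. \<bar>r x - ri\<bar> * real (level x) \<le> C)"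
proof -
  obtain C0 where C0: "\<And>x y. x \<in> Qpn p n \<Longrightarrow> y \<in> Qpn p n \<Longrightarrow>
    \<bar>r x - r y\<bar> \<le> C0 / log (real p) (real p + min (Qpn_norm p n x) (Qpn_norm p n y))"
    using c unfolding ClogInf_def by blast
  define C where "C = max C0 0"
  have p1: "1 < real p" using p2 by simp
  have bound: "\<bar>r x - r z\<bar> * real k \<le> 2 * C"
    if x: "x \<in> Qpn p n" "z \<in> Qpn p n" and k: "k = 0 \<or> real p powr (real k - 1) \<le> min (Qpn_norm p n x) (Qpn_norm p n z)" and nn: "0 \<le> min (Qpn_norm p n x) (Qpn_norm p n z)" for x z k
  proof (cases "k = 0")
    case False
    let ?m = "min (Qpn_norm p n x) (Qpn_norm p n z)"
    let ?L = "log (real p) (real p + ?m)"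
    have L1: "1 \<le> ?L"
    proof -
      have "log (real p) (real p) \<le> ?L" using p1 nn by (subst log_le_cancel_iff) auto
      then show ?thesis using p1 by simp
    qed
    have Lk: "real k - 1 \<le> ?L"
    proof -
      have "real p powr (real k - 1) \<le> real p + ?m" using k False p1 by linarith
      then show ?thesis using p1 nn by (subst le_log_iff) auto
    qed
    have kL: "real k \<le> 2 * ?L" using L1 Lk by linarith
    have "\<bar>r x - r z\<bar> \<le> C0 / ?L" by (rule C0[OF x])
    also have "\<dots> \<le> C / ?L" using L1 by (intro divide_right_mono) (auto simp: C_def)
    finally have "\<bar>r x - r z\<bar> * real k \<le> C / ?L * (2 * ?L)"
      using kL L1 by (intro mult_mono) (auto simp: C_def)
    also have "\<dots> = 2 * C" using L1 by simp
    finally show ?thesis .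
  qed (simp add: C_def)
  have norm_pos: "0 \<le> Qpn_norm p n x" for x
  proof -
    have "padic_dist p (x 0) ((\<lambda>_ _. 0) 0) \<le> Qpn_dist p n x (\<lambda>_ _. 0)"
      unfolding Qpn_dist_def using n0 by (intro Max_ge) auto
    moreover have "0 \<le> padic_dist p (x 0) ((\<lambda>_ _. 0) 0)" by (simp add: padic_dist_def)
    ultimately show ?thesis unfolding Qpn_norm_def by linarith
  qed
  have yn: "real p powr real k < Qpn_norm p n (y k)" for k
    using y(2)[of k] ball_org_iff[OF y(1)] by (simp add: not_le)
  have mono: "real p powr (real k - 1) \<le> real p powr real l" if "k \<le> Suc l" for k l
    using that p1 by (intro powr_mono) auto
  have yy: "\<bar>r (y i) - r (y j)\<bar> * real k \<le> 2 * C" if "k \<le> i" "k \<le> j" for i j k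
  proof (rule bound[OF y(1) y(1)])
    show "k = 0 \<or> real p powr (real k - 1) \<le> min (Qpn_norm p n (y i)) (Qpn_norm p n (y j))"
      using mono[of k i] mono[of k j] yn[of i] yn[of j] that by auto
  qed (use norm_pos in auto)
  have "Cauchy (\<lambda>k. r (y k))"
  proof (rule metric_CauchyI)
    fix e :: real assume e: "0 < e"
    obtain k where k: "2 * C / e < real k" using reals_Archimedean2 by blast
    have k0: "0 < real k" using k e by (intro le_less_trans[OF _ k]) (auto simp: C_def)
    have "dist (r (y i)) (r (y j)) < e" if "k \<le> i" "k \<le> j" for i j
    proof -
      have "\<bar>r (y i) - r (y j)\<bar> * real k < e * real k"
        using yy[OF that] k e by (simp add: pos_divide_less_eq mult.commute)
      then show ?thesis using k0 by (simp add: dist_real_def)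
    qed
    then show "\<exists>M. \<forall>m\<ge>M. \<forall>n\<ge>M. dist (r (y m)) (r (y n)) < e" by blast
  qed
  then obtain ri where ri: "(\<lambda>k. r (y k)) \<longlonglongrightarrow> ri" using Cauchy_convergent_iff convergent_def by blast
  have "\<bar>r x - ri\<bar> * real (level x) \<le> 2 * C" if x: "x \<in> Qpn p n" for x
  proof -
    let ?m = "level x"
    have up: "Qpn_norm p n x \<le> real p powr real ?m"
      using in_level_ball[of x] x ball_org_iff[OF x, of "int ?m"] by (simp add: space_haar)
    have low: "?m = 0 \<or> real p powr (real ?m - 1) \<le> Qpn_norm p n x"
    proof (cases "?m = 0")
      case False
      then have "x \<notin> qball p n (int (?m - 1)) (\<lambda>_ _. 0)"
        using not_less_Least[of "?m - 1" "\<lambda>k. x \<in> qball p n (int k) (\<lambda>_ _. 0)"] by (simp add: level_def)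
      then show ?thesis using ball_org_iff[OF x, of "int (?m - 1)"] False by (simp add: of_nat_diff)
    qed simp
    have "\<bar>r x - r (y k)\<bar> * real ?m \<le> 2 * C" if k: "?m \<le> k" for k
    proof (rule bound[OF x y(1)])
      show "?m = 0 \<or> real p powr (real ?m - 1) \<le> min (Qpn_norm p n x) (Qpn_norm p n (y k))"
        using low mono[of ?m k] yn[of k] k by auto
    qed (use norm_pos in auto)
    moreover have "(\<lambda>k. \<bar>r x - r (y k)\<bar> * real ?m) \<longlonglongrightarrow> \<bar>r x - ri\<bar> * real ?m" by (intro tendsto_intros ri)
    ultimately show ?thesis by (intro LIMSEQ_le_const2) blast+
  qed
  then show ?thesis using ri by (intro exI[of _ ri] exI[of _ "2 * C"]) (auto simp: C_def)
qed

text \<open>Measurability and bounds of q are derived from the relation with r. The bound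
  \<open>hi * (\<alpha> / n) < 1\<close> keeps 1 / q away from 0.\<close>

lemma adm_pair_exponents:
  assumes a: "adm_pair p n \<alpha> r q" and \<alpha>: "0 < \<alpha>" "\<alpha> < real n"
  shows "\<exists>lo hi ri C hi' qi C'. 1 < lo \<and> log_exponent r lo hi ri C \<and> log_exponent q lo hi' qi C' \<and>
    (AE x in H. 1 / q x = 1 / r x - \<alpha> / real n) \<and> 1 / qi = 1 / ri - \<alpha> / real n \<and> hi * (\<alpha> / real n) < 1"
proof -
  let ?\<beta> = "\<alpha> / real n"
  have \<beta>: "0 < ?\<beta>" using \<alpha> by simp
  have r [measurable]: "r \<in> borel_measurable H" and ess: "1 < ess_inf_on H (Qpn p n) r" "ess_sup_on H (Qpn p n) r < ereal (real n / \<alpha>)"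
    and cl: "r \<in> Clog p n" "q \<in> Clog p n" and eq: "\<And>x. x \<in> Qpn p n \<Longrightarrow> 1 / q x = 1 / r x - ?\<beta>"
    using a by (auto simp: adm_pair_def exp_P_def)
  \<comment> \<open>Essential bounds are extended reals; real numbers strictly between them and 1,
    respectively n / \<alpha>, leave room on both sides.\<close>
  obtain lo where lo: "1 < ereal lo" "ereal lo < ess_inf_on H (Qpn p n) r" using ereal_dense2[OF ess(1)] by blast
  obtain hi where hi: "ess_sup_on H (Qpn p n) r < ereal hi" "ereal hi < ereal (real n / \<alpha>)" using ereal_dense2[OF ess(2)] by blast
  have lo1: "1 < lo" using lo(1) by (simp add: one_ereal_def)
  have hb: "hi * ?\<beta> < 1" using hi(2) \<alpha> by (simp add: field_simps)
  have S: "Qpn p n \<in> sets H" using sets.top[of H] by (simp add: space_haar)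
  have "AE x in H. x \<in> space H" by simp
  with ess_on_AE[OF S, of r] have rb: "AE x in H. lo \<le> r x \<and> r x \<le> hi"
  proof eventually_elim
    fix x assume "x \<in> Qpn p n \<longrightarrow> ereal (r x) \<le> ess_sup_on H (Qpn p n) r" "x \<in> Qpn p n \<longrightarrow> ess_inf_on H (Qpn p n) r \<le> ereal (r x)" "x \<in> space H"
    then have "ereal (r x) \<le> ess_sup_on H (Qpn p n) r" "ess_inf_on H (Qpn p n) r \<le> ereal (r x)"
      by (auto simp: space_haar)
    from le_less_trans[OF this(1) hi(1)] less_le_trans[OF lo(2) this(2)]
    show "lo \<le> r x \<and> r x \<le> hi" by simp
  qed
  obtain x0 where x0: "lo \<le> r x0 \<and> r x0 \<le> hi" using AE_far_ex[OF rb] by blast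
  then have hi1: "1 < hi" using lo1 by simp
  have hbp: "0 < 1 / hi - ?\<beta>" using hb hi1 by (simp add: pos_less_divide_eq mult.commute)
  define hi' where "hi' = 1 / (1 / hi - ?\<beta>)"
  have qb_pt: "lo \<le> q x \<and> q x \<le> hi'" if rx: "lo \<le> r x" "r x \<le> hi" and e: "1 / q x = 1 / r x - ?\<beta>" for x
  proof -
    have "1 / hi \<le> 1 / r x" "1 / r x \<le> 1 / lo" using rx lo1 by (auto intro: divide_left_mono)
    then have 1: "1 / hi - ?\<beta> \<le> 1 / q x" "1 / q x \<le> 1 / lo" using e \<beta> by auto
    then have "0 < 1 / q x" using hbp by linarith
    then have q0: "0 < q x" by (simp add: zero_less_divide_iff)
    have "lo \<le> q x" using 1(2) q0 lo1 by (simp add: field_simps)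
    moreover have "q x \<le> hi'" unfolding hi'_def using 1(1) q0 hbp by (simp add: field_simps)
    ultimately show ?thesis by simp
  qed
  have "AE x in H. x \<in> space H" by simp
  with rb have good: "AE x in H. (lo \<le> r x \<and> r x \<le> hi) \<and> (lo \<le> q x \<and> q x \<le> hi') \<and> 1 / q x = 1 / r x - ?\<beta>"
    by eventually_elim (use qb_pt eq in \<open>auto simp: space_haar\<close>)
  then have qb: "AE x in H. lo \<le> q x \<and> q x \<le> hi'" by eventually_elim simp
  have q: "q \<in> borel_measurable H"
  proof -
    have "q x = 1 / (1 / r x - ?\<beta>)" if "x \<in> space H" for x
    proof -
      \<comment> \<open>By the convention 1 / 0 = 0 this also holds where \<open>q x = 0\<close>, so
        the formula for \<open>q\<close> is valid on the whole space.\<close>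
      have "q x = 1 / (1 / q x)" by simp
      also have "1 / q x = 1 / r x - ?\<beta>" using that unfolding space_haar by (rule eq)
      finally show ?thesis .
    qed
    then have "q \<in> borel_measurable H \<longleftrightarrow> (\<lambda>x. 1 / (1 / r x - ?\<beta>)) \<in> borel_measurable H" by (rule measurable_cong)
    then show ?thesis by simp
  qed
  \<comment> \<open>Outside the exceptional null set the bounds and the relation of r and q hold, so
    they pass to the limits \<open>ri\<close> and \<open>qi\<close>.\<close>
  have "\<forall>k::nat. \<exists>x\<in>space H. ((lo \<le> r x \<and> r x \<le> hi) \<and> (lo \<le> q x \<and> q x \<le> hi') \<and> 1 / q x = 1 / r x - ?\<beta>) \<and> x \<notin> qball p n (int k) (\<lambda>_ _. 0)"
    using AE_far_ex[OF good] by blast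
  then obtain y where y: "\<And>k. y k \<in> Qpn p n" "\<And>k. y k \<notin> qball p n (int k) (\<lambda>_ _. 0)"
    and yg: "\<And>k. lo \<le> r (y k)" "\<And>k. r (y k) \<le> hi" "\<And>k. lo \<le> q (y k)" "\<And>k. q (y k) \<le> hi'" "\<And>k. 1 / q (y k) = 1 / r (y k) - ?\<beta>"
    unfolding space_haar by metis
  obtain ri C1 where ri: "0 \<le> C1" "(\<lambda>k. r (y k)) \<longlonglongrightarrow> ri" "\<And>x. x \<in> Qpn p n \<Longrightarrow> \<bar>r x - ri\<bar> * real (level x) \<le> C1"
    using ClogInf_limit[of r y] cl y by (auto simp: Clog_def)
  obtain qi C2 where qi: "0 \<le> C2" "(\<lambda>k. q (y k)) \<longlonglongrightarrow> qi" "\<And>x. x \<in> Qpn p n \<Longrightarrow> \<bar>q x - qi\<bar> * real (level x) \<le> C2"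
    using ClogInf_limit[of q y] cl y by (auto simp: Clog_def)
  have rib: "lo \<le> ri" "ri \<le> hi" using ri(2) yg by (auto intro: LIMSEQ_le_const LIMSEQ_le_const2)
  have qib: "lo \<le> qi" "qi \<le> hi'" using qi(2) yg by (auto intro: LIMSEQ_le_const LIMSEQ_le_const2)
  have "(\<lambda>k. 1 / q (y k)) \<longlonglongrightarrow> 1 / qi" using qib lo1 by (intro tendsto_intros qi) auto
  moreover have "(\<lambda>k. 1 / r (y k) - ?\<beta>) \<longlonglongrightarrow> 1 / ri - ?\<beta>" using rib lo1 by (intro tendsto_intros ri) auto
  ultimately have lim: "1 / qi = 1 / ri - ?\<beta>" using yg(5) LIMSEQ_unique by simp
  have exponent: "\<exists>C. log_exponent f lo h fi C"
    if f: "f \<in> borel_measurable H" and b: "AE x in H. lo \<le> f x \<and> f x \<le> h" and fi: "lo \<le> fi" "fi \<le> h" and c: "f \<in> Clog0 p n"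
      and C0: "0 \<le> C0" and lev: "\<And>x. x \<in> Qpn p n \<Longrightarrow> \<bar>f x - fi\<bar> * real (level x) \<le> C0" for f h fi C0
  proof -
    obtain C where C: "0 \<le> C" "\<And>\<gamma> z. \<gamma> < 0 \<Longrightarrow> z \<in> space H \<Longrightarrow> \<exists>u. lo \<le> u \<and> u \<le> h \<and>
      (AE y in H. y \<in> qball p n \<gamma> z \<longrightarrow> u \<le> f y \<and> - real_of_int \<gamma> * (f y - u) \<le> C)"
      using Clog0_local[OF f b c] by blast
    have "AE x in H. x \<in> space H" by simp
    with b have "AE x in H. lo \<le> f x \<and> f x \<le> h \<and> \<bar>f x - fi\<bar> * real (level x) \<le> max C C0"
      by eventually_elim (use lev in \<open>auto simp: space_haar intro: max.coboundedI2\<close>)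
    moreover have "\<exists>u. lo \<le> u \<and> u \<le> h \<and> (AE y in H. y \<in> qball p n \<gamma> z \<longrightarrow> u \<le> f y \<and> - real_of_int \<gamma> * (f y - u) \<le> max C C0)"
      if g: "\<gamma> < 0" "z \<in> space H" for \<gamma> z
    proof -
      obtain u where u: "lo \<le> u" "u \<le> h" "AE y in H. y \<in> qball p n \<gamma> z \<longrightarrow> u \<le> f y \<and> - real_of_int \<gamma> * (f y - u) \<le> C"
        using C(2)[OF g] by blast
      have "AE y in H. y \<in> qball p n \<gamma> z \<longrightarrow> u \<le> f y \<and> - real_of_int \<gamma> * (f y - u) \<le> max C C0"
        using u(3) by eventually_elim (auto intro: max.coboundedI1)
      then show ?thesis using u by blast
    qed
    ultimately show ?thesis unfolding log_exponent_def using f fi C(1) by (intro exI[of _ "max C C0"]) auto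
  qed
  obtain C where "log_exponent r lo hi ri C"
    using exponent[OF r rb rib _ ri(1) ri(3)] cl by (auto simp: Clog_def)
  moreover obtain C' where "log_exponent q lo hi' qi C'"
    using exponent[OF q qb qib _ qi(1) qi(3)] cl by (auto simp: Clog_def)
  moreover have "AE x in H. 1 / q x = 1 / r x - ?\<beta>" using good by eventually_elim simp
  ultimately show ?thesis using lo1 lim hb by blast
qed

lemma const_Clog: "(\<lambda>_. c) \<in> Clog p n" and const_ess:
  "A \<in> sets H \<Longrightarrow> emeasure H A \<noteq> 0 \<Longrightarrow> ess_sup_on H A (\<lambda>_. c) = ereal c \<and> ess_inf_on H A (\<lambda>_. c) = ereal c"
proof -
  show ess: "ess_sup_on H A (\<lambda>_. c) = ereal c \<and> ess_inf_on H A (\<lambda>_. c) = ereal c"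
    if A: "A \<in> sets H" "emeasure H A \<noteq> 0" for A c
  proof -
    have "space (restrict_space H A) = A" using A sets.sets_into_space by (force simp: space_restrict_space)
    then have "emeasure (restrict_space H A) (space (restrict_space H A)) \<noteq> 0"
      using A by (subst emeasure_restrict_space) auto
    then show ?thesis unfolding ess_sup_on_def ess_inf_on_def by (simp add: esssup_const)
  qed
  have "ereal (real_of_int \<gamma>) * (ess_inf_on H (qball p n \<gamma> x) (\<lambda>_. c) - ess_sup_on H (qball p n \<gamma> x) (\<lambda>_. c)) \<le> ereal 0"
    if "x \<in> Qpn p n" for \<gamma> x
    using ess[of "qball p n \<gamma> x" c] that ball_sets emeasure_ball[of x \<gamma>] p2 by (simp add: space_haar)
  moreover have "\<bar>c - c\<bar> \<le> 0 / log (real p) (real p + min (Qpn_norm p n x) (Qpn_norm p n y))" for x y by simp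
  ultimately show "(\<lambda>_. c) \<in> Clog p n" unfolding Clog_def Clog0_def ClogInf_def by blast
qed

lemma adm_pair_exists:
  assumes \<alpha>: "0 < \<alpha>" "\<alpha> < real n" shows "\<exists>r q. adm_pair p n \<alpha> r q"
proof -
  have "1 < real n / \<alpha>" using \<alpha> by simp
  then obtain c where c: "1 < c" "c < real n / \<alpha>" using dense by blast
  have S: "Qpn p n \<in> sets H" using sets.top[of H] by (simp add: space_haar)
  have "emeasure H (qball p n 0 (\<lambda>_ _. 0)) \<le> emeasure H (Qpn p n)"
    using ball_subset_space[OF org_space] S by (intro emeasure_mono) (auto simp: space_haar)
  then have nz: "emeasure H (Qpn p n) \<noteq> 0" using emeasure_ball[OF org_space, of 0] p2 by auto
  have "adm_pair p n \<alpha> (\<lambda>_. c) (\<lambda>_. 1 / (1 / c - \<alpha> / real n))"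
    unfolding adm_pair_def exp_P_def using const_ess[OF S nz, of c] const_Clog c by (auto simp: one_ereal_def)
  then show ?thesis by blast
qed

end

section \<open>The equivalences\<close>

context padic_space begin

lemma comm_scale:
  assumes [measurable]: "b \<in> borel_measurable H" "g \<in> borel_measurable H" and c: "0 \<le> c" and x: "x \<in> space H"
  shows "comm \<beta> b (\<lambda>y. c * g y) \<gamma> x = ennreal c * comm \<beta> b g \<gamma> x"
proof -
  have [measurable]: "qball p n \<gamma> x \<in> sets H" using x by (rule ball_sets)
  have "(\<integral>\<^sup>+y\<in>qball p n \<gamma> x. ennreal (\<bar>b x - b y\<bar> * (c * g y)) \<partial>H)
      = (\<integral>\<^sup>+y. ennreal c * (ennreal (\<bar>b x - b y\<bar> * g y) * indicator (qball p n \<gamma> x) y) \<partial>H)"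
    using c by (intro nn_integral_cong) (auto simp: ennreal_mult'[symmetric] mult_ac indicator_def)
  also have "\<dots> = ennreal c * (\<integral>\<^sup>+y\<in>qball p n \<gamma> x. ennreal (\<bar>b x - b y\<bar> * g y) \<partial>H)"
    by (rule nn_integral_cmult) simp
  finally show ?thesis by (simp add: comm_def mult_ac)
qed

lemma bmo_imp_mc_bounded:
  assumes b: "bmo b D" and a: "adm_pair p n \<alpha> r q" and \<alpha>: "0 < \<alpha>" "\<alpha> < real n"
  shows "mc_bounded p n \<alpha> b r q"
proof -
  let ?\<beta> = "\<alpha> / real n"
  have \<beta>0: "0 \<le> ?\<beta>" using \<alpha> by simp
  have bm: "b \<in> borel_measurable H" using b loc_intD by (auto simp: bmo_def)
  obtain lo hi ri C hi' qi C' where E: "1 < lo" "log_exponent r lo hi ri C" "log_exponent q lo hi' qi C'"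
    "AE x in H. 1 / q x = 1 / r x - ?\<beta>" "1 / qi = 1 / ri - ?\<beta>"
    using adm_pair_exponents[OF a \<alpha>] by blast
  obtain K where K: "1 \<le> K" and key: "\<And>g. g \<in> borel_measurable H \<Longrightarrow> (\<And>x. 0 \<le> g x) \<Longrightarrow> (\<integral>\<^sup>+x. ennreal (g x powr r x) \<partial>H) \<le> 1 \<Longrightarrow>
    (\<exists>W\<in>borel_measurable H. (\<integral>\<^sup>+x. W x \<partial>H) \<le> ennreal K \<and>
      (AE x in H. (if (SUP \<gamma>. comm ?\<beta> b g \<gamma> x) = \<top> then \<top> else ennreal (enn2real (SUP \<gamma>. comm ?\<beta> b g \<gamma> x) powr q x)) \<le> W x))"
    using commutator_modular_bounded[OF b E(2,3,4,5) \<beta>0 E(1)] by blast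
  have q1: "AE x in H. 1 \<le> q x" using log_exponentD(5)[OF E(3)] by eventually_elim (use E(1) in auto)
  have "var_norm H q (max_comm p n \<alpha> b f) \<le> ennreal K * var_norm H r (\<lambda>y. ennreal \<bar>f y\<bar>)"
    if f [measurable]: "f \<in> borel_measurable H" for f
  proof (rule var_norm_transfer)
    fix \<eta> :: real assume \<eta>: "0 < \<eta>" "var_modular H r (\<lambda>y. ennreal \<bar>f y\<bar>) \<eta> \<le> 1"
    \<comment> \<open>By homogeneity of the commutator in \<open>f\<close> it suffices to treat
      modular at most 1.\<close>
    define g where "g y = 1 / \<eta> * \<bar>f y\<bar>" for y
    have "(\<integral>\<^sup>+x. ennreal (g x powr r x) \<partial>H) \<le> 1"
      using \<eta>(2) by (subst (asm) var_modular_real) (auto simp: g_def)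
    moreover have "g \<in> borel_measurable H" "\<And>x. 0 \<le> g x" using \<eta>(1) by (auto simp: g_def[abs_def])
    ultimately obtain W where W [measurable]: "W \<in> borel_measurable H" and Wi: "(\<integral>\<^sup>+x. W x \<partial>H) \<le> ennreal K"
      and Wg: "AE x in H. (if (SUP \<gamma>. comm ?\<beta> b g \<gamma> x) = \<top> then \<top> else ennreal (enn2real (SUP \<gamma>. comm ?\<beta> b g \<gamma> x) powr q x)) \<le> W x"
      using key by blast
    show "var_norm H q (max_comm p n \<alpha> b f) \<le> ennreal (K * \<eta>)"
    proof (rule var_norm_upper_scaled[OF \<eta>(1) K q1 W Wi])
      have "AE x in H. x \<in> space H" by simp
      with Wg show "AE x in H. (if max_comm p n \<alpha> b f x = \<top> then \<top> else ennreal ((enn2real (max_comm p n \<alpha> b f x) / \<eta>) powr q x)) \<le> W x"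
      proof eventually_elim
        fix x assume w: "(if (SUP \<gamma>. comm ?\<beta> b g \<gamma> x) = \<top> then \<top> else ennreal (enn2real (SUP \<gamma>. comm ?\<beta> b g \<gamma> x) powr q x)) \<le> W x" and x: "x \<in> space H"
        have S: "(SUP \<gamma>. comm ?\<beta> b g \<gamma> x) = ennreal (1 / \<eta>) * max_comm p n \<alpha> b f x"
        proof -
          have "comm ?\<beta> b g \<gamma> x = ennreal (1 / \<eta>) * comm ?\<beta> b (\<lambda>y. \<bar>f y\<bar>) \<gamma> x" for \<gamma>
            unfolding g_def by (rule comm_scale[OF bm _ _ x]) (use \<eta> in auto)
          then show ?thesis unfolding max_comm_eq by (simp add: SUP_mult_left_ennreal)
        qed
        show "(if max_comm p n \<alpha> b f x = \<top> then \<top> else ennreal ((enn2real (max_comm p n \<alpha> b f x) / \<eta>) powr q x)) \<le> W x"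
        proof (cases "max_comm p n \<alpha> b f x")
          case (real m)
          have e: "(SUP \<gamma>. comm ?\<beta> b g \<gamma> x) = ennreal (m / \<eta>)"
            unfolding S real using \<eta>(1) real by (simp flip: ennreal_mult)
          show ?thesis using w unfolding e using real \<eta>(1) by simp
        next
          case top
          have "(SUP \<gamma>. comm ?\<beta> b g \<gamma> x) = \<top>" unfolding S top using \<eta>(1) by (simp add: ennreal_mult_top)
          then show ?thesis using w by (simp add: top)
        qed
      qed
    qed
  qed (use K in simp)
  then show ?thesis unfolding mc_bounded_def by blast
qed

text \<open>Positivity and finiteness permit cancelling the denominator of the oscillation quotient
  in \<open>ennreal\<close>. Explicit bounds are the minimum and the maximum of 1 and the measure of
  the ball.\<close>

lemma indicator_norm_bounds:
  assumes q: "log_exponent q lo hi qi C" and lo: "1 \<le> lo" and z: "z \<in> space H"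
  shows "0 < var_norm H q (\<lambda>y. ennreal (indicator (qball p n \<gamma> z) y))"
    "var_norm H q (\<lambda>y. ennreal (indicator (qball p n \<gamma> z) y)) < \<top>"
proof -
  let ?v = "(real p powr real n) powr \<gamma>" and ?E = "qball p n \<gamma> z"
  have v: "0 < ?v" using p2 by simp
  have [measurable]: "?E \<in> sets H" using z by (rule ball_sets)
  have const: "(\<integral>\<^sup>+x\<in>?E. ennreal c \<partial>H) = ennreal (c * ?v)" for c
    using z by (simp add: nn_integral_cmult_indicator emeasure_ball ennreal_mult'')
  have "ennreal (min 1 ?v) \<le> var_norm H q (\<lambda>y. ennreal (indicator ?E y))"
    unfolding var_norm_def
  proof (rule INF_greatest)
    fix \<eta> assume "\<eta> \<in> {\<eta>. 0 < \<eta> \<and> var_modular H q (\<lambda>y. ennreal (indicator ?E y)) \<eta> \<le> 1}"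
    then have \<eta>: "0 < \<eta>" "(\<integral>\<^sup>+x\<in>?E. ennreal ((1 / \<eta>) powr q x) \<partial>H) \<le> 1"
      by (auto simp: var_modular_indicator)
    have "min 1 ?v \<le> \<eta>"
    proof (cases "\<eta> < 1")
      case True
      have "ennreal (1 / \<eta> * ?v) \<le> (\<integral>\<^sup>+x\<in>?E. ennreal ((1 / \<eta>) powr q x) \<partial>H)"
        unfolding const[symmetric]
      proof (rule nn_integral_mono_AE, use log_exponentD(5)[OF q] in eventually_elim)
        fix x assume "lo \<le> q x \<and> q x \<le> hi \<and> \<bar>q x - qi\<bar> * real (level x) \<le> C"
        then have "(1 / \<eta>) powr 1 \<le> (1 / \<eta>) powr q x" using True \<eta> lo by (intro powr_mono) auto
        then have "1 / \<eta> \<le> (1 / \<eta>) powr q x" using \<eta> by simp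
        then show "ennreal (1 / \<eta>) * indicator ?E x \<le> ennreal ((1 / \<eta>) powr q x) * indicator ?E x"
          by (intro mult_right_mono ennreal_leI) auto
      qed
      from order_trans[OF this \<eta>(2)] have "1 / \<eta> * ?v \<le> 1" by (simp only: ennreal_le_1)
      then have "?v \<le> \<eta>" using \<eta>(1) by (simp add: field_simps)
      then show ?thesis by simp
    qed simp
    then show "ennreal (min 1 ?v) \<le> ennreal \<eta>" by (rule ennreal_leI)
  qed
  moreover have "0 < ennreal (min 1 ?v)" using v by simp
  ultimately show "0 < var_norm H q (\<lambda>y. ennreal (indicator ?E y))" by (rule less_le_trans[rotated])
  let ?\<eta> = "max 1 ?v"
  have "var_norm H q (\<lambda>y. ennreal (indicator ?E y)) \<le> ennreal ?\<eta>"
  proof (rule var_norm_upper)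
    have "(\<integral>\<^sup>+x\<in>?E. ennreal ((1 / ?\<eta>) powr q x) \<partial>H) \<le> (\<integral>\<^sup>+x\<in>?E. ennreal (1 / ?\<eta>) \<partial>H)"
    proof (rule nn_integral_mono_AE, use log_exponentD(5)[OF q] in eventually_elim)
      fix x assume "lo \<le> q x \<and> q x \<le> hi \<and> \<bar>q x - qi\<bar> * real (level x) \<le> C"
      then have "(1 / ?\<eta>) powr q x \<le> (1 / ?\<eta>) powr 1" using lo by (intro powr_mono') (auto simp: divide_le_eq)
      then have "(1 / ?\<eta>) powr q x \<le> 1 / ?\<eta>" by simp
      then show "ennreal ((1 / ?\<eta>) powr q x) * indicator ?E x \<le> ennreal (1 / ?\<eta>) * indicator ?E x"
        by (intro mult_right_mono ennreal_leI) auto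
    qed
    also have "\<dots> \<le> 1" unfolding const by (simp add: divide_le_eq)
    finally show "var_modular H q (\<lambda>y. ennreal (indicator ?E y)) ?\<eta> \<le> 1" by (simp only: var_modular_indicator)
  qed simp
  then show "var_norm H q (\<lambda>y. ennreal (indicator ?E y)) < \<top>" by (rule le_less_trans) simp
qed

lemma max_comm_indicator_ge:
  assumes b: "loc_int b" and z: "z \<in> space H" and x: "x \<in> qball p n \<gamma> z"
  shows "ennreal (((real p powr real n) powr \<gamma>) powr (\<alpha> / real n) * \<bar>b x - avg \<gamma> b z\<bar>)
    \<le> max_comm p n \<alpha> b (indicator (qball p n \<gamma> z)) x"
proof -
  let ?v = "(real p powr real n) powr \<gamma>" and ?\<beta> = "\<alpha> / real n"
  have v: "0 < ?v" using p2 by simp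
  have xs: "x \<in> space H" using z x by (rule ball_in_space)
  have eq: "qball p n \<gamma> x = qball p n \<gamma> z" using z x by (rule ball_eq)
  have l: "loc_int (\<lambda>y. \<bar>b y - b x\<bar>)" using b by (rule loc_int_const_diff_abs)
  have "\<bar>b x - avg \<gamma> b z\<bar> \<le> avg \<gamma> (\<lambda>y. \<bar>b y - b x\<bar>) x"
    using avg_minus_const_le[OF b xs, of \<gamma> "b x"] avg_eq[OF z x, of b] by (simp add: abs_minus_commute)
  then have "?v powr ?\<beta> * \<bar>b x - avg \<gamma> b z\<bar> \<le> ?v powr ?\<beta> * avg \<gamma> (\<lambda>y. \<bar>b y - b x\<bar>) x" by (intro mult_left_mono) auto
  also have "\<dots> = ?v powr (?\<beta> - 1) * (avg \<gamma> (\<lambda>y. \<bar>b y - b x\<bar>) x * ?v)" using v by (simp add: powr_diff)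
  finally have "ennreal (?v powr ?\<beta> * \<bar>b x - avg \<gamma> b z\<bar>) \<le> ennreal (?v powr (?\<beta> - 1) * (avg \<gamma> (\<lambda>y. \<bar>b y - b x\<bar>) x * ?v))"
    by (rule ennreal_leI)
  also have "\<dots> = ennreal (?v powr (?\<beta> - 1)) * (ennreal (avg \<gamma> (\<lambda>y. \<bar>b y - b x\<bar>) x) * ennreal ?v)"
    by (simp add: ennreal_mult' ennreal_mult'')
  also have "ennreal (avg \<gamma> (\<lambda>y. \<bar>b y - b x\<bar>) x) * ennreal ?v = (\<integral>\<^sup>+y\<in>qball p n \<gamma> x. ennreal \<bar>b y - b x\<bar> \<partial>H)"
    by (rule nn_integral_avg[symmetric]) (use xs loc_intD(2)[OF l] in auto)
  also have "\<dots> = (\<integral>\<^sup>+y\<in>qball p n \<gamma> x. ennreal (\<bar>b x - b y\<bar> * \<bar>indicator (qball p n \<gamma> z) y\<bar>) \<partial>H)"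
    unfolding eq by (intro nn_integral_cong) (auto simp: indicator_def abs_minus_commute)
  also have "ennreal (?v powr (?\<beta> - 1)) * \<dots> = comm ?\<beta> b (\<lambda>y. \<bar>indicator (qball p n \<gamma> z) y\<bar>) \<gamma> x"
    by (simp add: comm_def)
  also have "\<dots> \<le> max_comm p n \<alpha> b (indicator (qball p n \<gamma> z)) x"
    unfolding max_comm_eq by (rule SUP_upper) simp
  finally show ?thesis .
qed

text \<open>With v = |B|^(\<alpha>/n), the oscillation has q-norm at most 1/v times that of the
  maximal commutator of the indicator, hence at most A/v times the r-norm of the indicator. The
  factor v gained in passing to its q-norm cancels.\<close>

lemma mc_bounded_imp_ddagger:
  assumes b: "loc_int b" and a: "adm_pair p n \<alpha> r q" and \<alpha>: "0 < \<alpha>" "\<alpha> < real n" and mc: "mc_bounded p n \<alpha> b r q"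
  shows "ddagger p n b q"
proof -
  let ?\<beta> = "\<alpha> / real n"
  have \<beta>0: "0 \<le> ?\<beta>" using \<alpha> by simp
  obtain lo hi ri C hi' qi C' where E: "1 < lo" "log_exponent r lo hi ri C" "log_exponent q lo hi' qi C'"
    "AE x in H. 1 / q x = 1 / r x - ?\<beta>" "1 / qi = 1 / ri - ?\<beta>" "hi * ?\<beta> < 1"
    using adm_pair_exponents[OF a \<alpha>] by blast
  have lo1: "1 \<le> lo" using E(1) by simp
  have rm [measurable]: "r \<in> borel_measurable H" using log_exponentD(1)[OF E(2)] .
  have q1: "AE x in H. 1 \<le> q x" using log_exponentD(5)[OF E(3)] by eventually_elim (use E(1) in auto)
  have r1: "AE x in H. 1 \<le> r x" using log_exponentD(5)[OF E(2)] by eventually_elim (use E(1) in auto)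
  obtain K where K: "1 \<le> K" and tr: "\<And>\<gamma> z l. z \<in> space H \<Longrightarrow> 0 < l \<Longrightarrow> (\<integral>\<^sup>+x\<in>qball p n \<gamma> z. ennreal (l powr q x) \<partial>H) \<le> 1 \<Longrightarrow>
    (\<integral>\<^sup>+x\<in>qball p n \<gamma> z. ennreal ((l / ((real p powr real n) powr \<gamma>) powr ?\<beta>) powr r x) \<partial>H) \<le> ennreal K"
    using ball_norm_transfer[OF E(2,3,4,5) \<beta>0 E(6) lo1 lo1] by blast
  obtain A where A: "\<And>f. f \<in> borel_measurable H \<Longrightarrow> var_norm H r (\<lambda>y. ennreal \<bar>f y\<bar>) < \<top> \<Longrightarrow>
      var_norm H q (max_comm p n \<alpha> b f) \<le> ennreal A * var_norm H r (\<lambda>y. ennreal \<bar>f y\<bar>)"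
    using mc unfolding mc_bounded_def by blast
  have "var_norm H q (\<lambda>y. ennreal (\<bar>b y - ball_avg p n b \<gamma> z\<bar> * indicator (qball p n \<gamma> z) y))
        / var_norm H q (\<lambda>y. ennreal (indicator (qball p n \<gamma> z) y)) \<le> ennreal A * ennreal K"
    if z: "z \<in> Qpn p n" for \<gamma> z
  proof -
    let ?E = "qball p n \<gamma> z"
    have zs: "z \<in> space H" using z by (simp add: space_haar)
    have Es [measurable]: "?E \<in> sets H" using zs by (rule ball_sets)
    define v where "v = ((real p powr real n) powr \<gamma>) powr ?\<beta>"
    have v: "0 < v" using p2 by (simp add: v_def)
    let ?Vq = "var_norm H q (\<lambda>y. ennreal (indicator ?E y))" and ?Vr = "var_norm H r (\<lambda>y. ennreal (indicator ?E y))"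
    note Vq = indicator_norm_bounds[OF E(3) lo1 zs, of \<gamma>]
    \<comment> \<open>An admissible \<open>\<eta>\<close> for the q-norm corresponds to
      \<open>l = 1 / \<eta>\<close> in \<open>ball_norm_transfer\<close>.\<close>
    have rq: "?Vr \<le> ennreal (K * v) * ?Vq"
    proof (rule var_norm_transfer)
      fix \<eta> :: real assume \<eta>: "0 < \<eta>" "var_modular H q (\<lambda>y. ennreal (indicator ?E y)) \<eta> \<le> 1"
      have W: "(\<integral>\<^sup>+x\<in>?E. ennreal ((1 / \<eta> / v) powr r x) \<partial>H) \<le> ennreal K"
        unfolding v_def by (rule tr[OF zs]) (use \<eta> in \<open>auto simp: var_modular_indicator\<close>)
      have "?Vr \<le> ennreal (K * (\<eta> * v))"
      proof (rule var_norm_upper_scaled[OF _ K r1 _ W])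
        show "AE x in H. (if ennreal (indicator ?E x) = \<top> then \<top> else ennreal ((enn2real (ennreal (indicator ?E x)) / (\<eta> * v)) powr r x))
          \<le> ennreal ((1 / \<eta> / v) powr r x) * indicator ?E x"
          by (intro AE_I2) (auto simp: indicator_def)
      qed (use \<eta> v in auto)
      then show "?Vr \<le> ennreal (K * v * \<eta>)" by (simp add: mult_ac)
    qed (use K v in simp)
    have abs_ind: "(\<lambda>y. ennreal \<bar>indicator ?E y\<bar>) = (\<lambda>y. ennreal (indicator ?E y))" by simp
    have "ennreal (K * v) * ?Vq < \<top>" using Vq by (simp add: ennreal_mult_less_top)
    then have Vr: "?Vr < \<top>" using rq by (rule le_less_trans[rotated])
    have M: "var_norm H q (max_comm p n \<alpha> b (indicator ?E)) \<le> ennreal A * ?Vr"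
      using A[of "indicator ?E"] Vr by (simp add: abs_ind)
    let ?a = "var_norm H q (\<lambda>y. ennreal (\<bar>b y - ball_avg p n b \<gamma> z\<bar> * indicator ?E y))"
    have "?a \<le> ennreal (1 / v) * var_norm H q (max_comm p n \<alpha> b (indicator ?E))"
    proof (rule var_norm_transfer)
      fix \<eta> :: real assume \<eta>: "0 < \<eta>" "var_modular H q (max_comm p n \<alpha> b (indicator ?E)) \<eta> \<le> 1"
      show "?a \<le> ennreal (1 / v * \<eta>)"
      proof (rule var_norm_upper)
        have "var_modular H q (\<lambda>y. ennreal (\<bar>b y - ball_avg p n b \<gamma> z\<bar> * indicator ?E y)) (1 / v * \<eta>)
          \<le> var_modular H q (max_comm p n \<alpha> b (indicator ?E)) \<eta>"
          unfolding var_modular_def[of H q "max_comm p n \<alpha> b (indicator ?E)"]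
        proof (subst var_modular_real, simp, rule nn_integral_mono_AE, use q1 in eventually_elim)
          fix x assume q: "1 \<le> q x"
          let ?F = "max_comm p n \<alpha> b (indicator ?E) x"
          show "ennreal ((\<bar>b x - ball_avg p n b \<gamma> z\<bar> * indicator ?E x / (1 / v * \<eta>)) powr q x)
            \<le> (if ?F = \<top> then \<top> else ennreal ((enn2real ?F / \<eta>) powr q x))"
          proof (cases "x \<in> ?E")
            case True
            show ?thesis
            proof (cases ?F)
              case (real m)
              have "ennreal (v * \<bar>b x - ball_avg p n b \<gamma> z\<bar>) \<le> ennreal m"
                using max_comm_indicator_ge[OF b zs True, of \<alpha>] real z by (simp add: ball_avg_eq v_def)
              then have "v * \<bar>b x - ball_avg p n b \<gamma> z\<bar> \<le> m" using real(1) by (simp add: ennreal_le_iff)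
              then have "v * \<bar>b x - ball_avg p n b \<gamma> z\<bar> / \<eta> \<le> m / \<eta>" using \<eta> by (intro divide_right_mono) auto
              then have "(v * \<bar>b x - ball_avg p n b \<gamma> z\<bar> / \<eta>) powr q x \<le> (m / \<eta>) powr q x"
                using q v \<eta> by (intro powr_mono2) auto
              then show ?thesis using True real v \<eta> by (simp add: mult.commute ennreal_leI)
            qed simp
          qed simp
        qed
        then show "var_modular H q (\<lambda>y. ennreal (\<bar>b y - ball_avg p n b \<gamma> z\<bar> * indicator ?E y)) (1 / v * \<eta>) \<le> 1"
          using \<eta>(2) by (rule order_trans)
      qed (use \<eta> v in simp)
    qed (use v in simp)
    also have "\<dots> \<le> ennreal (1 / v) * (ennreal A * (ennreal (K * v) * ?Vq))"
      by (intro mult_left_mono order_trans[OF M] rq) auto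
    also have "\<dots> = ennreal A * ennreal K * ?Vq"
    proof -
      have "ennreal (1 / v) * ennreal (K * v) = ennreal K" using v K by (simp flip: ennreal_mult)
      moreover have "x * (a * (y * w)) = a * (x * y) * w" for x a y w :: ennreal by (simp only: ac_simps)
      ultimately show ?thesis by simp
    qed
    finally have "?a / ?Vq \<le> ennreal A * ennreal K * ?Vq / ?Vq" by (rule divide_right_mono_ennreal)
    also have "\<dots> = ennreal A * ennreal K" using Vq by (intro mult_divide_eq_ennreal) auto
    finally show ?thesis .
  qed
  then have "(SUP (\<gamma>, x)\<in>UNIV \<times> Qpn p n.
        var_norm H q (\<lambda>y. ennreal (\<bar>b y - ball_avg p n b \<gamma> x\<bar> * indicator (qball p n \<gamma> x) y))
        / var_norm H q (\<lambda>y. ennreal (indicator (qball p n \<gamma> x) y))) \<le> ennreal A * ennreal K"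
    by (intro SUP_least) auto
  also have "\<dots> < \<top>" by (simp add: ennreal_mult_less_top)
  finally show ?thesis unfolding ddagger_def .
qed

text \<open>Let t be the mean of h = |b - b_B| restricted to B. Averaging is bounded on the modular,
  so t times the norm of the indicator of B is at most \<open>K\<close> times the norm of h, which
  the hypothesis bounds by \<open>A\<close> times the norm of the indicator. Cancelling gives t
  \<le> \<open>K * A\<close>.\<close>

lemma ddagger_imp_bmo:
  assumes b: "loc_int b" and a: "adm_pair p n \<alpha> r q" and \<alpha>: "0 < \<alpha>" "\<alpha> < real n" and dd: "ddagger p n b q"
  shows "\<exists>D. bmo b D"
proof -
  have bm [measurable]: "b \<in> borel_measurable H" using b loc_intD by auto
  obtain lo hi' qi C' where E: "1 < lo" "log_exponent q lo hi' qi C'"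
    using adm_pair_exponents[OF a \<alpha>] by blast
  have lo1: "1 \<le> lo" using E(1) by simp
  have qm [measurable]: "q \<in> borel_measurable H" using log_exponentD(1)[OF E(2)] .
  have q1: "AE x in H. 1 \<le> q x" using log_exponentD(5)[OF E(2)] by eventually_elim (use E(1) in auto)
  obtain K where K: "1 \<le> K" and key: "\<And>f \<gamma> z. f \<in> borel_measurable H \<Longrightarrow> (\<And>x. 0 \<le> f x) \<Longrightarrow> (\<integral>\<^sup>+x. ennreal (f x powr q x) \<partial>H) \<le> 1 \<Longrightarrow>
    z \<in> space H \<Longrightarrow> (\<integral>\<^sup>+x\<in>qball p n \<gamma> z. ennreal (avg \<gamma> f z powr q x) \<partial>H) \<le> ennreal K"
    using average_modular_bounded[OF E(2) lo1] by blast
  obtain A where A: "0 \<le> A" "\<And>\<gamma> z. z \<in> Qpn p n \<Longrightarrow> var_norm H q (\<lambda>y. ennreal (\<bar>b y - ball_avg p n b \<gamma> z\<bar> * indicator (qball p n \<gamma> z) y))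
        / var_norm H q (\<lambda>y. ennreal (indicator (qball p n \<gamma> z) y)) \<le> ennreal A"
  proof -
    let ?S = "SUP (\<gamma>, x)\<in>UNIV \<times> Qpn p n.
        var_norm H q (\<lambda>y. ennreal (\<bar>b y - ball_avg p n b \<gamma> x\<bar> * indicator (qball p n \<gamma> x) y))
        / var_norm H q (\<lambda>y. ennreal (indicator (qball p n \<gamma> x) y))"
    have "?S < \<top>" using dd unfolding ddagger_def .
    then obtain A where A: "0 \<le> A" "?S = ennreal A" by (cases ?S) auto
    have le: "var_norm H q (\<lambda>y. ennreal (\<bar>b y - ball_avg p n b \<gamma> z\<bar> * indicator (qball p n \<gamma> z) y))
        / var_norm H q (\<lambda>y. ennreal (indicator (qball p n \<gamma> z) y)) \<le> ?S" if "z \<in> Qpn p n" for \<gamma> z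
      using that by (intro SUP_upper2[of "(\<gamma>, z)"]) auto
    show ?thesis by (rule that[OF A(1)]) (rule le[unfolded A(2)])
  qed
  have "avg \<gamma> (\<lambda>y. \<bar>b y - avg \<gamma> b z\<bar>) z \<le> K * A" if z: "z \<in> space H" for \<gamma> z
  proof -
    let ?E = "qball p n \<gamma> z"
    have zQ: "z \<in> Qpn p n" using z by (simp add: space_haar)
    have Es [measurable]: "?E \<in> sets H" using z by (rule ball_sets)
    define h where "h y = \<bar>b y - avg \<gamma> b z\<bar> * indicator ?E y" for y
    have [measurable]: "h \<in> borel_measurable H" unfolding h_def[abs_def] by measurable
    have h0: "0 \<le> h y" for y by (simp add: h_def)
    let ?a = "var_norm H q (\<lambda>y. ennreal (h y))" and ?V = "var_norm H q (\<lambda>y. ennreal (indicator ?E y))"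
    note V = indicator_norm_bounds[OF E(2) lo1 z, of \<gamma>]
    have "?a / ?V \<le> ennreal A" using A(2)[OF zQ, of \<gamma>] by (simp add: h_def ball_avg_eq[OF zQ])
    then have "?a / ?V * ?V \<le> ennreal A * ?V" by (rule mult_right_mono) simp
    moreover have "?a / ?V * ?V = ?a" using V by (simp add: ennreal_divide_times)
    ultimately have aV: "?a \<le> ennreal A * ?V" by simp
    define t where "t = avg \<gamma> (\<lambda>y. \<bar>b y - avg \<gamma> b z\<bar>) z"
    have th: "avg \<gamma> h z = t"
      unfolding t_def avg_def set_lebesgue_integral_def h_def
      by (intro arg_cong2[where f="(/)"] Bochner_Integration.integral_cong refl) (auto simp: indicator_def)
    show "avg \<gamma> (\<lambda>y. \<bar>b y - avg \<gamma> b z\<bar>) z \<le> K * A"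
    proof (cases "0 < t")
      case False
      then show ?thesis using K A(1) unfolding t_def by (meson mult_nonneg_nonneg not_less order_trans zero_le_one)
    next
      case t0: True
      have "?V \<le> ennreal (K / t) * ?a"
      proof (rule var_norm_transfer)
        fix \<eta> :: real assume \<eta>: "0 < \<eta>" "var_modular H q (\<lambda>y. ennreal (h y)) \<eta> \<le> 1"
        have "(\<integral>\<^sup>+x. ennreal ((1 / \<eta> * h x) powr q x) \<partial>H) \<le> 1"
          using \<eta>(2) h0 by (subst (asm) var_modular_real) auto
        then have W: "(\<integral>\<^sup>+x\<in>?E. ennreal ((1 / \<eta> * t) powr q x) \<partial>H) \<le> ennreal K"
          using key[of "\<lambda>x. 1 / \<eta> * h x" z \<gamma>] \<eta>(1) h0 z by (simp add: avg_cmult[of _ "1 / \<eta>", simplified] th)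
        have "?V \<le> ennreal (K * (\<eta> / t))"
        proof (rule var_norm_upper_scaled[OF _ K q1 _ W])
          show "AE x in H. (if ennreal (indicator ?E x) = \<top> then \<top> else ennreal ((enn2real (ennreal (indicator ?E x)) / (\<eta> / t)) powr q x))
            \<le> ennreal ((1 / \<eta> * t) powr q x) * indicator ?E x"
            by (intro AE_I2) (auto simp: indicator_def)
        qed (use \<eta> t0 in auto)
        then show "?V \<le> ennreal (K / t * \<eta>)" by simp
      qed (use K t0 in simp)
      also have "\<dots> \<le> ennreal (K / t) * (ennreal A * ?V)" by (intro mult_left_mono aV) simp
      also have "\<dots> = ennreal (K / t * A) * ?V" using K t0 A(1) by (subst ennreal_mult) (auto simp only: mult.assoc zero_le_divide_iff less_imp_le order_trans[OF zero_le_one])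
      finally have le: "?V \<le> ennreal (K / t * A) * ?V" .
      \<comment> \<open>The norm of the indicator is a positive real number, so it can be
        cancelled.\<close>
      obtain w where w: "?V = ennreal w" "0 < w" using V by (cases ?V) auto
      have "ennreal w \<le> ennreal (K / t * A * w)" using le less_imp_le[OF w(2)] unfolding w(1) by (simp only: ennreal_mult'')
      then have "w \<le> K / t * A * w" using w(2) K t0 A(1) by (subst (asm) ennreal_le_iff) auto
      then have "1 * w \<le> (K / t * A) * w" by simp
      then have "1 \<le> K / t * A" using w(2) by (rule mult_right_le_imp_le)
      then have "t \<le> K * A" using t0 by (simp add: field_simps)
      then show ?thesis by (simp add: t_def)
    qed
  qed
  then show ?thesis using b unfolding bmo_def by blast
qed

end

theorem theorem2:
  fixes p n :: nat and \<alpha> :: real and b :: "(nat \<Rightarrow> int \<Rightarrow> nat) \<Rightarrow> real"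
  assumes "prime p" and "0 < \<alpha>" and "\<alpha> < real n" and "loc_integrable p n b"
  defines "T1 \<equiv> b \<in> BMO p n"
      and "T2 \<equiv> (\<forall>r q. adm_pair p n \<alpha> r q \<longrightarrow> mc_bounded p n \<alpha> b r q)"
      and "T3 \<equiv> (\<exists>r q. adm_pair p n \<alpha> r q \<and> mc_bounded p n \<alpha> b r q)"
      and "T4 \<equiv> (\<exists>r q. adm_pair p n \<alpha> r q \<and> ddagger p n b q)"
      and "T5 \<equiv> (\<forall>r q. adm_pair p n \<alpha> r q \<longrightarrow> ddagger p n b q)"
  shows "(T1 \<longleftrightarrow> T2) \<and> (T1 \<longleftrightarrow> T3) \<and> (T1 \<longleftrightarrow> T4) \<and> (T1 \<longleftrightarrow> T5)"
proof -
  interpret padic_space p n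
    using assms(1-3) by unfold_locales (auto intro: prime_ge_2_nat)
  have b: "loc_int b" using assms(4) by (simp add: loc_int_iff)
  obtain r q where rq: "adm_pair p n \<alpha> r q" using adm_pair_exists[OF assms(2,3)] by blast
  have 12: "T1 \<Longrightarrow> T2"
    unfolding T1_def T2_def BMO_iff using bmo_imp_mc_bounded[OF _ _ assms(2,3)] by blast
  have 23: "T2 \<Longrightarrow> T3" and 54: "T5 \<Longrightarrow> T4"
    unfolding T2_def T3_def T4_def T5_def using rq by blast+
  have 25: "T2 \<Longrightarrow> T5" and 34: "T3 \<Longrightarrow> T4"
    unfolding T2_def T3_def T4_def T5_def using mc_bounded_imp_ddagger[OF b _ assms(2,3)] by blast+
  have 41: "T4 \<Longrightarrow> T1"
    unfolding T1_def T4_def BMO_iff using ddagger_imp_bmo[OF b _ assms(2,3)] by blast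
  show ?thesis using 12 23 25 34 41 54 by blast
qed

end
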